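(* Let $\mathcal{E}$ be a category with finite limits. Then $(\mathbf{Poly}_{\mathcal{E}},y,\triangleleft)$ is a monoidal category, with unit the identity polynomial $y$ and monoidal product the composition product $\triangleleft$.
   Context: For $f\colon B\to A$ in $\mathcal{E}$, $\Delta_f\colon\mathcal{E}/A\to\mathcal{E}/B$ denotes pullback along $f$. The morphism $f$ is exponentiable if $\Delta_f$ has a right adjoint $\Pi_f$. A polynomial in $\mathcal{E}$ is an exponentiable morphism $p\colon P_*\to P$. A morphism of polynomials $\phi\colon p\to q$ is a pair $\phi_1\colon P\to Q$, $\phi^\sharp\colon P\times_Q Q_*\to P_*$ with $p\circ\phi^\sharp$ the projection to $P$, up to isomorphism of the choice of pullback. Identities are the evident ones, and $(\psi\circ\phi)_1=\psi_1\circ\phi_1$, $(\psi\circ\phi)^\sharp=\phi^\sharp\circ(P\times_Q\psi^\sharp)$ for $\phi\colon p\to q$, $\psi\colon q\to r$ (using $P\times_R R_*\cong P\times_Q(Q\times_R R_* )$). This gives the category $\mathbf{Poly}_{\mathcal{E}}$. The identity polynomial $y$ is $\mathrm{id}_1\colon 1\to1$, for $1$ the terminal object. The composition product $p\triangleleft q$ is the polynomial given by the composite of projections $$(\Pi_p(Q\times P_* )\times_P P_* )\times_Q Q_*\to\Pi_p(Q\times P_* )\times_P P_*\to\Pi_p(Q\times P_* ),$$ where $Q\times P_*$ lies over $P_*$ by projection and $\Pi_p(Q\times P_* )\times_P P_*\to Q$ is the counit of $\Delta_p\dashv\Pi_p$ (landing in $Q\times P_*$) followed by projection. It is exponentiable,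 since exponentiable morphisms are closed under pullback and composition. In terms of generalized elements: a map $X\to\Pi_p(Q\times P_* )$ is a pair $(x\colon X\to P,\ f\colon X\times_P P_*\to Q)$, and a direction at $(x,f)$ is a pair $(y,z)$ with $y\colon X\to P_*$ over $x$ and $z\colon X\to Q_*$ over $f(y)$. On morphisms $\phi\colon p\to p'$, $\psi\colon q\to q'$, the morphism $\phi\triangleleft\psi$ sends the position $(x,f)$ to $(\phi_1x,\ \psi_1\circ f\circ\phi^\sharp(x,-))$, and sends a direction $(y',z')$ at the latter to $(\phi^\sharp(x,y'),\ \psi^\sharp(f(\phi^\sharp(x,y')),z'))$. Associators and unitors are the canonical isomorphisms determined by these universal properties. *)

theory Defs
  imports Main
begin

section \<open>Categories, functors, adjunctions, limits\<close>

record ('o, 'm) cat =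
  Obj :: "'o set"
  Arr :: "'m set"
  Dom :: "'m \<Rightarrow> 'o"
  Cod :: "'m \<Rightarrow> 'o"
  Ident :: "'o \<Rightarrow> 'm"
  Comp :: "'m \<Rightarrow> 'm \<Rightarrow> 'm"  (infixr "\<cdot>\<index>" 70)

text \<open>\<open>g \<cdot>\<^bsub>C\<^esub> f\<close> is "\<open>g\<close> after \<open>f\<close>".
  All operations are meaningful only on the carriers.\<close>

definition hom :: "('o, 'm) cat \<Rightarrow> 'o \<Rightarrow> 'o \<Rightarrow> 'm set" where
  "hom C a b = {f \<in> Arr C. Dom C f = a \<and> Cod C f = b}"

definition category :: "('o, 'm) cat \<Rightarrow> bool" where
  "category C \<longleftrightarrow>
     (\<forall>f\<in>Arr C. Dom C f \<in> Obj C \<and> Cod C f \<in> Obj C) \<and>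
     (\<forall>a\<in>Obj C. Ident C a \<in> hom C a a) \<and>
     (\<forall>f\<in>Arr C. \<forall>g\<in>Arr C. Cod C f = Dom C g \<longrightarrow>
        g \<cdot>\<^bsub>C\<^esub> f \<in> hom C (Dom C f) (Cod C g)) \<and>
     (\<forall>f\<in>Arr C. f \<cdot>\<^bsub>C\<^esub> Ident C (Dom C f) = f \<and> Ident C (Cod C f) \<cdot>\<^bsub>C\<^esub> f = f) \<and>
     (\<forall>f\<in>Arr C. \<forall>g\<in>Arr C. \<forall>h\<in>Arr C. Cod C f = Dom C g \<and> Cod C g = Dom C h \<longrightarrow>
        h \<cdot>\<^bsub>C\<^esub> (g \<cdot>\<^bsub>C\<^esub> f) = (h \<cdot>\<^bsub>C\<^esub> g) \<cdot>\<^bsub>C\<^esub> f)"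

definition is_iso :: "('o, 'm) cat \<Rightarrow> 'm \<Rightarrow> bool" where
  "is_iso C f \<longleftrightarrow> f \<in> Arr C \<and>
     (\<exists>g \<in> hom C (Cod C f) (Dom C f).
        g \<cdot>\<^bsub>C\<^esub> f = Ident C (Dom C f) \<and> f \<cdot>\<^bsub>C\<^esub> g = Ident C (Cod C f))"

definition prod_cat :: "('o1, 'm1) cat \<Rightarrow> ('o2, 'm2) cat \<Rightarrow> ('o1 \<times> 'o2, 'm1 \<times> 'm2) cat" where
  "prod_cat C D =
     \<lparr> Obj = Obj C \<times> Obj D,
       Arr = Arr C \<times> Arr D,
       Dom = (\<lambda>(f, g). (Dom C f, Dom D g)),
       Cod = (\<lambda>(f, g). (Cod C f, Cod D g)),
       Ident = (\<lambda>(a, b). (Ident C a, Ident D b)),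
       Comp = (\<lambda>(f', g') (f, g). (f' \<cdot>\<^bsub>C\<^esub> f, g' \<cdot>\<^bsub>D\<^esub> g)) \<rparr>"

record ('o1, 'm1, 'o2, 'm2) func =
  FObj :: "'o1 \<Rightarrow> 'o2"
  FArr :: "'m1 \<Rightarrow> 'm2"

definition is_functor ::
  "('o1, 'm1) cat \<Rightarrow> ('o2, 'm2) cat \<Rightarrow> ('o1, 'm1, 'o2, 'm2) func \<Rightarrow> bool" where
  "is_functor C D F \<longleftrightarrow> category C \<and> category D \<and>
     (\<forall>a\<in>Obj C. FObj F a \<in> Obj D) \<and>
     (\<forall>f\<in>Arr C. FArr F f \<in> hom D (FObj F (Dom C f)) (FObj F (Cod C f))) \<and>
     (\<forall>a\<in>Obj C. FArr F (Ident C a) = Ident D (FObj F a)) \<and>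
     (\<forall>f\<in>Arr C. \<forall>g\<in>Arr C. Cod C f = Dom C g \<longrightarrow>
        FArr F (g \<cdot>\<^bsub>C\<^esub> f) = FArr F g \<cdot>\<^bsub>D\<^esub> FArr F f)"

definition id_func :: "('o, 'm, 'o, 'm) func" where
  "id_func = \<lparr> FObj = (\<lambda>a. a), FArr = (\<lambda>f. f) \<rparr>"

definition comp_func ::
  "('o2, 'm2, 'o3, 'm3) func \<Rightarrow> ('o1, 'm1, 'o2, 'm2) func \<Rightarrow> ('o1, 'm1, 'o3, 'm3) func" where
  "comp_func G F = \<lparr> FObj = (\<lambda>a. FObj G (FObj F a)), FArr = (\<lambda>f. FArr G (FArr F f)) \<rparr>"

definition is_nat_trans ::
  "('o1, 'm1) cat \<Rightarrow> ('o2, 'm2) cat \<Rightarrow> ('o1, 'm1, 'o2, 'm2) func \<Rightarrow> ('o1, 'm1, 'o2, 'm2) func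
    \<Rightarrow> ('o1 \<Rightarrow> 'm2) \<Rightarrow> bool" where
  "is_nat_trans C D F G \<eta> \<longleftrightarrow>
     (\<forall>a\<in>Obj C. \<eta> a \<in> hom D (FObj F a) (FObj G a)) \<and>
     (\<forall>f\<in>Arr C. \<eta> (Cod C f) \<cdot>\<^bsub>D\<^esub> FArr F f = FArr G f \<cdot>\<^bsub>D\<^esub> \<eta> (Dom C f))"

text \<open>\<open>is_adjunction C D F G \<eta> \<epsilon>\<close>: \<open>F : C \<rightarrow> D\<close> is left adjoint to \<open>G : D \<rightarrow> C\<close>
  with unit \<open>\<eta>\<close> and counit \<open>\<epsilon>\<close>.\<close>

definition is_adjunction ::
  "('o1, 'm1) cat \<Rightarrow> ('o2, 'm2) cat \<Rightarrow> ('o1, 'm1, 'o2, 'm2) func \<Rightarrow> ('o2, 'm2, 'o1, 'm1) func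
    \<Rightarrow> ('o1 \<Rightarrow> 'm1) \<Rightarrow> ('o2 \<Rightarrow> 'm2) \<Rightarrow> bool" where
  "is_adjunction C D F G \<eta> \<epsilon> \<longleftrightarrow>
     is_functor C D F \<and> is_functor D C G \<and>
     is_nat_trans C C id_func (comp_func G F) \<eta> \<and>
     is_nat_trans D D (comp_func F G) id_func \<epsilon> \<and>
     (\<forall>a\<in>Obj C. \<epsilon> (FObj F a) \<cdot>\<^bsub>D\<^esub> FArr F (\<eta> a) = Ident D (FObj F a)) \<and>
     (\<forall>b\<in>Obj D. FArr G (\<epsilon> b) \<cdot>\<^bsub>C\<^esub> \<eta> (FObj G b) = Ident C (FObj G b))"

definition is_cone ::
  "('j, 'k) cat \<Rightarrow> ('o, 'm) cat \<Rightarrow> ('j, 'k, 'o, 'm) func \<Rightarrow> 'o \<Rightarrow> ('j \<Rightarrow> 'm) \<Rightarrow> bool" where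
  "is_cone J C D x \<pi> \<longleftrightarrow> x \<in> Obj C \<and>
     (\<forall>j\<in>Obj J. \<pi> j \<in> hom C x (FObj D j)) \<and>
     (\<forall>u\<in>Arr J. FArr D u \<cdot>\<^bsub>C\<^esub> \<pi> (Dom J u) = \<pi> (Cod J u))"

definition is_limit ::
  "('j, 'k) cat \<Rightarrow> ('o, 'm) cat \<Rightarrow> ('j, 'k, 'o, 'm) func \<Rightarrow> 'o \<Rightarrow> ('j \<Rightarrow> 'm) \<Rightarrow> bool" where
  "is_limit J C D L \<pi> \<longleftrightarrow> is_cone J C D L \<pi> \<and>
     (\<forall>x \<sigma>. is_cone J C D x \<sigma> \<longrightarrow>
        (\<exists>!h. h \<in> hom C x L \<and> (\<forall>j\<in>Obj J. \<pi> j \<cdot>\<^bsub>C\<^esub> h = \<sigma> j)))"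

text \<open>Every finite category is isomorphic to one whose objects and arrows are natural numbers,
  so it suffices to let the shapes range over those.\<close>

definition has_finite_limits :: "('o, 'm) cat \<Rightarrow> bool" where
  "has_finite_limits C \<longleftrightarrow>
     (\<forall>(J :: (nat, nat) cat) D.
        finite (Obj J) \<and> finite (Arr J) \<and> is_functor J C D \<longrightarrow> (\<exists>L \<pi>. is_limit J C D L \<pi>))"


section \<open>Monoidal categories\<close>

text \<open>\<open>\<alpha> a b c : (a \<otimes> b) \<otimes> c \<rightarrow> a \<otimes> (b \<otimes> c)\<close>, \<open>l a : i \<otimes> a \<rightarrow> a\<close>, \<open>r a : a \<otimes> i \<rightarrow> a\<close>.\<close>

definition monoidal_category ::
  "('o, 'm) cat \<Rightarrow> ('o \<times> 'o, 'm \<times> 'm, 'o, 'm) func \<Rightarrow> 'o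
    \<Rightarrow> ('o \<Rightarrow> 'o \<Rightarrow> 'o \<Rightarrow> 'm) \<Rightarrow> ('o \<Rightarrow> 'm) \<Rightarrow> ('o \<Rightarrow> 'm) \<Rightarrow> bool" where
  "monoidal_category C T i \<alpha> l r \<longleftrightarrow>
    (let ten = (\<lambda>a b. FObj T (a, b)); tenA = (\<lambda>f g. FArr T (f, g)) in
     category C \<and>
     is_functor (prod_cat C C) C T \<and>
     i \<in> Obj C \<and>
     (\<forall>a\<in>Obj C. \<forall>b\<in>Obj C. \<forall>c\<in>Obj C.
        \<alpha> a b c \<in> hom C (ten (ten a b) c) (ten a (ten b c)) \<and> is_iso C (\<alpha> a b c)) \<and>
     (\<forall>a\<in>Obj C. l a \<in> hom C (ten i a) a \<and> is_iso C (l a)) \<and>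
     (\<forall>a\<in>Obj C. r a \<in> hom C (ten a i) a \<and> is_iso C (r a)) \<and>
     (\<forall>f\<in>Arr C. \<forall>g\<in>Arr C. \<forall>h\<in>Arr C.
        \<alpha> (Cod C f) (Cod C g) (Cod C h) \<cdot>\<^bsub>C\<^esub> tenA (tenA f g) h
        = tenA f (tenA g h) \<cdot>\<^bsub>C\<^esub> \<alpha> (Dom C f) (Dom C g) (Dom C h)) \<and>
     (\<forall>f\<in>Arr C. l (Cod C f) \<cdot>\<^bsub>C\<^esub> tenA (Ident C i) f = f \<cdot>\<^bsub>C\<^esub> l (Dom C f)) \<and>
     (\<forall>f\<in>Arr C. r (Cod C f) \<cdot>\<^bsub>C\<^esub> tenA f (Ident C i) = f \<cdot>\<^bsub>C\<^esub> r (Dom C f)) \<and>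
     (\<forall>a\<in>Obj C. \<forall>b\<in>Obj C. \<forall>c\<in>Obj C. \<forall>d\<in>Obj C.
        \<alpha> a b (ten c d) \<cdot>\<^bsub>C\<^esub> \<alpha> (ten a b) c d
        = tenA (Ident C a) (\<alpha> b c d) \<cdot>\<^bsub>C\<^esub> \<alpha> a (ten b c) d \<cdot>\<^bsub>C\<^esub> tenA (\<alpha> a b c) (Ident C d)) \<and>
     (\<forall>a\<in>Obj C. \<forall>b\<in>Obj C.
        tenA (Ident C a) (l b) \<cdot>\<^bsub>C\<^esub> \<alpha> a i b = tenA (r a) (Ident C b)))"


section \<open>Polynomials\<close>

text \<open>\<open>Slice f h g\<close> is \<open>h\<close> regarded as an arrow from \<open>f\<close> to \<open>g\<close> in a slice category.\<close>

datatype 'm slice_arr = Slice (slice_src: 'm) (slice_map: 'm) (slice_tgt: 'm)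

text \<open>\<open>Poly_arr p q \<phi>\<^sub>1 \<phi>\<^sub>2\<close> is the morphism \<open>p \<rightarrow> q\<close> with \<open>\<phi>\<^sub>1\<close> on positions and
  \<open>\<phi>\<^sub>2 = \<phi>\<^sup>\<sharp>\<close> on directions.\<close>

datatype 'm poly_arr =
  Poly_arr (poly_src: 'm) (poly_tgt: 'm) (on_pos: 'm) (on_dir: 'm)

context
  fixes E :: "('o, 'm) cat" (structure)
begin

subsection \<open>Chosen finite limits\<close>

definition is_terminal :: "'o \<Rightarrow> bool" where
  "is_terminal t \<longleftrightarrow> t \<in> Obj E \<and> (\<forall>x\<in>Obj E. \<exists>!h. h \<in> hom E x t)"

definition is_product :: "'o \<Rightarrow> 'o \<Rightarrow> 'm \<Rightarrow> 'm \<Rightarrow> bool" where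
  "is_product a b p1 p2 \<longleftrightarrow>
     p1 \<in> Arr E \<and> p2 \<in> Arr E \<and> Dom E p1 = Dom E p2 \<and> Cod E p1 = a \<and> Cod E p2 = b \<and>
     (\<forall>x. \<forall>u \<in> hom E x a. \<forall>v \<in> hom E x b.
        \<exists>!h. h \<in> hom E x (Dom E p1) \<and> p1 \<cdot> h = u \<and> p2 \<cdot> h = v)"

definition is_pullback :: "'m \<Rightarrow> 'm \<Rightarrow> 'm \<Rightarrow> 'm \<Rightarrow> bool" where
  "is_pullback f g p1 p2 \<longleftrightarrow>
     p1 \<in> Arr E \<and> p2 \<in> Arr E \<and> Dom E p1 = Dom E p2 \<and>
     Cod E p1 = Dom E f \<and> Cod E p2 = Dom E g \<and> f \<cdot> p1 = g \<cdot> p2 \<and>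
     (\<forall>x. \<forall>u \<in> hom E x (Dom E f). \<forall>v \<in> hom E x (Dom E g). f \<cdot> u = g \<cdot> v \<longrightarrow>
        (\<exists>!h. h \<in> hom E x (Dom E p1) \<and> p1 \<cdot> h = u \<and> p2 \<cdot> h = v))"

definition term_obj :: 'o where
  "term_obj = (SOME t. is_terminal t)"

definition bang :: "'o \<Rightarrow> 'm" where
  "bang x = (THE h. h \<in> hom E x term_obj)"

definition prod_projs :: "'o \<Rightarrow> 'o \<Rightarrow> 'm \<times> 'm" where
  "prod_projs a b = (SOME (p1, p2). is_product a b p1 p2)"

definition prod1 :: "'o \<Rightarrow> 'o \<Rightarrow> 'm" where "prod1 a b = fst (prod_projs a b)"
definition prod2 :: "'o \<Rightarrow> 'o \<Rightarrow> 'm" where "prod2 a b = snd (prod_projs a b)"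

text \<open>For \<open>f : A \<rightarrow> C\<close> and \<open>g : B \<rightarrow> C\<close>, \<open>pb f g\<close> is the chosen pullback \<open>A \<times>\<^sub>C B\<close>, with
  projections \<open>pb1 f g\<close> to \<open>A\<close> and \<open>pb2 f g\<close> to \<open>B\<close>, and \<open>pb_pair f g u v\<close> is the induced
  arrow \<open>\<langle>u, v\<rangle>\<close> into it.\<close>

definition pb_projs :: "'m \<Rightarrow> 'm \<Rightarrow> 'm \<times> 'm" where
  "pb_projs f g = (SOME (p1, p2). is_pullback f g p1 p2)"

definition pb1 :: "'m \<Rightarrow> 'm \<Rightarrow> 'm" where "pb1 f g = fst (pb_projs f g)"
definition pb2 :: "'m \<Rightarrow> 'm \<Rightarrow> 'm" where "pb2 f g = snd (pb_projs f g)"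
definition pb :: "'m \<Rightarrow> 'm \<Rightarrow> 'o" where "pb f g = Dom E (pb1 f g)"

definition pb_pair :: "'m \<Rightarrow> 'm \<Rightarrow> 'm \<Rightarrow> 'm \<Rightarrow> 'm" where
  "pb_pair f g u v =
     (THE h. h \<in> hom E (Dom E u) (pb f g) \<and> pb1 f g \<cdot> h = u \<and> pb2 f g \<cdot> h = v)"

subsection \<open>Slices, pullback functors and exponentiability\<close>

definition slice_cat :: "'o \<Rightarrow> ('m, 'm slice_arr) cat" where
  "slice_cat a =
     \<lparr> Obj = {f \<in> Arr E. Cod E f = a},
       Arr = {Slice f h g | f h g. f \<in> Arr E \<and> g \<in> Arr E \<and> Cod E f = a \<and> Cod E g = a \<and>
                h \<in> hom E (Dom E f) (Dom E g) \<and> g \<cdot> h = f},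
       Dom = slice_src,
       Cod = slice_tgt,
       Ident = (\<lambda>f. Slice f (Ident E (Dom E f)) f),
       Comp = (\<lambda>n m. Slice (slice_src m) (slice_map n \<cdot> slice_map m) (slice_tgt n)) \<rparr>"

text \<open>\<open>\<Delta>\<^sub>f : E/A \<rightarrow> E/B\<close> for \<open>f : B \<rightarrow> A\<close>, sending \<open>x : X \<rightarrow> A\<close> to the projection
  \<open>X \<times>\<^sub>A B \<rightarrow> B\<close>.\<close>

definition pb_functor :: "'m \<Rightarrow> ('m, 'm slice_arr, 'm, 'm slice_arr) func" where
  "pb_functor f =
     \<lparr> FObj = (\<lambda>x. pb2 x f),
       FArr = (\<lambda>m. Slice (pb2 (slice_src m) f)
                (pb_pair (slice_tgt m) f
                   (slice_map m \<cdot> pb1 (slice_src m) f) (pb2 (slice_src m) f))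
                (pb2 (slice_tgt m) f)) \<rparr>"

definition exponentiable :: "'m \<Rightarrow> bool" where
  "exponentiable f \<longleftrightarrow> f \<in> Arr E \<and>
     (\<exists>G \<eta> \<epsilon>. is_adjunction (slice_cat (Cod E f)) (slice_cat (Dom E f)) (pb_functor f) G \<eta> \<epsilon>)"

text \<open>A chosen right adjoint \<open>\<Pi>\<^sub>f\<close> together with its counit \<open>\<Delta>\<^sub>f \<Pi>\<^sub>f \<rightarrow> 1\<close>.\<close>

definition dep_prod ::
  "'m \<Rightarrow> ('m, 'm slice_arr, 'm, 'm slice_arr) func \<times> ('m \<Rightarrow> 'm slice_arr)" where
  "dep_prod f = (SOME (G, \<epsilon>). \<exists>\<eta>.
     is_adjunction (slice_cat (Cod E f)) (slice_cat (Dom E f)) (pb_functor f) G \<eta> \<epsilon>)"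

definition Pi_functor :: "'m \<Rightarrow> ('m, 'm slice_arr, 'm, 'm slice_arr) func" where
  "Pi_functor f = fst (dep_prod f)"

definition Pi_counit :: "'m \<Rightarrow> 'm \<Rightarrow> 'm slice_arr" where
  "Pi_counit f = snd (dep_prod f)"

subsection \<open>The category of polynomials\<close>

text \<open>In the composite, \<open>(\<psi> \<circ> \<phi>)\<^sup>\<sharp>\<close> maps \<open>(x, w) \<in> P \<times>\<^sub>R R\<^sub>*\<close> to
  \<open>\<phi>\<^sup>\<sharp> (x, \<psi>\<^sup>\<sharp> (\<phi>\<^sub>1 x, w))\<close>.\<close>

definition Poly :: "('m, 'm poly_arr) cat" where
  "Poly =
     \<lparr> Obj = {p. exponentiable p},
       Arr = {Poly_arr p q \<phi>\<^sub>1 \<phi>\<^sub>2 | p q \<phi>\<^sub>1 \<phi>\<^sub>2. exponentiable p \<and> exponentiable q \<and>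
                \<phi>\<^sub>1 \<in> hom E (Cod E p) (Cod E q) \<and> \<phi>\<^sub>2 \<in> hom E (pb \<phi>\<^sub>1 q) (Dom E p) \<and>
                p \<cdot> \<phi>\<^sub>2 = pb1 \<phi>\<^sub>1 q},
       Dom = poly_src,
       Cod = poly_tgt,
       Ident = (\<lambda>p. Poly_arr p p (Ident E (Cod E p)) (pb2 (Ident E (Cod E p)) p)),
       Comp = (\<lambda>\<psi> \<phi>.
         let q = poly_tgt \<phi>; r = poly_tgt \<psi>; \<chi> = on_pos \<psi> \<cdot> on_pos \<phi> in
         Poly_arr (poly_src \<phi>) r \<chi>
           (on_dir \<phi> \<cdot> pb_pair (on_pos \<phi>) q (pb1 \<chi> r)
              (on_dir \<psi> \<cdot> pb_pair (on_pos \<psi>) r (on_pos \<phi> \<cdot> pb1 \<chi> r) (pb2 \<chi> r)))) \<rparr>"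

definition unit_poly :: 'm where
  "unit_poly = Ident E term_obj"

subsection \<open>The composition product\<close>

text \<open>\<open>cp_pos p q : \<Pi>\<^sub>p (Q \<times> P\<^sub>*) \<rightarrow> P\<close>, and \<open>cp_ev p q : \<Pi>\<^sub>p (Q \<times> P\<^sub>*) \<times>\<^sub>P P\<^sub>* \<rightarrow> Q\<close> is the
  counit followed by the projection to \<open>Q\<close>.  These are the two components of the generic
  position \<open>(x, f)\<close>.\<close>

definition cp_pos :: "'m \<Rightarrow> 'm \<Rightarrow> 'm" where
  "cp_pos p q = FObj (Pi_functor p) (prod2 (Cod E q) (Dom E p))"

definition cp_ev :: "'m \<Rightarrow> 'm \<Rightarrow> 'm" where
  "cp_ev p q = prod1 (Cod E q) (Dom E p) \<cdot>
     slice_map (Pi_counit p (prod2 (Cod E q) (Dom E p)))"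

definition comp_prod :: "'m \<Rightarrow> 'm \<Rightarrow> 'm" where
  "comp_prod p q = pb1 (cp_pos p q) p \<cdot> pb1 (cp_ev p q) q"

text \<open>Generalized elements of \<open>p \<triangleleft> q\<close>.  A generalized position \<open>k : X \<rightarrow> \<Pi>\<^sub>p (Q \<times> P\<^sub>*)\<close> has
  components \<open>x = cp_pos p q \<cdot> k : X \<rightarrow> P\<close> and \<open>f = pos_fun p q k : X \<times>\<^sub>P P\<^sub>* \<rightarrow> Q\<close>, and
  \<open>mk_pos p q x f\<close> is the unique \<open>k\<close> with these components.  A generalized direction at
  \<open>k\<close> is an arrow \<open>d\<close> from \<open>X\<close> to the domain of \<open>p \<triangleleft> q\<close> over \<open>k\<close>; its components are
  \<open>y = dir1 p q d : X \<rightarrow> P\<^sub>*\<close> and \<open>z = dir2 p q d : X \<rightarrow> Q\<^sub>*\<close>, and \<open>mk_dir p q k y z\<close> is the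
  direction at \<open>k\<close> with components \<open>y\<close> and \<open>z\<close>.\<close>

definition pos_fun :: "'m \<Rightarrow> 'm \<Rightarrow> 'm \<Rightarrow> 'm" where
  "pos_fun p q k = (let x = cp_pos p q \<cdot> k in
     cp_ev p q \<cdot> pb_pair (cp_pos p q) p (k \<cdot> pb1 x p) (pb2 x p))"

definition mk_pos :: "'m \<Rightarrow> 'm \<Rightarrow> 'm \<Rightarrow> 'm \<Rightarrow> 'm" where
  "mk_pos p q x f =
     (THE k. k \<in> hom E (Dom E x) (Dom E (cp_pos p q)) \<and> cp_pos p q \<cdot> k = x \<and> pos_fun p q k = f)"

definition dir1 :: "'m \<Rightarrow> 'm \<Rightarrow> 'm \<Rightarrow> 'm" where
  "dir1 p q d = pb2 (cp_pos p q) p \<cdot> pb1 (cp_ev p q) q \<cdot> d"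

definition dir2 :: "'m \<Rightarrow> 'm \<Rightarrow> 'm \<Rightarrow> 'm" where
  "dir2 p q d = pb2 (cp_ev p q) q \<cdot> d"

definition mk_dir :: "'m \<Rightarrow> 'm \<Rightarrow> 'm \<Rightarrow> 'm \<Rightarrow> 'm \<Rightarrow> 'm" where
  "mk_dir p q k y z = pb_pair (cp_ev p q) q (pb_pair (cp_pos p q) p k y) z"

text \<open>\<open>\<phi> \<triangleleft> \<psi>\<close> for \<open>\<phi> : p \<rightarrow> p'\<close> and \<open>\<psi> : q \<rightarrow> q'\<close>.  On positions, \<open>s\<close> is
  \<open>\<phi>\<^sup>\<sharp> (x, -) : X \<times>\<^sub>P\<^sub>' P'\<^sub>* \<rightarrow> X \<times>\<^sub>P P\<^sub>*\<close> at the generic position.  On directions, \<open>k\<close> and \<open>d\<close>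
  are the generic position of \<open>p \<triangleleft> q\<close> and the generic direction of \<open>p' \<triangleleft> q'\<close> at its image.\<close>

definition comp_prod_pos :: "'m poly_arr \<Rightarrow> 'm poly_arr \<Rightarrow> 'm" where
  "comp_prod_pos \<phi> \<psi> =
     (let p = poly_src \<phi>; p' = poly_tgt \<phi>; q = poly_src \<psi>; q' = poly_tgt \<psi>;
          x = cp_pos p q; f = cp_ev p q; x' = on_pos \<phi> \<cdot> x;
          s = pb_pair x p (pb1 x' p')
                (on_dir \<phi> \<cdot> pb_pair (on_pos \<phi>) p' (x \<cdot> pb1 x' p') (pb2 x' p'))
      in mk_pos p' q' x' (on_pos \<psi> \<cdot> f \<cdot> s))"

definition comp_prod_dir :: "'m poly_arr \<Rightarrow> 'm poly_arr \<Rightarrow> 'm" where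
  "comp_prod_dir \<phi> \<psi> =
     (let p = poly_src \<phi>; p' = poly_tgt \<phi>; q = poly_src \<psi>; q' = poly_tgt \<psi>;
          k = pb1 (comp_prod_pos \<phi> \<psi>) (comp_prod p' q');
          d = pb2 (comp_prod_pos \<phi> \<psi>) (comp_prod p' q');
          y = on_dir \<phi> \<cdot> pb_pair (on_pos \<phi>) p' (cp_pos p q \<cdot> k) (dir1 p' q' d);
          fy = cp_ev p q \<cdot> pb_pair (cp_pos p q) p k y;
          z = on_dir \<psi> \<cdot> pb_pair (on_pos \<psi>) q' fy (dir2 p' q' d)
      in mk_dir p q k y z)"

definition comp_prod_arr :: "'m poly_arr \<Rightarrow> 'm poly_arr \<Rightarrow> 'm poly_arr" where
  "comp_prod_arr \<phi> \<psi> =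
     Poly_arr (comp_prod (poly_src \<phi>) (poly_src \<psi>)) (comp_prod (poly_tgt \<phi>) (poly_tgt \<psi>))
       (comp_prod_pos \<phi> \<psi>) (comp_prod_dir \<phi> \<psi>)"

definition comp_prod_functor :: "('m \<times> 'm, 'm poly_arr \<times> 'm poly_arr, 'm, 'm poly_arr) func" where
  "comp_prod_functor =
     \<lparr> FObj = (\<lambda>(p, q). comp_prod p q), FArr = (\<lambda>(\<phi>, \<psi>). comp_prod_arr \<phi> \<psi>) \<rparr>"

subsection \<open>Associator and unitors\<close>

text \<open>A position of \<open>(p \<triangleleft> q) \<triangleleft> r\<close> consists of \<open>x\<close>, of \<open>f\<close> on the directions \<open>y\<close> at \<open>x\<close>, and of
  \<open>g\<close> on the pairs \<open>(y, z)\<close> with \<open>z\<close> a direction at \<open>f y\<close>; the associator sends it to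
  \<open>(x, \<lambda>y. (f y, \<lambda>z. g (y, z)))\<close>, and a direction \<open>(y, (z, w))\<close> at the latter to \<open>((y, z), w)\<close>.
  Below, \<open>k = (x, f)\<close> and \<open>g\<close> are the components of the generic position, and \<open>s\<close> is
  the arrow \<open>((k, g), y, z) \<mapsto> ((k, g), (y, z))\<close>.\<close>

definition assoc_pos :: "'m \<Rightarrow> 'm \<Rightarrow> 'm \<Rightarrow> 'm" where
  "assoc_pos p q r =
     (let k = cp_pos (comp_prod p q) r; g = cp_ev (comp_prod p q) r;
          x = cp_pos p q \<cdot> k; f = pos_fun p q k;
          a = pb1 x p \<cdot> pb1 f q;
          s = pb_pair k (comp_prod p q) a
                (mk_dir p q (k \<cdot> a) (pb2 x p \<cdot> pb1 f q) (pb2 f q))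
      in mk_pos p (comp_prod q r) x (mk_pos q r f (g \<cdot> s)))"

definition assoc_dir :: "'m \<Rightarrow> 'm \<Rightarrow> 'm \<Rightarrow> 'm" where
  "assoc_dir p q r =
     (let \<kappa> = pb1 (assoc_pos p q r) (comp_prod p (comp_prod q r));
          d = pb2 (assoc_pos p q r) (comp_prod p (comp_prod q r));
          y = dir1 p (comp_prod q r) d;
          zw = dir2 p (comp_prod q r) d
      in mk_dir (comp_prod p q) r \<kappa>
           (mk_dir p q (cp_pos (comp_prod p q) r \<cdot> \<kappa>) y (dir1 q r zw))
           (dir2 q r zw))"

definition associator :: "'m \<Rightarrow> 'm \<Rightarrow> 'm \<Rightarrow> 'm poly_arr" where
  "associator p q r =
     Poly_arr (comp_prod (comp_prod p q) r) (comp_prod p (comp_prod q r))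
       (assoc_pos p q r) (assoc_dir p q r)"

text \<open>A position of \<open>unit_poly \<triangleleft> q\<close> is \<open>(x, f)\<close> with \<open>x : X \<rightarrow> 1\<close>, \<open>f : X \<times>\<^sub>1 1 \<rightarrow> Q\<close>, and is
  sent to \<open>f x\<close>, since \<open>x\<close> also serves as the unique direction of \<open>unit_poly\<close> at \<open>x\<close>; a
  direction \<open>z\<close> at \<open>f x\<close> is sent to \<open>(x, z)\<close>.\<close>

definition left_unitor :: "'m \<Rightarrow> 'm poly_arr" where
  "left_unitor q =
     (let x = cp_pos unit_poly q;
          \<phi>\<^sub>1 = cp_ev unit_poly q \<cdot> pb_pair x unit_poly (Ident E (Dom E x)) x
      in Poly_arr (comp_prod unit_poly q) q \<phi>\<^sub>1
           (mk_dir unit_poly q (pb1 \<phi>\<^sub>1 q) (x \<cdot> pb1 \<phi>\<^sub>1 q) (pb2 \<phi>\<^sub>1 q)))"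

text \<open>A position of \<open>p \<triangleleft> unit_poly\<close> is \<open>(x, f)\<close> with \<open>f : X \<times>\<^sub>P P\<^sub>* \<rightarrow> 1\<close>, and is sent to \<open>x\<close>; a direction
  \<open>y\<close> at \<open>x\<close> is sent to \<open>(y, !)\<close>.\<close>

definition right_unitor :: "'m \<Rightarrow> 'm poly_arr" where
  "right_unitor p =
     (let x = cp_pos p unit_poly
      in Poly_arr (comp_prod p unit_poly) p x
           (mk_dir p unit_poly (pb1 x p) (pb2 x p) (bang (pb x p))))"

end

end

theory Submission
  imports Defs
begin

text \<open>A morphism of polynomials is determined by its action on generalized elements: positions
  \<open>x : X \<rightarrow> P\<close>, and directions \<open>w : X \<rightarrow> Q\<^sub>*\<close> at \<open>\<phi>\<^sub>1 x\<close>.  Likewise a position \<open>k = (x, f)\<close> of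
  \<open>p \<triangleleft> q\<close> is determined by \<open>x\<close> and by the values \<open>f y\<close> at the directions \<open>y\<close> of all restrictions of
  \<open>x\<close>, and a direction by its two components.  In these terms the coherence laws become
  computations with pairs and functions.

  That \<open>\<triangleleft>\<close> preserves exponentiability is proved in the same style.  Right adjoints to pullback
  amount to universal arrows, and these are restated so that \<open>\<Pi>\<^sub>f\<close> represents natural families; this
  form does not mention chosen pullbacks and is easily seen to be stable under composition and
  base change.\<close>

section \<open>Adjunctions from universal arrows\<close>

text \<open>Limits, right adjoints and mediating arrows are all picked by choice, so different
  constructions of one object agree only up to canonical isomorphism, and chasing diagrams through
  chosen pullbacks would produce a comparison map at every turn. Instead, each construction is
  computed once at its generic element, and every other value follows because evaluation commutes
  with precomposition. Function components are compared over all restrictions because the generic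
  direction exists only over the restriction along a pullback projection. \<open>E\<close> is not
  assumed locally cartesian closed: \<open>\<Pi>\<close> exists only along exponentiable arrows, so
  that \<open>p \<triangleleft> q\<close> is an object of \<open>Poly E\<close> at all has to be
  proved, and all later typing rests on it. Equations are then settled mostly by rewriting:
  precomposition is pushed inwards onto arguments, and each rule carries conditions saying that its
  arguments are positions, or directions at the right position.\<close>

lemma categoryD:
  assumes "category C"
  shows "f \<in> Arr C \<Longrightarrow> Dom C f \<in> Obj C"
    and "f \<in> Arr C \<Longrightarrow> Cod C f \<in> Obj C"
    and "a \<in> Obj C \<Longrightarrow> Ident C a \<in> Arr C"
    and "a \<in> Obj C \<Longrightarrow> Dom C (Ident C a) = a"
    and "a \<in> Obj C \<Longrightarrow> Cod C (Ident C a) = a"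
    and "f \<in> Arr C \<Longrightarrow> g \<in> Arr C \<Longrightarrow> Cod C f = Dom C g \<Longrightarrow> g \<cdot>\<^bsub>C\<^esub> f \<in> Arr C"
    and "f \<in> Arr C \<Longrightarrow> g \<in> Arr C \<Longrightarrow> Cod C f = Dom C g \<Longrightarrow> Dom C (g \<cdot>\<^bsub>C\<^esub> f) = Dom C f"
    and "f \<in> Arr C \<Longrightarrow> g \<in> Arr C \<Longrightarrow> Cod C f = Dom C g \<Longrightarrow> Cod C (g \<cdot>\<^bsub>C\<^esub> f) = Cod C g"
    and "f \<in> Arr C \<Longrightarrow> Dom C f = a \<Longrightarrow> f \<cdot>\<^bsub>C\<^esub> Ident C a = f"
    and "f \<in> Arr C \<Longrightarrow> Cod C f = a \<Longrightarrow> Ident C a \<cdot>\<^bsub>C\<^esub> f = f"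
    and "f \<in> Arr C \<Longrightarrow> g \<in> Arr C \<Longrightarrow> h \<in> Arr C \<Longrightarrow> Cod C f = Dom C g \<Longrightarrow> Cod C g = Dom C h \<Longrightarrow>
        (h \<cdot>\<^bsub>C\<^esub> g) \<cdot>\<^bsub>C\<^esub> f = h \<cdot>\<^bsub>C\<^esub> (g \<cdot>\<^bsub>C\<^esub> f)"
  using assms unfolding category_def hom_def by auto

text \<open>With \<open>G\<close> and \<open>\<eta>\<close> defined as transposes, naturality of the
  counit and the first triangle identity are their defining equations. Functoriality of
  \<open>G\<close>, naturality of \<open>\<eta>\<close> and the second triangle identity follow from
  uniqueness of transposes.\<close>

lemma right_adjoint_of_universal_arrows:
  assumes F: "is_functor C D F"
    and G0: "\<And>b. b \<in> Obj D \<Longrightarrow> G0 b \<in> Obj C"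
    and eps: "\<And>b. b \<in> Obj D \<Longrightarrow> \<epsilon> b \<in> hom D (FObj F (G0 b)) b"
    and univ: "\<And>a b h. a \<in> Obj C \<Longrightarrow> b \<in> Obj D \<Longrightarrow> h \<in> hom D (FObj F a) b \<Longrightarrow>
      \<exists>!k. k \<in> hom C a (G0 b) \<and> \<epsilon> b \<cdot>\<^bsub>D\<^esub> FArr F k = h"
  shows "\<exists>G \<eta>. is_adjunction C D F G \<eta> \<epsilon>"
proof -
  have C: "category C" and D: "category D"
    using F by (auto simp: is_functor_def)
  note [simp] = categoryD[OF C] categoryD[OF D]
  have FO [simp]: "FObj F a \<in> Obj D" if "a \<in> Obj C" for a
    using F that by (auto simp: is_functor_def)
  have FA [simp]: "FArr F f \<in> Arr D" "Dom D (FArr F f) = FObj F (Dom C f)"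
    "Cod D (FArr F f) = FObj F (Cod C f)" if "f \<in> Arr C" for f
    using F that by (auto simp: is_functor_def hom_def)
  have FI [simp]: "FArr F (Ident C a) = Ident D (FObj F a)" if "a \<in> Obj C" for a
    using F that by (auto simp: is_functor_def)
  have FC [simp]: "FArr F (g \<cdot>\<^bsub>C\<^esub> f) = FArr F g \<cdot>\<^bsub>D\<^esub> FArr F f"
    if "f \<in> Arr C" "g \<in> Arr C" "Cod C f = Dom C g" for f g
    using F that by (auto simp: is_functor_def)
  have eps' [simp]: "\<epsilon> b \<in> Arr D" "Dom D (\<epsilon> b) = FObj F (G0 b)" "Cod D (\<epsilon> b) = b"
    if "b \<in> Obj D" for b
    using eps[OF that] by (auto simp: hom_def)
  define tr where "tr a b h = (THE k. k \<in> hom C a (G0 b) \<and> \<epsilon> b \<cdot>\<^bsub>D\<^esub> FArr F k = h)" for a b h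
  have tr: "tr a b h \<in> hom C a (G0 b) \<and> \<epsilon> b \<cdot>\<^bsub>D\<^esub> FArr F (tr a b h) = h"
    if "a \<in> Obj C" "b \<in> Obj D" "h \<in> hom D (FObj F a) b" for a b h
    unfolding tr_def by (rule theI'[OF univ[OF that]])
  have eq: "k = k'" if "b \<in> Obj D" "k \<in> Arr C" "k' \<in> Arr C" "Dom C k = Dom C k'"
      "Cod C k = G0 b" "Cod C k' = G0 b" "\<epsilon> b \<cdot>\<^bsub>D\<^esub> FArr F k = \<epsilon> b \<cdot>\<^bsub>D\<^esub> FArr F k'" for b k k'
  proof -
    have "Dom C k \<in> Obj C" using that by simp
    moreover have "\<epsilon> b \<cdot>\<^bsub>D\<^esub> FArr F k \<in> hom D (FObj F (Dom C k)) b"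
      using that by (simp add: hom_def)
    ultimately show ?thesis
      using univ[of "Dom C k" b "\<epsilon> b \<cdot>\<^bsub>D\<^esub> FArr F k"] that unfolding hom_def by auto
  qed
  \<comment> \<open>On arrows, \<open>G\<close> transposes \<open>m\<close> after the counit, as
    naturality of the counit demands; \<open>\<eta>\<close> transposes the identity.\<close>
  define G where "G = \<lparr>FObj = G0, FArr = (\<lambda>m. tr (G0 (Dom D m)) (Cod D m) (m \<cdot>\<^bsub>D\<^esub> \<epsilon> (Dom D m)))\<rparr>"
  define \<eta> where "\<eta> a = tr a (FObj F a) (Ident D (FObj F a))" for a
  have GA: "FArr G m \<in> Arr C" "Dom C (FArr G m) = G0 (Dom D m)" "Cod C (FArr G m) = G0 (Cod D m)"
    "\<epsilon> (Cod D m) \<cdot>\<^bsub>D\<^esub> FArr F (FArr G m) = m \<cdot>\<^bsub>D\<^esub> \<epsilon> (Dom D m)" if "m \<in> Arr D" for m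
    using tr[of "G0 (Dom D m)" "Cod D m" "m \<cdot>\<^bsub>D\<^esub> \<epsilon> (Dom D m)"] that G0
    by (auto simp: G_def hom_def)
  note [simp] = GA(1-3)
  have GO [simp]: "FObj G b = G0 b" for b by (simp add: G_def)
  have et: "\<eta> a \<in> Arr C" "Dom C (\<eta> a) = a" "Cod C (\<eta> a) = G0 (FObj F a)"
    "\<epsilon> (FObj F a) \<cdot>\<^bsub>D\<^esub> FArr F (\<eta> a) = Ident D (FObj F a)" if "a \<in> Obj C" for a
    using tr[of a "FObj F a" "Ident D (FObj F a)"] that by (auto simp: \<eta>_def hom_def)
  note [simp] = et(1-3)
  \<comment> \<open>The rewrite rules associate to the right; this reverses them at the counit so
    that \<open>GA(4)\<close> and \<open>et(4)\<close> can apply.\<close>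
  have r: "\<epsilon> b \<cdot>\<^bsub>D\<^esub> (FArr F k \<cdot>\<^bsub>D\<^esub> g) = (\<epsilon> b \<cdot>\<^bsub>D\<^esub> FArr F k) \<cdot>\<^bsub>D\<^esub> g"
    if "b \<in> Obj D" "k \<in> Arr C" "g \<in> Arr D" "Cod C k = G0 b" "Cod D g = FObj F (Dom C k)" for b k g
    using that by simp
  have G: "is_functor D C G"
    unfolding is_functor_def
  proof (intro conjI ballI impI)
    fix f g assume fg: "f \<in> Arr D" "g \<in> Arr D" "Cod D f = Dom D g"
    have "\<epsilon> (Cod D g) \<cdot>\<^bsub>D\<^esub> FArr F (FArr G g \<cdot>\<^bsub>C\<^esub> FArr G f) = (g \<cdot>\<^bsub>D\<^esub> f) \<cdot>\<^bsub>D\<^esub> \<epsilon> (Dom D f)"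
      using fg GA(4)[of f] by (simp add: r GA(4))
    moreover have "\<epsilon> (Cod D g) \<cdot>\<^bsub>D\<^esub> FArr F (FArr G (g \<cdot>\<^bsub>D\<^esub> f)) = (g \<cdot>\<^bsub>D\<^esub> f) \<cdot>\<^bsub>D\<^esub> \<epsilon> (Dom D f)"
      using fg GA(4)[of "g \<cdot>\<^bsub>D\<^esub> f"] by simp
    ultimately show "FArr G (g \<cdot>\<^bsub>D\<^esub> f) = FArr G g \<cdot>\<^bsub>C\<^esub> FArr G f"
      by (intro eq[of "Cod D g"]) (use fg in simp_all)
  next
    fix a assume a: "a \<in> Obj D"
    show "FArr G (Ident D a) = Ident C (FObj G a)"
      by (rule eq[of a]) (use a G0 GA(4)[of "Ident D a"] in simp_all)
  qed (use C D G0 in \<open>auto simp: hom_def\<close>)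
  have nat_eta: "is_nat_trans C C id_func (comp_func G F) \<eta>"
    unfolding is_nat_trans_def
  proof (intro conjI ballI)
    fix f assume f: "f \<in> Arr C"
    have "\<epsilon> (FObj F (Cod C f)) \<cdot>\<^bsub>D\<^esub> FArr F (\<eta> (Cod C f) \<cdot>\<^bsub>C\<^esub> f) = FArr F f"
      using f by (simp add: r G0 et(4))
    moreover have "\<epsilon> (FObj F (Cod C f)) \<cdot>\<^bsub>D\<^esub> FArr F (FArr G (FArr F f) \<cdot>\<^bsub>C\<^esub> \<eta> (Dom C f)) = FArr F f"
      using f GA(4)[of "FArr F f"] by (simp add: r G0 et(4))
    ultimately show "\<eta> (Cod C f) \<cdot>\<^bsub>C\<^esub> FArr id_func f = FArr (comp_func G F) f \<cdot>\<^bsub>C\<^esub> \<eta> (Dom C f)"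
      by (intro eq[of "FObj F (Cod C f)"]) (use f in \<open>simp_all add: id_func_def comp_func_def\<close>)
  qed (auto simp: hom_def id_func_def comp_func_def)
  have nat_eps: "is_nat_trans D D (comp_func F G) id_func \<epsilon>"
    unfolding is_nat_trans_def by (auto simp: hom_def id_func_def comp_func_def GA(4))
  have "FArr G (\<epsilon> b) \<cdot>\<^bsub>C\<^esub> \<eta> (G0 b) = Ident C (G0 b)" if b: "b \<in> Obj D" for b
    by (rule eq[of b]) (use b G0 GA(4)[of "\<epsilon> b"] in \<open>simp_all add: r et(4)\<close>)
  then have "is_adjunction C D F G \<eta> \<epsilon>"
    unfolding is_adjunction_def using F G nat_eta nat_eps et(4) by simp
  then show ?thesis by blast
qed

text \<open>The transpose is \<open>FArr G h\<close> after \<open>\<eta> a\<close>: it works by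
  naturality of \<open>\<epsilon>\<close> and the first triangle identity, and is unique by
  naturality of \<open>\<eta>\<close> and the second.\<close>

lemma counit_universal:
  assumes adj: "is_adjunction C D F G \<eta> \<epsilon>" and a: "a \<in> Obj C" and b: "b \<in> Obj D"
    and h: "h \<in> hom D (FObj F a) b"
  shows "\<exists>!k. k \<in> hom C a (FObj G b) \<and> \<epsilon> b \<cdot>\<^bsub>D\<^esub> FArr F k = h"
proof -
  have F: "is_functor C D F" and G: "is_functor D C G"
    using adj by (auto simp: is_adjunction_def)
  have C: "category C" and D: "category D"
    using F by (auto simp: is_functor_def)
  note [simp] = categoryD[OF C] categoryD[OF D]
  have [simp]: "FObj F a \<in> Obj D" if "a \<in> Obj C" for a
    using F that by (auto simp: is_functor_def)
  have [simp]: "FObj G a \<in> Obj C" if "a \<in> Obj D" for a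
    using G that by (auto simp: is_functor_def)
  have [simp]: "FArr F f \<in> Arr D" "Dom D (FArr F f) = FObj F (Dom C f)"
    "Cod D (FArr F f) = FObj F (Cod C f)" if "f \<in> Arr C" for f
    using F that by (auto simp: is_functor_def hom_def)
  have [simp]: "FArr G f \<in> Arr C" "Dom C (FArr G f) = FObj G (Dom D f)"
    "Cod C (FArr G f) = FObj G (Cod D f)" if "f \<in> Arr D" for f
    using G that by (auto simp: is_functor_def hom_def)
  have FC [simp]: "FArr F (g \<cdot>\<^bsub>C\<^esub> f) = FArr F g \<cdot>\<^bsub>D\<^esub> FArr F f"
    if "f \<in> Arr C" "g \<in> Arr C" "Cod C f = Dom C g" for f g
    using F that by (auto simp: is_functor_def)
  have GC [simp]: "FArr G (g \<cdot>\<^bsub>D\<^esub> f) = FArr G g \<cdot>\<^bsub>C\<^esub> FArr G f"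
    if "f \<in> Arr D" "g \<in> Arr D" "Cod D f = Dom D g" for f g
    using G that by (auto simp: is_functor_def)
  have [simp]: "\<eta> a \<in> Arr C" "Dom C (\<eta> a) = a" "Cod C (\<eta> a) = FObj G (FObj F a)" if "a \<in> Obj C" for a
    using adj that by (auto simp: is_adjunction_def is_nat_trans_def hom_def id_func_def comp_func_def)
  have [simp]: "\<epsilon> b \<in> Arr D" "Dom D (\<epsilon> b) = FObj F (FObj G b)" "Cod D (\<epsilon> b) = b" if "b \<in> Obj D" for b
    using adj that by (auto simp: is_adjunction_def is_nat_trans_def hom_def id_func_def comp_func_def)
  have neta: "\<eta> (Cod C f) \<cdot>\<^bsub>C\<^esub> f = FArr G (FArr F f) \<cdot>\<^bsub>C\<^esub> \<eta> (Dom C f)" if "f \<in> Arr C" for f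
    using adj that by (auto simp: is_adjunction_def is_nat_trans_def id_func_def comp_func_def)
  have neps: "\<epsilon> (Cod D f) \<cdot>\<^bsub>D\<^esub> FArr F (FArr G f) = f \<cdot>\<^bsub>D\<^esub> \<epsilon> (Dom D f)" if "f \<in> Arr D" for f
    using adj that by (auto simp: is_adjunction_def is_nat_trans_def id_func_def comp_func_def)
  have tri1: "\<epsilon> (FObj F a) \<cdot>\<^bsub>D\<^esub> FArr F (\<eta> a) = Ident D (FObj F a)" if "a \<in> Obj C" for a
    using adj that by (auto simp: is_adjunction_def)
  have tri2: "FArr G (\<epsilon> b) \<cdot>\<^bsub>C\<^esub> \<eta> (FObj G b) = Ident C (FObj G b)" if "b \<in> Obj D" for b
    using adj that by (auto simp: is_adjunction_def)
  have h' [simp]: "h \<in> Arr D" "Dom D h = FObj F a" "Cod D h = b"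
    using h by (auto simp: hom_def)
  note [simp] = a b
  show ?thesis
  proof (rule ex1I)
    have "\<epsilon> b \<cdot>\<^bsub>D\<^esub> FArr F (FArr G h \<cdot>\<^bsub>C\<^esub> \<eta> a) = (\<epsilon> b \<cdot>\<^bsub>D\<^esub> FArr F (FArr G h)) \<cdot>\<^bsub>D\<^esub> FArr F (\<eta> a)"
      by simp
    also have "\<dots> = h \<cdot>\<^bsub>D\<^esub> (\<epsilon> (FObj F a) \<cdot>\<^bsub>D\<^esub> FArr F (\<eta> a))"
      using neps[of h] by simp
    finally show "FArr G h \<cdot>\<^bsub>C\<^esub> \<eta> a \<in> hom C a (FObj G b) \<and> \<epsilon> b \<cdot>\<^bsub>D\<^esub> FArr F (FArr G h \<cdot>\<^bsub>C\<^esub> \<eta> a) = h"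
      by (simp add: hom_def tri1)
  next
    fix k assume "k \<in> hom C a (FObj G b) \<and> \<epsilon> b \<cdot>\<^bsub>D\<^esub> FArr F k = h"
    then have k [simp]: "k \<in> Arr C" "Dom C k = a" "Cod C k = FObj G b" and hk: "h = \<epsilon> b \<cdot>\<^bsub>D\<^esub> FArr F k"
      by (auto simp: hom_def)
    have "FArr G h \<cdot>\<^bsub>C\<^esub> \<eta> a = FArr G (\<epsilon> b) \<cdot>\<^bsub>C\<^esub> (FArr G (FArr F k) \<cdot>\<^bsub>C\<^esub> \<eta> a)"
      unfolding hk by simp
    also have "\<dots> = (FArr G (\<epsilon> b) \<cdot>\<^bsub>C\<^esub> \<eta> (FObj G b)) \<cdot>\<^bsub>C\<^esub> k"
      using neta[of k] by simp
    finally show "k = FArr G h \<cdot>\<^bsub>C\<^esub> \<eta> a" by (simp add: tri2)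
  qed
qed

section \<open>Chosen finite limits\<close>

locale finlim =
  fixes E :: "('o, 'm) cat" (structure)
  assumes cat: "category E" and lims: "has_finite_limits E"
begin

lemmas cat_simps [simp] = categoryD[OF cat]

text \<open>Composites are normalised to the right, so an equation about \<open>f \<cdot> u\<close>
  does not match inside \<open>f \<cdot> u \<cdot> t\<close>. This and the next lemma extend such
  equations along \<open>t\<close>.\<close>

lemma comp_eq_comp:
  assumes "f \<cdot> u = g \<cdot> v" "f \<in> Arr E" "g \<in> Arr E" "u \<in> Arr E" "v \<in> Arr E"
    "Cod E u = Dom E f" "Cod E v = Dom E g" "t \<in> Arr E" "Cod E t = Dom E u" "Cod E t = Dom E v"
  shows "f \<cdot> u \<cdot> t = g \<cdot> v \<cdot> t"
  using arg_cong[OF assms(1), of "\<lambda>z. z \<cdot> t"] assms(2-) by simp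

lemma comp_eq_arr:
  assumes "f \<cdot> u = w" "f \<in> Arr E" "u \<in> Arr E" "Cod E u = Dom E f" "t \<in> Arr E" "Cod E t = Dom E u"
  shows "f \<cdot> u \<cdot> t = w \<cdot> t"
  using arg_cong[OF assms(1), of "\<lambda>z. z \<cdot> t"] assms(2-) by simp

lemma terminal_exists: "\<exists>t. is_terminal E t"
proof -
  \<comment> \<open>The empty shape, over which every object is a cone.\<close>
  let ?J = "\<lparr>Obj = {}, Arr = {}, Dom = \<lambda>_. 0, Cod = \<lambda>_. 0, Ident = \<lambda>_. 0, Comp = \<lambda>_ _. 0\<rparr> :: (nat, nat) cat"
  let ?D = "\<lparr>FObj = \<lambda>_. undefined, FArr = \<lambda>_. undefined\<rparr> :: (nat, nat, 'o, 'm) func"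
  have "is_functor ?J E ?D"
    using cat by (simp add: is_functor_def category_def)
  then obtain L \<pi> where "is_limit ?J E ?D L \<pi>"
    using lims unfolding has_finite_limits_def by (metis finite.emptyI cat.select_convs(1,2))
  then have "is_terminal E L"
    by (simp add: is_limit_def is_cone_def is_terminal_def)
  then show ?thesis by blast
qed

lemma term_obj: "is_terminal E (term_obj E)"
  unfolding term_obj_def by (rule someI_ex[OF terminal_exists])

lemma term_obj_in [simp]: "term_obj E \<in> Obj E"
  using term_obj by (simp add: is_terminal_def)

lemma bang [simp]:
  assumes "x \<in> Obj E"
  shows "bang E x \<in> Arr E" "Dom E (bang E x) = x" "Cod E (bang E x) = term_obj E"
proof -
  have "\<exists>!h. h \<in> hom E x (term_obj E)"
    using term_obj assms by (simp add: is_terminal_def)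
  from theI'[OF this] show "bang E x \<in> Arr E" "Dom E (bang E x) = x" "Cod E (bang E x) = term_obj E"
    by (auto simp: bang_def hom_def)
qed

lemma term_eq:
  assumes "h \<in> Arr E" "k \<in> Arr E" "Dom E h = Dom E k" "Cod E h = term_obj E" "Cod E k = term_obj E"
  shows "h = k"
proof -
  have "Dom E h \<in> Obj E" using assms by simp
  then have "\<exists>!m. m \<in> hom E (Dom E h) (term_obj E)"
    using term_obj by (simp add: is_terminal_def)
  then show ?thesis using assms by (auto simp: hom_def)
qed

lemma pullback_exists:
  assumes [simp]: "f \<in> Arr E" "g \<in> Arr E" "Cod E f = Cod E g"
  shows "\<exists>p1 p2. is_pullback E f g p1 p2"
proof -
  \<comment> \<open>The cospan shape: \<open>0\<close>, \<open>1\<close>, \<open>2\<close> are the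
    objects and also their identities, \<open>3\<close> runs from \<open>0\<close> to
    \<open>2\<close> and \<open>4\<close> from \<open>1\<close> to \<open>2\<close>. One factor of a
    composable pair is always an identity, which explains \<open>Comp\<close>.\<close>
  define J where "J = (\<lparr>Obj = {0, 1, 2}, Arr = {0, 1, 2, 3, 4},
    Dom = \<lambda>n. if n = 3 then 0 else if n = 4 then 1 else n,
    Cod = \<lambda>n. if n < 3 then n else 2, Ident = \<lambda>n. n,
    Comp = \<lambda>g f. if g < 3 then f else g\<rparr> :: (nat, nat) cat)"
  define D where "D = (\<lparr>FObj = \<lambda>n. if n = 0 then Dom E f else if n = 1 then Dom E g else Cod E g,
    FArr = \<lambda>n. if n = 0 then Ident E (Dom E f) else if n = 1 then Ident E (Dom E g)
      else if n = 2 then Ident E (Cod E g) else if n = 3 then f else g\<rparr> :: (nat, nat, 'o, 'm) func)"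
  have "category J"
    by (auto simp: category_def hom_def J_def)
  then have "is_functor J E D"
    using cat by (auto simp: is_functor_def hom_def J_def D_def)
  then obtain L \<pi> where L: "is_limit J E D L \<pi>"
    using lims unfolding has_finite_limits_def by (fastforce simp: J_def)
  then have c: "is_cone J E D L \<pi>" by (simp add: is_limit_def)
  have 1: "\<pi> 0 \<in> Arr E" "\<pi> 1 \<in> Arr E" "Dom E (\<pi> 0) = L" "Dom E (\<pi> 1) = L"
    "Cod E (\<pi> 0) = Dom E f" "Cod E (\<pi> 1) = Dom E g" "L \<in> Obj E"
    "f \<cdot> \<pi> 0 = \<pi> 2" "g \<cdot> \<pi> 1 = \<pi> 2"
    using c by (auto simp: is_cone_def hom_def J_def D_def)
  have "is_pullback E f g (\<pi> 0) (\<pi> 1)"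
    unfolding is_pullback_def
  proof (intro conjI allI ballI impI)
    fix x u v assume uv: "u \<in> hom E x (Dom E f)" "v \<in> hom E x (Dom E g)" "f \<cdot> u = g \<cdot> v"
    \<comment> \<open>The leg at the corner \<open>2\<close> is forced to be the common
      composite.\<close>
    let ?s = "\<lambda>n. if n = (0::nat) then u else if n = 1 then v else g \<cdot> v"
    have "is_cone J E D x ?s"
      using uv by (auto simp: is_cone_def hom_def J_def D_def)
    then have "\<exists>!h. h \<in> hom E x L \<and> (\<forall>j\<in>Obj J. \<pi> j \<cdot> h = ?s j)"
      using L unfolding is_limit_def by blast
    moreover have "(\<forall>j\<in>Obj J. \<pi> j \<cdot> h = ?s j) = (\<pi> 0 \<cdot> h = u \<and> \<pi> 1 \<cdot> h = v)"
      if "h \<in> hom E x L" for h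
    proof -
      have "\<pi> 2 \<cdot> h = g \<cdot> (\<pi> 1 \<cdot> h)" using 1(1-7) that by (simp add: hom_def 1(9)[symmetric] del: One_nat_def)
      then show ?thesis by (auto simp: J_def)
    qed
    ultimately show "\<exists>!h. h \<in> hom E x (Dom E (\<pi> 0)) \<and> \<pi> 0 \<cdot> h = u \<and> \<pi> 1 \<cdot> h = v"
      using 1(3) by (metis (no_types, lifting))
  qed (use 1 in simp_all)
  then show ?thesis by blast
qed

lemma is_pullback:
  assumes "f \<in> Arr E" "g \<in> Arr E" "Cod E f = Cod E g"
  shows "is_pullback E f g (pb1 E f g) (pb2 E f g)"
proof -
  have "\<exists>x. case x of (p1, p2) \<Rightarrow> is_pullback E f g p1 p2"
    using pullback_exists[OF assms] by auto
  from someI_ex[OF this] show ?thesis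
    by (auto simp: pb1_def pb2_def pb_projs_def split: prod.splits)
qed

lemma pb_projs [simp]:
  assumes "f \<in> Arr E" "g \<in> Arr E" "Cod E f = Cod E g"
  shows "pb1 E f g \<in> Arr E" "pb2 E f g \<in> Arr E"
    "Dom E (pb1 E f g) = pb E f g" "Dom E (pb2 E f g) = pb E f g"
    "Cod E (pb1 E f g) = Dom E f" "Cod E (pb2 E f g) = Dom E g"
    "pb E f g \<in> Obj E"
  using is_pullback[OF assms] by (auto simp: is_pullback_def pb_def)

lemma pb_square:
  assumes "f \<in> Arr E" "g \<in> Arr E" "Cod E f = Cod E g"
  shows "f \<cdot> pb1 E f g = g \<cdot> pb2 E f g"
  using is_pullback[OF assms] by (auto simp: is_pullback_def)

lemma pb_square':
  assumes "f \<in> Arr E" "g \<in> Arr E" "Cod E f = Cod E g" "t \<in> Arr E" "Cod E t = pb E f g"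
  shows "f \<cdot> pb1 E f g \<cdot> t = g \<cdot> pb2 E f g \<cdot> t"
  by (rule comp_eq_comp[OF pb_square]) (use assms in simp_all)

lemma pb_pair [simp]:
  assumes "f \<in> Arr E" "g \<in> Arr E" "Cod E f = Cod E g" "u \<in> Arr E" "v \<in> Arr E"
    "Dom E u = Dom E v" "Cod E u = Dom E f" "Cod E v = Dom E g" "f \<cdot> u = g \<cdot> v"
  shows "pb_pair E f g u v \<in> Arr E" "Dom E (pb_pair E f g u v) = Dom E v"
    "Cod E (pb_pair E f g u v) = pb E f g"
    "pb1 E f g \<cdot> pb_pair E f g u v = u" "pb2 E f g \<cdot> pb_pair E f g u v = v"
proof -
  have "\<exists>!h. h \<in> hom E (Dom E u) (pb E f g) \<and> pb1 E f g \<cdot> h = u \<and> pb2 E f g \<cdot> h = v"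
  proof -
    have "u \<in> hom E (Dom E u) (Dom E f)" "v \<in> hom E (Dom E u) (Dom E g)"
      using assms by (auto simp: hom_def)
    then show ?thesis
      using is_pullback[OF assms(1-3)] assms(9) unfolding is_pullback_def pb_def by blast
  qed
  from theI'[OF this] show "pb_pair E f g u v \<in> Arr E" "Dom E (pb_pair E f g u v) = Dom E v"
    "Cod E (pb_pair E f g u v) = pb E f g"
    "pb1 E f g \<cdot> pb_pair E f g u v = u" "pb2 E f g \<cdot> pb_pair E f g u v = v"
    using assms(6) by (auto simp: pb_pair_def hom_def)
qed

lemma pb_eqI:
  assumes "f \<in> Arr E" "g \<in> Arr E" "Cod E f = Cod E g" "h \<in> Arr E" "k \<in> Arr E"
    "Dom E h = Dom E k" "Cod E h = pb E f g" "Cod E k = pb E f g"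
    "pb1 E f g \<cdot> h = pb1 E f g \<cdot> k" "pb2 E f g \<cdot> h = pb2 E f g \<cdot> k"
  shows "h = k"
proof -
  let ?u = "pb1 E f g \<cdot> k" and ?v = "pb2 E f g \<cdot> k"
  have "?u \<in> hom E (Dom E k) (Dom E f)" "?v \<in> hom E (Dom E k) (Dom E g)"
    using assms by (auto simp: hom_def)
  moreover have "f \<cdot> ?u = g \<cdot> ?v" using assms by (simp add: pb_square')
  ultimately have "\<exists>!h. h \<in> hom E (Dom E k) (Dom E (pb1 E f g)) \<and> pb1 E f g \<cdot> h = ?u \<and> pb2 E f g \<cdot> h = ?v"
    using is_pullback[OF assms(1-3)] unfolding is_pullback_def by blast
  then show ?thesis using assms by (auto simp: hom_def)
qed

lemma pb_pair_proj [simp]: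
  assumes "f \<in> Arr E" "g \<in> Arr E" "Cod E f = Cod E g" "u \<in> Arr E" "v \<in> Arr E"
    "Dom E u = Dom E v" "Cod E u = Dom E f" "Cod E v = Dom E g" "f \<cdot> u = g \<cdot> v"
    "t \<in> Arr E" "Cod E t = Dom E v"
  shows "pb1 E f g \<cdot> pb_pair E f g u v \<cdot> t = u \<cdot> t" "pb2 E f g \<cdot> pb_pair E f g u v \<cdot> t = v \<cdot> t"
  by (rule comp_eq_arr; use assms in simp)+

lemma pb_pair_comp:
  assumes "f \<in> Arr E" "g \<in> Arr E" "Cod E f = Cod E g" "u \<in> Arr E" "v \<in> Arr E"
    "Dom E u = Dom E v" "Cod E u = Dom E f" "Cod E v = Dom E g" "f \<cdot> u = g \<cdot> v"
    "t \<in> Arr E" "Cod E t = Dom E v"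
  shows "pb_pair E f g u v \<cdot> t = pb_pair E f g (u \<cdot> t) (v \<cdot> t)"
proof -
  have "f \<cdot> u \<cdot> t = g \<cdot> v \<cdot> t" by (rule comp_eq_comp) (use assms in simp_all)
  then show ?thesis by - (rule pb_eqI[of f g], use assms in simp_all)
qed

lemma pb_pair_eta:
  assumes "f \<in> Arr E" "g \<in> Arr E" "Cod E f = Cod E g" "h \<in> Arr E" "Cod E h = pb E f g"
  shows "pb_pair E f g (pb1 E f g \<cdot> h) (pb2 E f g \<cdot> h) = h"
  by (rule pb_eqI[of f g]) (use assms in \<open>simp_all add: pb_square'\<close>)

text \<open>Over the terminal object every square commutes, so a pullback there is a
  product.\<close>

lemma product_exists:
  assumes [simp]: "a \<in> Obj E" "b \<in> Obj E"
  shows "\<exists>p1 p2. is_product E a b p1 p2"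
proof -
  let ?f = "bang E a" and ?g = "bang E b"
  have "is_product E a b (pb1 E ?f ?g) (pb2 E ?f ?g)"
    unfolding is_product_def
  proof (intro conjI allI ballI)
    fix x u v assume "u \<in> hom E x a" "v \<in> hom E x b"
    moreover from this have "?f \<cdot> u = ?g \<cdot> v" by (intro term_eq) (auto simp: hom_def)
    ultimately show "\<exists>!h. h \<in> hom E x (Dom E (pb1 E ?f ?g)) \<and> pb1 E ?f ?g \<cdot> h = u \<and> pb2 E ?f ?g \<cdot> h = v"
      using is_pullback[of ?f ?g] by (simp add: is_pullback_def)
  qed simp_all
  then show ?thesis by blast
qed

lemma is_product:
  assumes "a \<in> Obj E" "b \<in> Obj E"
  shows "is_product E a b (prod1 E a b) (prod2 E a b)"
proof -
  have "\<exists>x. case x of (p1, p2) \<Rightarrow> is_product E a b p1 p2"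
    using product_exists[OF assms] by auto
  from someI_ex[OF this] show ?thesis
    by (auto simp: prod1_def prod2_def prod_projs_def split: prod.splits)
qed

lemma prod_projs [simp]:
  assumes "a \<in> Obj E" "b \<in> Obj E"
  shows "prod1 E a b \<in> Arr E" "prod2 E a b \<in> Arr E" "Dom E (prod1 E a b) = Dom E (prod2 E a b)"
    "Cod E (prod1 E a b) = a" "Cod E (prod2 E a b) = b"
  using is_product[OF assms] by (auto simp: is_product_def)

lemma prod_pair_ex:
  assumes "a \<in> Obj E" "b \<in> Obj E" "u \<in> Arr E" "v \<in> Arr E" "Dom E u = Dom E v" "Cod E u = a" "Cod E v = b"
  shows "\<exists>!h. h \<in> Arr E \<and> Dom E h = Dom E v \<and> Cod E h = Dom E (prod2 E a b) \<and>
    prod1 E a b \<cdot> h = u \<and> prod2 E a b \<cdot> h = v"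
proof -
  have "u \<in> hom E (Dom E v) a" "v \<in> hom E (Dom E v) b" using assms by (auto simp: hom_def)
  then have "\<exists>!h. h \<in> hom E (Dom E v) (Dom E (prod1 E a b)) \<and> prod1 E a b \<cdot> h = u \<and> prod2 E a b \<cdot> h = v"
    using is_product[OF assms(1,2)] unfolding is_product_def by blast
  then show ?thesis using assms by (simp add: hom_def conj_assoc)
qed

lemma prod_eqI:
  assumes "a \<in> Obj E" "b \<in> Obj E" "h \<in> Arr E" "k \<in> Arr E"
    "Dom E h = Dom E k" "Cod E h = Dom E (prod2 E a b)" "Cod E k = Dom E (prod2 E a b)"
    "prod1 E a b \<cdot> h = prod1 E a b \<cdot> k" "prod2 E a b \<cdot> h = prod2 E a b \<cdot> k"
  shows "h = k"
  using prod_pair_ex[OF assms(1,2), of "prod1 E a b \<cdot> k" "prod2 E a b \<cdot> k"] assms by auto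

section \<open>Slice categories and the pullback functor\<close>

lemma slice_Obj [simp]: "f \<in> Obj (slice_cat E a) \<longleftrightarrow> f \<in> Arr E \<and> Cod E f = a"
  by (simp add: slice_cat_def)

lemma slice_Arr: "Slice f h g \<in> Arr (slice_cat E a) \<longleftrightarrow> g \<in> Arr E \<and> Cod E g = a \<and>
   h \<in> Arr E \<and> Cod E h = Dom E g \<and> f = g \<cdot> h"
  by (auto simp: slice_cat_def hom_def)

lemma slice_simps [simp]:
  "Dom (slice_cat E a) (Slice f h g) = f" "Cod (slice_cat E a) (Slice f h g) = g"
  "Ident (slice_cat E a) f = Slice f (Ident E (Dom E f)) f"
  "Slice g' k l \<cdot>\<^bsub>slice_cat E a\<^esub> Slice f h g = Slice f (k \<cdot> h) l"
  by (simp_all add: slice_cat_def)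

text \<open>The source of a slice arrow is determined by its map and target. Substituting it turns
  the category and functor axioms into plain equations in \<open>E\<close>.\<close>

lemma slice_all: "(\<forall>m\<in>Arr (slice_cat E a). Q m) \<longleftrightarrow>
   (\<forall>g h. g \<in> Arr E \<longrightarrow> Cod E g = a \<longrightarrow> h \<in> Arr E \<longrightarrow> Cod E h = Dom E g \<longrightarrow> Q (Slice (g \<cdot> h) h g))"
  by (auto simp: slice_cat_def hom_def)

lemma slice_category:
  assumes "a \<in> Obj E"
  shows "category (slice_cat E a)"
  unfolding category_def slice_all hom_def
  by (simp add: slice_Arr assms)

lemma pb_functor:
  assumes f [simp]: "f \<in> Arr E"
  shows "is_functor (slice_cat E (Cod E f)) (slice_cat E (Dom E f)) (pb_functor E f)"
proof -
  \<comment> \<open>The pullback square of a composite, in the right-nested form that simplification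
    meets; \<open>r2\<close> serves two consecutive slice arrows.\<close>
  have r: "g \<cdot> h \<cdot> pb1 E (g \<cdot> h) f = f \<cdot> pb2 E (g \<cdot> h) f"
    if "g \<in> Arr E" "h \<in> Arr E" "Cod E h = Dom E g" "Cod E g = Cod E f" for g h
    using pb_square[of "g \<cdot> h" f] that assms by simp
  have r2: "g \<cdot> h \<cdot> k \<cdot> pb1 E (g \<cdot> h \<cdot> k) f = f \<cdot> pb2 E (g \<cdot> h \<cdot> k) f"
    if "g \<in> Arr E" "h \<in> Arr E" "k \<in> Arr E" "Cod E h = Dom E g" "Cod E k = Dom E h" "Cod E g = Cod E f" for g h k
    using r[of g "h \<cdot> k"] that assms by simp
  show ?thesis
    unfolding is_functor_def slice_all
  proof (intro conjI allI impI)
    fix g h k l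
    assume "g \<in> Arr E" "Cod E g = Cod E f" "h \<in> Arr E" "Cod E h = Dom E g"
      "k \<in> Arr E" "Cod E k = Cod E f" "l \<in> Arr E" "Cod E l = Dom E k"
      "Cod (slice_cat E (Cod E f)) (Slice (g \<cdot> h) h g) = Dom (slice_cat E (Cod E f)) (Slice (k \<cdot> l) l k)"
    then show "FArr (pb_functor E f) (Slice (k \<cdot> l) l k \<cdot>\<^bsub>slice_cat E (Cod E f)\<^esub> Slice (g \<cdot> h) h g) =
      FArr (pb_functor E f) (Slice (k \<cdot> l) l k) \<cdot>\<^bsub>slice_cat E (Dom E f)\<^esub> FArr (pb_functor E f) (Slice (g \<cdot> h) h g)"
      by (simp add: pb_functor_def pb_pair_comp r r2)
  next
    show "\<forall>a\<in>Obj (slice_cat E (Cod E f)). FArr (pb_functor E f) (Ident (slice_cat E (Cod E f)) a)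
      = Ident (slice_cat E (Dom E f)) (FObj (pb_functor E f) a)"
    proof
      fix m assume "m \<in> Obj (slice_cat E (Cod E f))"
      then show "FArr (pb_functor E f) (Ident (slice_cat E (Cod E f)) m)
        = Ident (slice_cat E (Dom E f)) (FObj (pb_functor E f) m)"
        using pb_pair_eta[of m f "Ident E (pb E m f)"]
        by (simp add: pb_functor_def)
    qed
  qed (simp_all add: slice_category pb_functor_def hom_def slice_Arr r)
qed

section \<open>Exponentiable morphisms\<close>

text \<open>A generalized element of the pullback of \<open>x\<close> and \<open>f\<close>, kept as
  a pair of arrows so that no chosen pullback is involved. Equality of the two domains is a
  consequence, by \<open>cone_Dom\<close>.\<close>

abbreviation cone :: "'m \<Rightarrow> 'm \<Rightarrow> 'm \<Rightarrow> 'm \<Rightarrow> bool" where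
  "cone x f t y \<equiv> t \<in> Arr E \<and> y \<in> Arr E \<and> Cod E t = Dom E x \<and> Cod E y = Dom E f \<and> x \<cdot> t = f \<cdot> y"

text \<open>\<open>natfam f g x F\<close>: \<open>F t y\<close> is a natural assignment, to all \<open>t\<close> into the domain of \<open>x\<close> and all \<open>y\<close>
  with \<open>f y = x t\<close>, of an arrow lying over \<open>y\<close> along \<open>g\<close>.  \<open>depprod f g \<pi> ap\<close> says that \<open>\<pi>\<close>
  represents such families, that is, \<open>\<pi> = \<Pi>\<^sub>f g\<close>, with \<open>ap k y\<close> the value of \<open>k\<close> at \<open>y\<close>.\<close>

definition natfam :: "'m \<Rightarrow> 'm \<Rightarrow> 'm \<Rightarrow> ('m \<Rightarrow> 'm \<Rightarrow> 'm) \<Rightarrow> bool" where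
  "natfam f g x F \<longleftrightarrow> (\<forall>t y. cone x f t y \<longrightarrow>
     F t y \<in> Arr E \<and> Cod E (F t y) = Dom E g \<and> g \<cdot> F t y = y \<and>
     (\<forall>u\<in>Arr E. Cod E u = Dom E t \<longrightarrow> F t y \<cdot> u = F (t \<cdot> u) (y \<cdot> u)))"

definition depprod :: "'m \<Rightarrow> 'm \<Rightarrow> 'm \<Rightarrow> ('m \<Rightarrow> 'm \<Rightarrow> 'm) \<Rightarrow> bool" where
  "depprod f g \<pi> ap \<longleftrightarrow> \<pi> \<in> Arr E \<and> Cod E \<pi> = Cod E f \<and>
     (\<forall>k y. cone \<pi> f k y \<longrightarrow> ap k y \<in> Arr E \<and> Cod E (ap k y) = Dom E g \<and> g \<cdot> ap k y = y \<and>
        (\<forall>u\<in>Arr E. Cod E u = Dom E k \<longrightarrow> ap k y \<cdot> u = ap (k \<cdot> u) (y \<cdot> u))) \<and>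
     (\<forall>k\<in>Arr E. \<forall>k'\<in>Arr E. Dom E k = Dom E k' \<and> Cod E k = Dom E \<pi> \<and> Cod E k' = Dom E \<pi> \<and>
        \<pi> \<cdot> k = \<pi> \<cdot> k' \<and> (\<forall>t y. cone (\<pi> \<cdot> k) f t y \<longrightarrow> ap (k \<cdot> t) y = ap (k' \<cdot> t) y) \<longrightarrow> k = k') \<and>
     (\<forall>x\<in>Arr E. \<forall>F. Cod E x = Cod E f \<and> natfam f g x F \<longrightarrow>
        (\<exists>k\<in>Arr E. Dom E k = Dom E x \<and> Cod E k = Dom E \<pi> \<and> \<pi> \<cdot> k = x \<and>
          (\<forall>t y. cone x f t y \<longrightarrow> ap (k \<cdot> t) y = F t y)))"

lemma cone_Dom:
  assumes "x \<in> Arr E" "f \<in> Arr E" "cone x f t y"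
  shows "Dom E t = Dom E y"
  using assms cat_simps(7) by metis

lemma natfamD:
  assumes "natfam f g x F" "cone x f t y"
  shows "F t y \<in> Arr E" "Cod E (F t y) = Dom E g" "g \<cdot> F t y = y"
    "u \<in> Arr E \<Longrightarrow> Cod E u = Dom E t \<Longrightarrow> F t y \<cdot> u = F (t \<cdot> u) (y \<cdot> u)"
  using assms by (auto simp: natfam_def)

lemma depprodD:
  assumes "depprod f g \<pi> ap"
  shows "\<pi> \<in> Arr E" "Cod E \<pi> = Cod E f"
    "cone \<pi> f k y \<Longrightarrow> ap k y \<in> Arr E" "cone \<pi> f k y \<Longrightarrow> Cod E (ap k y) = Dom E g"
    "cone \<pi> f k y \<Longrightarrow> g \<cdot> ap k y = y"
    "cone \<pi> f k y \<Longrightarrow> u \<in> Arr E \<Longrightarrow> Cod E u = Dom E k \<Longrightarrow> ap k y \<cdot> u = ap (k \<cdot> u) (y \<cdot> u)"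
    and depprod_eqI: "\<lbrakk>k \<in> Arr E; k' \<in> Arr E; Dom E k = Dom E k'; Cod E k = Dom E \<pi>; Cod E k' = Dom E \<pi>;
      \<pi> \<cdot> k = \<pi> \<cdot> k'; \<And>t y. cone (\<pi> \<cdot> k) f t y \<Longrightarrow> ap (k \<cdot> t) y = ap (k' \<cdot> t) y\<rbrakk> \<Longrightarrow> k = k'"
    and depprod_ex: "x \<in> Arr E \<Longrightarrow> Cod E x = Cod E f \<Longrightarrow> natfam f g x F \<Longrightarrow>
      \<exists>k\<in>Arr E. Dom E k = Dom E x \<and> Cod E k = Dom E \<pi> \<and> \<pi> \<cdot> k = x \<and>
          (\<forall>t y. cone x f t y \<longrightarrow> ap (k \<cdot> t) y = F t y)"
  using assms unfolding depprod_def by blast+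

section \<open>Right adjoints to pullback as dependent products\<close>

lemma Pi_adjunction:
  assumes "exponentiable E f"
  shows "\<exists>\<eta>. is_adjunction (slice_cat E (Cod E f)) (slice_cat E (Dom E f)) (pb_functor E f)
    (Pi_functor E f) \<eta> (Pi_counit E f)"
proof -
  have "\<exists>x. case x of (G, \<epsilon>) \<Rightarrow> \<exists>\<eta>. is_adjunction (slice_cat E (Cod E f)) (slice_cat E (Dom E f))
      (pb_functor E f) G \<eta> \<epsilon>"
    using assms by (auto simp: exponentiable_def)
  from someI_ex[OF this] show ?thesis
    by (auto simp: Pi_functor_def Pi_counit_def dep_prod_def split: prod.splits)
qed

lemma pb_functor_simps [simp]:
  "FObj (pb_functor E f) x = pb2 E x f"
  "FArr (pb_functor E f) (Slice x k z) =
     Slice (pb2 E x f) (pb_pair E z f (k \<cdot> pb1 E x f) (pb2 E x f)) (pb2 E z f)"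
  by (simp_all add: pb_functor_def)

lemma slice_hom: "g \<in> Arr E \<Longrightarrow> Cod E g = a \<Longrightarrow> m \<in> hom (slice_cat E a) f g \<longleftrightarrow>
   (\<exists>h\<in>Arr E. Cod E h = Dom E g \<and> g \<cdot> h = f \<and> m = Slice f h g)"
  by (cases m) (auto simp: hom_def slice_Arr)

lemma Pi_counit:
  assumes ex: "exponentiable E f" and g: "g \<in> Arr E" "Cod E g = Dom E f"
  shows "FObj (Pi_functor E f) g \<in> Arr E" "Cod E (FObj (Pi_functor E f) g) = Cod E f"
    "Pi_counit E f g = Slice (pb2 E (FObj (Pi_functor E f) g) f) (slice_map (Pi_counit E f g)) g"
    "slice_map (Pi_counit E f g) \<in> Arr E"
    "Dom E (slice_map (Pi_counit E f g)) = pb E (FObj (Pi_functor E f) g) f"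
    "Cod E (slice_map (Pi_counit E f g)) = Dom E g"
    "g \<cdot> slice_map (Pi_counit E f g) = pb2 E (FObj (Pi_functor E f) g) f"
proof -
  define \<pi> where "\<pi> = FObj (Pi_functor E f) g"
  define e where "e = slice_map (Pi_counit E f g)"
  note [simp] = g
  have f [simp]: "f \<in> Arr E" using ex by (simp add: exponentiable_def)
  obtain \<eta> where adj: "is_adjunction (slice_cat E (Cod E f)) (slice_cat E (Dom E f)) (pb_functor E f)
    (Pi_functor E f) \<eta> (Pi_counit E f)"
    using Pi_adjunction[OF ex] by blast
  have "\<pi> \<in> Obj (slice_cat E (Cod E f))"
    using adj unfolding \<pi>_def by (auto simp: is_adjunction_def is_functor_def)
  then have pi [simp]: "\<pi> \<in> Arr E" "Cod E \<pi> = Cod E f" by simp_all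
  have "Pi_counit E f g \<in> hom (slice_cat E (Dom E f)) (pb2 E \<pi> f) g"
    using adj unfolding \<pi>_def
    by (auto simp: is_adjunction_def is_nat_trans_def comp_func_def id_func_def)
  then have c: "Pi_counit E f g = Slice (pb2 E \<pi> f) e g"
    and e [simp]: "e \<in> Arr E" "Cod E e = Dom E g" and ge: "g \<cdot> e = pb2 E \<pi> f"
    unfolding e_def by (auto simp: slice_hom)
  have [simp]: "Dom E e = pb E \<pi> f"
    using arg_cong[OF ge, of "Dom E"] by simp
  show "FObj (Pi_functor E f) g \<in> Arr E" "Cod E (FObj (Pi_functor E f) g) = Cod E f"
    "Pi_counit E f g = Slice (pb2 E (FObj (Pi_functor E f) g) f) (slice_map (Pi_counit E f g)) g"
    "slice_map (Pi_counit E f g) \<in> Arr E"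
    "Dom E (slice_map (Pi_counit E f g)) = pb E (FObj (Pi_functor E f) g) f"
    "Cod E (slice_map (Pi_counit E f g)) = Dom E g"
    "g \<cdot> slice_map (Pi_counit E f g) = pb2 E (FObj (Pi_functor E f) g) f"
    using c ge unfolding \<pi>_def[symmetric] e_def[symmetric] by simp_all
qed

text \<open>A Yoneda argument: a natural family is fixed by its value at the two pullback
  projections of \<open>x\<close> and \<open>f\<close>, and such a value is exactly a slice arrow
  from the pulled-back \<open>x\<close> to \<open>g\<close>. The counit turns it into an arrow into
  the dependent product.\<close>

lemma Pi_depprod:
  assumes ex: "exponentiable E f" and g [simp]: "g \<in> Arr E" "Cod E g = Dom E f"
  shows "depprod f g (FObj (Pi_functor E f) g)
    (\<lambda>k y. slice_map (Pi_counit E f g) \<cdot> pb_pair E (FObj (Pi_functor E f) g) f k y)"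
proof -
  define \<pi> where "\<pi> = FObj (Pi_functor E f) g"
  define e where "e = slice_map (Pi_counit E f g)"
  have f [simp]: "f \<in> Arr E" using ex by (simp add: exponentiable_def)
  obtain \<eta> where adj: "is_adjunction (slice_cat E (Cod E f)) (slice_cat E (Dom E f)) (pb_functor E f)
    (Pi_functor E f) \<eta> (Pi_counit E f)"
    using Pi_adjunction[OF ex] by blast
  note c = Pi_counit(3)[OF ex g, folded \<pi>_def e_def] and ge = Pi_counit(7)[OF ex g, folded \<pi>_def e_def]
  note pi [simp] = Pi_counit(1,2)[OF ex g, folded \<pi>_def]
    and e [simp] = Pi_counit(4-6)[OF ex g, folded \<pi>_def e_def]
  \<comment> \<open>The universal property of the counit, stripped of the slice wrappers.\<close>
  have univ: "\<exists>!k. k \<in> Arr E \<and> Cod E k = Dom E \<pi> \<and> \<pi> \<cdot> k = x \<and>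
       e \<cdot> pb_pair E \<pi> f (k \<cdot> pb1 E x f) (pb2 E x f) = h"
    if x: "x \<in> Arr E" "Cod E x = Cod E f" "h \<in> Arr E" "Cod E h = Dom E g" "g \<cdot> h = pb2 E x f" for x h
  proof -
    let ?Q = "\<lambda>m. m \<in> hom (slice_cat E (Cod E f)) x \<pi> \<and>
       Pi_counit E f g \<cdot>\<^bsub>slice_cat E (Dom E f)\<^esub> FArr (pb_functor E f) m = Slice (pb2 E x f) h g"
    have "\<exists>!m. ?Q m"
      using counit_universal[OF adj, of x g "Slice (pb2 E x f) h g"] x
      by (simp add: slice_hom \<pi>_def)
    moreover have Q: "?Q (Slice x k \<pi>) \<longleftrightarrow> k \<in> Arr E \<and> Cod E k = Dom E \<pi> \<and> \<pi> \<cdot> k = x \<and>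
       e \<cdot> pb_pair E \<pi> f (k \<cdot> pb1 E x f) (pb2 E x f) = h" for k
      unfolding c slice_hom[OF pi] by auto
    moreover have "\<exists>k. m = Slice x k \<pi>" if "?Q m" for m
      using that unfolding slice_hom[OF pi] by blast
    ultimately show ?thesis unfolding Q[symmetric] by (metis slice_arr.inject)
  qed
  have ev_typ: "e \<cdot> pb_pair E \<pi> f k y \<in> Arr E" "Cod E (e \<cdot> pb_pair E \<pi> f k y) = Dom E g"
     "g \<cdot> e \<cdot> pb_pair E \<pi> f k y = y"
     "u \<in> Arr E \<Longrightarrow> Cod E u = Dom E k \<Longrightarrow> (e \<cdot> pb_pair E \<pi> f k y) \<cdot> u = e \<cdot> pb_pair E \<pi> f (k \<cdot> u) (y \<cdot> u)"
    if "cone \<pi> f k y" for k y u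
    using that cone_Dom[OF pi(1) f that] comp_eq_arr[OF ge, of "pb_pair E \<pi> f k y"]
    by (simp_all add: pb_pair_comp)
  have "depprod f g \<pi> (\<lambda>k y. e \<cdot> pb_pair E \<pi> f k y)"
    unfolding depprod_def
  proof (intro conjI allI ballI impI)
    fix k k' assume k: "k \<in> Arr E" "k' \<in> Arr E" and
      a: "Dom E k = Dom E k' \<and> Cod E k = Dom E \<pi> \<and> Cod E k' = Dom E \<pi> \<and> \<pi> \<cdot> k = \<pi> \<cdot> k' \<and>
      (\<forall>t y. cone (\<pi> \<cdot> k) f t y \<longrightarrow> e \<cdot> pb_pair E \<pi> f (k \<cdot> t) y = e \<cdot> pb_pair E \<pi> f (k' \<cdot> t) y)"
    \<comment> \<open>By uniqueness in \<open>univ\<close> it is enough to compare the values at the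
      generic pair.\<close>
    let ?x = "\<pi> \<cdot> k'"
    let ?h = "e \<cdot> pb_pair E \<pi> f (k' \<cdot> pb1 E ?x f) (pb2 E ?x f)"
    have q: "cone \<pi> f (k' \<cdot> pb1 E ?x f) (pb2 E ?x f)"
      using k a pb_square[of ?x f] by simp
    have "cone ?x f (pb1 E ?x f) (pb2 E ?x f)"
      using k a pb_square[of ?x f] by simp
    then have "e \<cdot> pb_pair E \<pi> f (k \<cdot> pb1 E ?x f) (pb2 E ?x f) = ?h"
      using a k by simp
    moreover have "\<exists>!k. k \<in> Arr E \<and> Cod E k = Dom E \<pi> \<and> \<pi> \<cdot> k = ?x \<and>
       e \<cdot> pb_pair E \<pi> f (k \<cdot> pb1 E ?x f) (pb2 E ?x f) = ?h"
      by (rule univ) (use k a ev_typ[OF q] in auto)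
    ultimately show "k = k'" using k a by auto
  next
    fix x F assume x: "x \<in> Arr E" and a: "Cod E x = Cod E f \<and> natfam f g x F"
    have q: "cone x f (pb1 E x f) (pb2 E x f)"
      using x a pb_square[of x f] by simp
    let ?h = "F (pb1 E x f) (pb2 E x f)"
    have h: "?h \<in> Arr E" "Cod E ?h = Dom E g" "g \<cdot> ?h = pb2 E x f"
      using natfamD[OF conjunct2[OF a] q] by blast+
    obtain k where k: "k \<in> Arr E" "Cod E k = Dom E \<pi>" "\<pi> \<cdot> k = x"
      "e \<cdot> pb_pair E \<pi> f (k \<cdot> pb1 E x f) (pb2 E x f) = ?h"
      using univ[of x ?h] x a h by auto
    have "e \<cdot> pb_pair E \<pi> f (k \<cdot> t) y = F t y" if c: "cone x f t y" for t y
    proof -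
      have d: "Dom E t = Dom E y" using cone_Dom[OF x f c] .
      \<comment> \<open>Every cone is the generic one precomposed with such a \<open>?u\<close>, and
        naturality of \<open>F\<close> moves the value along it.\<close>
      let ?u = "pb_pair E x f t y"
      have u: "?u \<in> Arr E" "Cod E ?u = pb E x f" "pb1 E x f \<cdot> ?u = t" "pb2 E x f \<cdot> ?u = y"
        using c d x a by simp_all
      have pk: "\<pi> \<cdot> k \<cdot> pb1 E x f = x \<cdot> pb1 E x f"
        by (rule comp_eq_arr[OF k(3)]) (use k x a in auto)
      have [simp]: "Dom E k = Dom E x" using k by auto
      have "F t y = ?h \<cdot> ?u"
        using natfamD(4)[OF conjunct2[OF a] q, of ?u] u x a by simp
      also have "\<dots> = e \<cdot> pb_pair E \<pi> f (k \<cdot> pb1 E x f) (pb2 E x f) \<cdot> ?u"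
        using comp_eq_arr[OF k(4), of ?u] k x a u pb_square[of x f] pk by simp
      also have "pb_pair E \<pi> f (k \<cdot> pb1 E x f) (pb2 E x f) \<cdot> ?u = pb_pair E \<pi> f (k \<cdot> t) y"
        using k x a u pb_square[of x f] pk d by (subst pb_pair_comp) simp_all
      finally show ?thesis by simp
    qed
    moreover have "Dom E k = Dom E x" using k by auto
    ultimately show "\<exists>k\<in>Arr E. Dom E k = Dom E x \<and> Cod E k = Dom E \<pi> \<and> \<pi> \<cdot> k = x \<and>
          (\<forall>t y. cone x f t y \<longrightarrow> e \<cdot> pb_pair E \<pi> f (k \<cdot> t) y = F t y)"
      using k by blast
  qed (use ev_typ in simp_all)
  then show ?thesis by (simp add: \<pi>_def e_def)
qed

text \<open>Existence for each \<open>g\<close> separately suffices, since universal arrows assemble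
  into a right adjoint. The counit at \<open>g\<close> is the value of the representing object at
  its generic pair.\<close>

lemma exponentiableI:
  assumes f [simp]: "f \<in> Arr E"
    and ex: "\<And>g. g \<in> Arr E \<Longrightarrow> Cod E g = Dom E f \<Longrightarrow> \<exists>\<pi> ap. depprod f g \<pi> ap"
  shows "exponentiable E f"
proof -
  have "\<forall>g. \<exists>\<pi> ap. g \<in> Arr E \<and> Cod E g = Dom E f \<longrightarrow> depprod f g \<pi> ap"
    using ex by blast
  then obtain \<pi> ap where d: "\<And>g. g \<in> Arr E \<and> Cod E g = Dom E f \<Longrightarrow> depprod f g (\<pi> g) (ap g)"
    by metis
  note D = depprodD[OF d]
  define \<epsilon> where "\<epsilon> g = Slice (pb2 E (\<pi> g) f) (ap g (pb1 E (\<pi> g) f) (pb2 E (\<pi> g) f)) g" for g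
  have gen: "cone x f (pb1 E x f) (pb2 E x f)" if "x \<in> Arr E" "Cod E x = Cod E f" for x
    using that pb_square[of x f] by simp
  have "\<exists>G \<eta>. is_adjunction (slice_cat E (Cod E f)) (slice_cat E (Dom E f)) (pb_functor E f) G \<eta> \<epsilon>"
  proof (rule right_adjoint_of_universal_arrows[of _ _ _ \<pi>])
    fix x g h assume xg: "x \<in> Obj (slice_cat E (Cod E f))" "g \<in> Obj (slice_cat E (Dom E f))"
      "h \<in> hom (slice_cat E (Dom E f)) (FObj (pb_functor E f) x) g"
    then have x [simp]: "x \<in> Arr E" "Cod E x = Cod E f" and g [simp]: "g \<in> Arr E" "Cod E g = Dom E f"
      by simp_all
    obtain h' where h' [simp]: "h' \<in> Arr E" "Cod E h' = Dom E g" and gh: "g \<cdot> h' = pb2 E x f"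
      and h: "h = Slice (pb2 E x f) h' g"
      using xg by (auto simp: slice_hom)
    have [simp]: "Dom E h' = pb E x f" using arg_cong[OF gh, of "Dom E"] by simp
    have pi [simp]: "\<pi> g \<in> Arr E" "Cod E (\<pi> g) = Cod E f"
      using D[of g] by simp_all
    \<comment> \<open>The counit is built from a single value; naturality recovers \<open>ap\<close>
      at every pair from it.\<close>
    have ap_gen: "ap g (pb1 E (\<pi> g) f) (pb2 E (\<pi> g) f) \<cdot> pb_pair E (\<pi> g) f k y = ap g k y"
      if "cone (\<pi> g) f k y" for k y
      using D(6)[of g "pb1 E (\<pi> g) f" "pb2 E (\<pi> g) f" "pb_pair E (\<pi> g) f k y"] gen[of "\<pi> g"]
        that cone_Dom[OF _ _ that] by simp
    \<comment> \<open>Evaluating an arrow out of the chosen pullback at pairs gives a natural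
      family; representing that family transposes the arrow.\<close>
    have "natfam f g x (\<lambda>t y. h' \<cdot> pb_pair E x f t y)"
      unfolding natfam_def
    proof (intro allI impI)
      fix t y assume c: "cone x f t y"
      then show "h' \<cdot> pb_pair E x f t y \<in> Arr E \<and> Cod E (h' \<cdot> pb_pair E x f t y) = Dom E g \<and>
        g \<cdot> h' \<cdot> pb_pair E x f t y = y \<and> (\<forall>u\<in>Arr E. Cod E u = Dom E t \<longrightarrow>
          (h' \<cdot> pb_pair E x f t y) \<cdot> u = h' \<cdot> pb_pair E x f (t \<cdot> u) (y \<cdot> u))"
        using cone_Dom[OF x(1) f c] comp_eq_arr[OF gh, of "pb_pair E x f t y"]
        by (simp add: pb_pair_comp)
    qed
    from depprod_ex[OF d _ _ this]
    obtain k where k [simp]: "k \<in> Arr E" "Dom E k = Dom E x" "Cod E k = Dom E (\<pi> g)" and pk: "\<pi> g \<cdot> k = x"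
      and kk: "\<And>t y. cone x f t y \<Longrightarrow> ap g (k \<cdot> t) y = h' \<cdot> pb_pair E x f t y"
      by auto
    have pk': "\<pi> g \<cdot> k \<cdot> t = x \<cdot> t" if "t \<in> Arr E" "Cod E t = Dom E x" for t
      using comp_eq_arr[OF pk] that by simp
    show "\<exists>!m. m \<in> hom (slice_cat E (Cod E f)) x (\<pi> g) \<and>
      \<epsilon> g \<cdot>\<^bsub>slice_cat E (Dom E f)\<^esub> FArr (pb_functor E f) m = h"
    proof (rule ex1I)
      have "ap g (k \<cdot> pb1 E x f) (pb2 E x f) = h'"
        using kk[OF gen[OF x]] pb_pair_eta[of x f "Ident E (pb E x f)"] by simp
      then show "Slice x k (\<pi> g) \<in> hom (slice_cat E (Cod E f)) x (\<pi> g) \<and>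
        \<epsilon> g \<cdot>\<^bsub>slice_cat E (Dom E f)\<^esub> FArr (pb_functor E f) (Slice x k (\<pi> g)) = h"
        using ap_gen[of "k \<cdot> pb1 E x f" "pb2 E x f"] gen[OF x] pk
        by (simp add: slice_hom \<epsilon>_def h pk')
    next
      fix m assume m: "m \<in> hom (slice_cat E (Cod E f)) x (\<pi> g) \<and>
        \<epsilon> g \<cdot>\<^bsub>slice_cat E (Dom E f)\<^esub> FArr (pb_functor E f) m = h"
      then obtain l where l [simp]: "l \<in> Arr E" "Cod E l = Dom E (\<pi> g)" and pl: "\<pi> g \<cdot> l = x"
        and ml: "m = Slice x l (\<pi> g)"
        by (auto simp: slice_hom)
      have Dl [simp]: "Dom E l = Dom E x" using arg_cong[OF pl, of "Dom E"] by simp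
      have pl': "\<pi> g \<cdot> l \<cdot> t = x \<cdot> t" if "t \<in> Arr E" "Cod E t = Dom E x" for t
        using comp_eq_arr[OF pl] that by simp
      have "ap g (l \<cdot> pb1 E x f) (pb2 E x f) = h'"
        using m ap_gen[of "l \<cdot> pb1 E x f" "pb2 E x f"] gen[OF x] unfolding ml
        by (simp add: \<epsilon>_def h pl')
      then have "h' \<cdot> pb_pair E x f t y = ap g (l \<cdot> t) y" if c: "cone x f t y" for t y
        using D(6)[of g "l \<cdot> pb1 E x f" "pb2 E x f" "pb_pair E x f t y"] c cone_Dom[OF x(1) f c]
          gen[OF x] by (simp add: pl')
      then have "k = l"
        by (intro depprod_eqI[OF d, of g k l]) (use pk pl kk in auto)
      then show "m = Slice x k (\<pi> g)" using ml by simp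
    qed
  next
    fix g assume "g \<in> Obj (slice_cat E (Dom E f))"
    then show "\<pi> g \<in> Obj (slice_cat E (Cod E f))"
      and "\<epsilon> g \<in> hom (slice_cat E (Dom E f)) (FObj (pb_functor E f) (\<pi> g)) g"
      using D[of g] gen[of "\<pi> g"] by (auto simp: slice_hom \<epsilon>_def)
  qed (simp add: pb_functor)
  then show ?thesis using f by (auto simp: exponentiable_def)
qed

section \<open>Closure of exponentiable morphisms under identities, composition and base
  change\<close>

lemma depprod_exists:
  "exponentiable E f \<Longrightarrow> g \<in> Arr E \<Longrightarrow> Cod E g = Dom E f \<Longrightarrow> \<exists>\<pi> ap. depprod f g \<pi> ap"
  using Pi_depprod by blast

text \<open>A pair over an identity has \<open>y = x \<cdot> t\<close>, so a natural family amounts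
  to one lift of \<open>x\<close> through \<open>g\<close>, and \<open>g\<close> is its own
  dependent product.\<close>

lemma exponentiable_Ident:
  assumes "a \<in> Obj E"
  shows "exponentiable E (Ident E a)"
proof (rule exponentiableI)
  fix g assume "g \<in> Arr E" "Cod E g = Dom E (Ident E a)"
  moreover from this have "\<exists>k\<in>Arr E. Dom E k = Dom E x \<and> Cod E k = Dom E g \<and> g \<cdot> k = x \<and>
      (\<forall>t y. cone x (Ident E a) t y \<longrightarrow> k \<cdot> t = F t y)"
    if "x \<in> Arr E" "Cod E x = a" "natfam (Ident E a) g x F" for x F
  proof (intro bexI[of _ "F (Ident E (Dom E x)) x"] conjI allI impI)
    have c: "cone x (Ident E a) (Ident E (Dom E x)) x" using that assms by simp
    note F = natfamD[OF that(3) c]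
    then show "F (Ident E (Dom E x)) x \<in> Arr E" "Cod E (F (Ident E (Dom E x)) x) = Dom E g"
      "g \<cdot> F (Ident E (Dom E x)) x = x" by simp_all
    then show "Dom E (F (Ident E (Dom E x)) x) = Dom E x"
      using \<open>g \<in> Arr E\<close> by (metis cat_simps(7))
    fix t y assume "cone x (Ident E a) t y"
    then show "F (Ident E (Dom E x)) x \<cdot> t = F t y"
      using F(4)[of t] that assms by simp
  qed
  ultimately have "depprod (Ident E a) g g (\<lambda>k y. k)"
    unfolding depprod_def using assms by (auto dest: bspec[of _ _ "Ident E (Dom E _)"])
      (use cat_simps in metis)
  then show "\<exists>\<pi> ap. depprod (Ident E a) g \<pi> ap" by blast
qed (use assms in simp)

text \<open>Dependent products compose: \<open>\<Pi>\<close> along \<open>f \<cdot> g\<close> is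
  \<open>\<Pi>\<close> along \<open>f\<close> of \<open>\<Pi>\<close> along \<open>g\<close>. An
  element takes \<open>g \<cdot> c\<close> to an element of the inner product, which takes
  \<open>c\<close> to the value.\<close>

lemma exponentiable_comp:
  assumes ef: "exponentiable E f" and eg: "exponentiable E g" and fg [simp]: "Cod E g = Dom E f"
  shows "exponentiable E (f \<cdot> g)"
proof -
  have [simp]: "f \<in> Arr E" "g \<in> Arr E" using ef eg by (simp_all add: exponentiable_def)
  show ?thesis
  proof (rule exponentiableI)
    fix h assume "h \<in> Arr E" "Cod E h = Dom E (f \<cdot> g)"
    then have h [simp]: "h \<in> Arr E" "Cod E h = Dom E g" by simp_all
    obtain \<pi>1 a1 where d1: "depprod g h \<pi>1 a1" using depprod_exists[OF eg h] by blast
    have p1 [simp]: "\<pi>1 \<in> Arr E" "Cod E \<pi>1 = Dom E f" using depprodD(1,2)[OF d1] by simp_all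
    obtain \<pi>2 a2 where d2: "depprod f \<pi>1 \<pi>2 a2" using depprod_exists[OF ef p1] by blast
    have p2 [simp]: "\<pi>2 \<in> Arr E" "Cod E \<pi>2 = Cod E f" using depprodD(1,2)[OF d2] by simp_all
    have t2: "a2 k y \<in> Arr E" "Cod E (a2 k y) = Dom E \<pi>1" "\<pi>1 \<cdot> a2 k y = y" "Dom E (a2 k y) = Dom E k"
      "u \<in> Arr E \<Longrightarrow> Cod E u = Dom E k \<Longrightarrow> a2 k y \<cdot> u = a2 (k \<cdot> u) (y \<cdot> u)"
      if c: "cone \<pi>2 f k y" for k y u
      using depprodD(3-6)[OF d2 c] cone_Dom[OF p2(1) _ c] cat_simps(7)[of "a2 k y" \<pi>1] by simp_all
    have c2: "cone \<pi>2 f k (g \<cdot> c)" if "cone \<pi>2 (f \<cdot> g) k c" for k c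
      using that by simp
    have c1: "cone \<pi>1 g (a2 k (g \<cdot> c)) c" if "cone \<pi>2 (f \<cdot> g) k c" for k c
      using that t2[OF c2[OF that]] by simp
    have "depprod (f \<cdot> g) h \<pi>2 (\<lambda>k c. a1 (a2 k (g \<cdot> c)) c)"
      unfolding depprod_def
    proof (intro conjI allI ballI impI)
      fix k c assume c: "cone \<pi>2 (f \<cdot> g) k c"
      show "a1 (a2 k (g \<cdot> c)) c \<in> Arr E" "Cod E (a1 (a2 k (g \<cdot> c)) c) = Dom E h"
        "h \<cdot> a1 (a2 k (g \<cdot> c)) c = c"
        using depprodD(3-5)[OF d1 c1[OF c]] by auto
      fix u assume u: "u \<in> Arr E" "Cod E u = Dom E k"
      show "a1 (a2 k (g \<cdot> c)) c \<cdot> u = a1 (a2 (k \<cdot> u) (g \<cdot> c \<cdot> u)) (c \<cdot> u)"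
        using depprodD(6)[OF d1 c1[OF c], of u] u t2(4,5)[OF c2[OF c]] c
          cone_Dom[OF p2(1) _ c] by simp
    next
      fix k k' assume k [simp]: "k \<in> Arr E" "k' \<in> Arr E" and
        "Dom E k = Dom E k' \<and> Cod E k = Dom E \<pi>2 \<and> Cod E k' = Dom E \<pi>2 \<and> \<pi>2 \<cdot> k = \<pi>2 \<cdot> k' \<and>
        (\<forall>t c. cone (\<pi>2 \<cdot> k) (f \<cdot> g) t c \<longrightarrow>
          a1 (a2 (k \<cdot> t) (g \<cdot> c)) c = a1 (a2 (k' \<cdot> t) (g \<cdot> c)) c)"
      then have k' [simp]: "Dom E k = Dom E k'" "Cod E k = Dom E \<pi>2" "Cod E k' = Dom E \<pi>2" and
        pk: "\<pi>2 \<cdot> k = \<pi>2 \<cdot> k'" and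
        eq: "\<And>t c. cone (\<pi>2 \<cdot> k) (f \<cdot> g) t c \<Longrightarrow>
          a1 (a2 (k \<cdot> t) (g \<cdot> c)) c = a1 (a2 (k' \<cdot> t) (g \<cdot> c)) c"
        by blast+
      show "k = k'"
      proof (rule depprod_eqI[OF d2 _ _ _ _ _ pk])
        fix t y assume c: "cone (\<pi>2 \<cdot> k) f t y"
        have cd: "Dom E t = Dom E y" by (rule cone_Dom[OF _ _ c]) simp_all
        have cc: "cone \<pi>2 f (k \<cdot> t) y" "cone \<pi>2 f (k' \<cdot> t) y"
          using c comp_eq_comp[OF pk, of t] by auto
        note T = t2[OF cc(1)] t2[OF cc(2)]
        show "a2 (k \<cdot> t) y = a2 (k' \<cdot> t) y"
        proof (rule depprod_eqI[OF d1])
          fix s z assume s: "cone (\<pi>1 \<cdot> a2 (k \<cdot> t) y) g s z"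
          then have s': "y \<cdot> s = g \<cdot> z" using T by simp
          \<comment> \<open>The inner test stage \<open>s\<close> is absorbed into
            \<open>t \<cdot> s\<close>, over which \<open>z\<close> is an argument for the
            composite.\<close>
          have c3: "cone (\<pi>2 \<cdot> k) (f \<cdot> g) (t \<cdot> s) z"
            using s c T s' cd comp_eq_comp[of "\<pi>2" "k \<cdot> t" f y s] by auto
          show "a1 (a2 (k \<cdot> t) y \<cdot> s) z = a1 (a2 (k' \<cdot> t) y \<cdot> s) z"
            using eq[OF c3] T(5)[of s] T(10)[of s] s c T s' cd by simp
        qed (use T c in simp_all)
      qed (use k' in simp_all)
    next
      fix x F assume x [simp]: "x \<in> Arr E" and "Cod E x = Cod E (f \<cdot> g) \<and> natfam (f \<cdot> g) h x F"
      then have Cx [simp]: "Cod E x = Cod E f" and F: "natfam (f \<cdot> g) h x F" by simp_all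
      \<comment> \<open>Currying: \<open>?K t y k\<close> says that \<open>k\<close> represents the
        family \<open>F\<close> with its argument along \<open>f\<close> frozen at \<open>y\<close>.
        Uniqueness of representing arrows makes the choice in \<open>F'\<close> natural.\<close>
      let ?K = "\<lambda>t y k. k \<in> Arr E \<and> Dom E k = Dom E y \<and> Cod E k = Dom E \<pi>1 \<and> \<pi>1 \<cdot> k = y \<and>
        (\<forall>s c. cone y g s c \<longrightarrow> a1 (k \<cdot> s) c = F (t \<cdot> s) c)"
      define F' where "F' t y = (SOME k. ?K t y k)" for t y
      have fam: "cone x (f \<cdot> g) (t \<cdot> s) c" if "cone x f t y" "cone y g s c" for t y s c
        using that cone_Dom[OF _ _ that(1)] comp_eq_comp[of x t f y s] by auto
      have F': "?K t y (F' t y)" if c: "cone x f t y" for t y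
      proof -
        have cd: "Dom E t = Dom E y" by (rule cone_Dom[OF _ _ c]) simp_all
        have "natfam g h y (\<lambda>s c. F (t \<cdot> s) c)"
          unfolding natfam_def
        proof (intro allI impI conjI ballI)
          fix s z assume s: "cone y g s z"
          note N = natfamD[OF F fam[OF c s]]
          show "F (t \<cdot> s) z \<in> Arr E" "Cod E (F (t \<cdot> s) z) = Dom E h" "h \<cdot> F (t \<cdot> s) z = z"
            using N by auto
          fix u assume "u \<in> Arr E" "Cod E u = Dom E s"
          then show "F (t \<cdot> s) z \<cdot> u = F (t \<cdot> s \<cdot> u) (z \<cdot> u)"
            using N(4)[of u] c s cd by simp
        qed
        from depprod_ex[OF d1 _ _ this] c have "\<exists>k. ?K t y k" by auto
        then show ?thesis unfolding F'_def by (rule someI_ex)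
      qed
      have "natfam f \<pi>1 x F'"
        unfolding natfam_def
      proof (intro allI impI conjI ballI)
        fix t y assume c: "cone x f t y"
        have cd: "Dom E t = Dom E y" by (rule cone_Dom[OF _ _ c]) simp_all
        note T = F'[OF c]
        show "F' t y \<in> Arr E" "Cod E (F' t y) = Dom E \<pi>1" "\<pi>1 \<cdot> F' t y = y" using T by auto
        fix u assume u: "u \<in> Arr E" "Cod E u = Dom E t"
        have cu: "cone x f (t \<cdot> u) (y \<cdot> u)"
          using c u cd comp_eq_comp[of x t f y u] by auto
        note T' = F'[OF cu]
        have pu: "\<pi>1 \<cdot> F' t y \<cdot> u = y \<cdot> u"
          by (rule comp_eq_arr) (use T u cd in auto)
        show "F' t y \<cdot> u = F' (t \<cdot> u) (y \<cdot> u)"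
        proof (rule depprod_eqI[OF d1])
          fix s z assume s: "cone (\<pi>1 \<cdot> F' t y \<cdot> u) g s z"
          then have "cone (y \<cdot> u) g s z" "cone y g (u \<cdot> s) z"
            using pu T u c cd by auto
          then show "a1 ((F' t y \<cdot> u) \<cdot> s) z = a1 (F' (t \<cdot> u) (y \<cdot> u) \<cdot> s) z"
            using T T' c u cd by simp
        qed (use T T' u pu cd c in simp_all)
      qed
      from depprod_ex[OF d2 _ _ this] obtain k where k: "k \<in> Arr E" "Dom E k = Dom E x"
        "Cod E k = Dom E \<pi>2" "\<pi>2 \<cdot> k = x" and kF: "\<And>t y. cone x f t y \<Longrightarrow> a2 (k \<cdot> t) y = F' t y"
        by auto
      have "a1 (a2 (k \<cdot> t) (g \<cdot> c)) c = F t c" if c: "cone x (f \<cdot> g) t c" for t c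
      proof -
        have c': "cone x f t (g \<cdot> c)" using c by simp
        have cd: "Dom E t = Dom E c" using cone_Dom[OF _ _ c] by simp
        \<comment> \<open>Uncurrying: the inner element is applied to \<open>c\<close> itself, with
          no further restriction.\<close>
        have "cone (g \<cdot> c) g (Ident E (Dom E c)) c" using c by simp
        then have "a1 (F' t (g \<cdot> c) \<cdot> Ident E (Dom E c)) c = F (t \<cdot> Ident E (Dom E c)) c"
          using F'[OF c'] by blast
        then show ?thesis
          using F'[OF c'] kF[OF c'] c cd by simp
      qed
      then show "\<exists>k\<in>Arr E. Dom E k = Dom E x \<and> Cod E k = Dom E \<pi>2 \<and> \<pi>2 \<cdot> k = x \<and>
          (\<forall>t c. cone x (f \<cdot> g) t c \<longrightarrow> a1 (a2 (k \<cdot> t) (g \<cdot> c)) c = F t c)"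
        using k by blast
    qed simp_all
    then show "\<exists>\<pi> ap. depprod (f \<cdot> g) h \<pi> ap" by blast
  qed simp
qed

text \<open>With \<open>b\<close> the other projection of the pullback, the dependent product of \<open>g\<close> along the base
  change of \<open>f\<close> is the pullback of \<open>\<Pi>\<^sub>f (b g) \<rightarrow> \<Pi>\<^sub>f b\<close> along the transpose of the identity.\<close>

lemma exponentiable_pb1:
  assumes ef: "exponentiable E f" and a [simp]: "a \<in> Arr E" "Cod E a = Cod E f"
  shows "exponentiable E (pb1 E a f)"
proof -
  have f [simp]: "f \<in> Arr E" using ef by (simp add: exponentiable_def)
  define f' b where "f' = pb1 E a f" and "b = pb2 E a f"
  have [simp]: "f' \<in> Arr E" "b \<in> Arr E" "Cod E f' = Dom E a" "Cod E b = Dom E f"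
    "Dom E f' = pb E a f" "Dom E b = pb E a f"
    by (simp_all add: f'_def b_def)
  have sq: "a \<cdot> f' = f \<cdot> b" using pb_square[of a f] by (simp add: f'_def b_def)
  have sq': "a \<cdot> f' \<cdot> y = f \<cdot> b \<cdot> y" if "y \<in> Arr E" "Cod E y = pb E a f" for y
    by (rule comp_eq_comp[OF sq]) (use that in simp_all)
  have pr: "f' \<cdot> pb_pair E a f t y = t" "b \<cdot> pb_pair E a f t y = y"
    "pb_pair E a f t y \<in> Arr E" "Dom E (pb_pair E a f t y) = Dom E y"
    "Cod E (pb_pair E a f t y) = pb E a f"
    "u \<in> Arr E \<Longrightarrow> Cod E u = Dom E t \<Longrightarrow> pb_pair E a f t y \<cdot> u = pb_pair E a f (t \<cdot> u) (y \<cdot> u)"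
    if "cone a f t y" for t y u
    using that cone_Dom[OF a(1) f that] by (simp_all add: f'_def b_def pb_pair_comp)
  have eta: "pb_pair E a f (f' \<cdot> y) (b \<cdot> y) = y" if "y \<in> Arr E" "Cod E y = pb E a f" for y
    using that pb_pair_eta[of a f y] by (simp add: f'_def b_def)
  have "exponentiable E f'"
  proof (rule exponentiableI)
    fix g assume "g \<in> Arr E" "Cod E g = Dom E f'"
    then have g [simp]: "g \<in> Arr E" "Cod E g = pb E a f" by simp_all
    obtain \<rho> aq where dq: "depprod f b \<rho> aq" using depprod_exists[OF ef, of b] by auto
    obtain \<pi> ap where dp: "depprod f (b \<cdot> g) \<pi> ap" using depprod_exists[OF ef, of "b \<cdot> g"] by auto
    have [simp]: "\<rho> \<in> Arr E" "Cod E \<rho> = Cod E f" "\<pi> \<in> Arr E" "Cod E \<pi> = Cod E f"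
      using depprodD(1,2)[OF dq] depprodD(1,2)[OF dp] by simp_all
    have P: "ap k y \<in> Arr E" "Cod E (ap k y) = Dom E g" "b \<cdot> g \<cdot> ap k y = y" "Dom E (ap k y) = Dom E k"
      "u \<in> Arr E \<Longrightarrow> Cod E u = Dom E k \<Longrightarrow> ap k y \<cdot> u = ap (k \<cdot> u) (y \<cdot> u)"
      if c: "cone \<pi> f k y" for k y u
      using depprodD(3-6)[OF dp c] cone_Dom[OF _ _ c] cat_simps(7)[of "ap k y" "b \<cdot> g"] by simp_all
    \<comment> \<open>The resulting \<open>m\<close> is the image under \<open>\<Pi>\<close> along
      \<open>f\<close> of \<open>g\<close>, seen as a slice arrow from \<open>b \<cdot> g\<close> to
      \<open>b\<close>.\<close>
    have "natfam f b \<pi> (\<lambda>t y. g \<cdot> ap t y)"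
      unfolding natfam_def using P by simp
    from depprod_ex[OF dq _ _ this] obtain m where m [simp]: "m \<in> Arr E" "Dom E m = Dom E \<pi>"
      "Cod E m = Dom E \<rho>" and rm: "\<rho> \<cdot> m = \<pi>"
      and m_ap: "\<And>t y. cone \<pi> f t y \<Longrightarrow> aq (m \<cdot> t) y = g \<cdot> ap t y"
      by auto
    \<comment> \<open>The resulting \<open>n\<close> sends \<open>t\<close> to the section
      \<open>y \<mapsto> (t, y)\<close>; it is the transpose of the identity.\<close>
    have "natfam f b a (pb_pair E a f)"
      unfolding natfam_def using pr by simp
    from depprod_ex[OF dq _ _ this] obtain n where n [simp]: "n \<in> Arr E" "Dom E n = Dom E a"
      "Cod E n = Dom E \<rho>" and rn: "\<rho> \<cdot> n = a"
      and n_ap: "\<And>t y. cone a f t y \<Longrightarrow> aq (n \<cdot> t) y = pb_pair E a f t y"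
      by auto
    have rm': "\<rho> \<cdot> m \<cdot> t = \<pi> \<cdot> t" if "t \<in> Arr E" "Cod E t = Dom E \<pi>" for t
      by (rule comp_eq_arr[OF rm]) (use that in simp_all)
    have rn': "\<rho> \<cdot> n \<cdot> t = a \<cdot> t" if "t \<in> Arr E" "Cod E t = Dom E a" for t
      by (rule comp_eq_arr[OF rn]) (use that in simp_all)
    \<comment> \<open>An element is a section of \<open>b \<cdot> g\<close> together with a point
      \<open>t\<close> of the domain of \<open>a\<close> such that \<open>g\<close> maps the section
      to \<open>y \<mapsto> (t, y)\<close>: in other words, a section of \<open>g\<close> over the
      fibre at \<open>t\<close>.\<close>
    define \<pi>' q where "\<pi>' = pb2 E m n" and "q = pb1 E m n"
    have [simp]: "\<pi>' \<in> Arr E" "q \<in> Arr E" "Cod E \<pi>' = Dom E a" "Cod E q = Dom E \<pi>"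
      "Dom E \<pi>' = pb E m n" "Dom E q = pb E m n"
      by (simp_all add: \<pi>'_def q_def)
    have mn: "m \<cdot> q \<cdot> l = n \<cdot> \<pi>' \<cdot> l" if "l \<in> Arr E" "Cod E l = pb E m n" for l
      using that pb_square'[of m n l] by (simp add: \<pi>'_def q_def)
    have pq: "\<pi> \<cdot> q \<cdot> l = a \<cdot> \<pi>' \<cdot> l" if "l \<in> Arr E" "Cod E l = pb E m n" for l
      using rm'[of "q \<cdot> l"] rn'[of "\<pi>' \<cdot> l"] mn[OF that] that by simp
    have cone': "cone \<pi> f (q \<cdot> l) (b \<cdot> y)" "cone a f (\<pi>' \<cdot> l) (b \<cdot> y)" if "cone \<pi>' f' l y" for l y
      using that pq[of l] sq'[of y] by simp_all
    have "depprod f' g \<pi>' (\<lambda>l y. ap (q \<cdot> l) (b \<cdot> y))"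
      unfolding depprod_def
    proof (intro conjI allI ballI impI)
      fix l y assume c: "cone \<pi>' f' l y"
      have cd: "Dom E l = Dom E y" by (rule cone_Dom[OF _ _ c]) simp_all
      note T = P[OF cone'(1)[OF c]]
      show "ap (q \<cdot> l) (b \<cdot> y) \<in> Arr E" "Cod E (ap (q \<cdot> l) (b \<cdot> y)) = Dom E g"
        using T by simp_all
      have "g \<cdot> ap (q \<cdot> l) (b \<cdot> y) = pb_pair E a f (\<pi>' \<cdot> l) (b \<cdot> y)"
        using m_ap[OF cone'(1)[OF c]] n_ap[OF cone'(2)[OF c]] mn[of l] c by simp
      also have "\<dots> = y" using eta[of y] c by simp
      finally show "g \<cdot> ap (q \<cdot> l) (b \<cdot> y) = y" .
      fix u assume "u \<in> Arr E" "Cod E u = Dom E l"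
      then show "ap (q \<cdot> l) (b \<cdot> y) \<cdot> u = ap (q \<cdot> l \<cdot> u) (b \<cdot> y \<cdot> u)"
        using T(5)[of u] c cd by simp
    next
      fix l l' assume [simp]: "l \<in> Arr E" "l' \<in> Arr E" and
        "Dom E l = Dom E l' \<and> Cod E l = Dom E \<pi>' \<and> Cod E l' = Dom E \<pi>' \<and> \<pi>' \<cdot> l = \<pi>' \<cdot> l' \<and>
        (\<forall>t y. cone (\<pi>' \<cdot> l) f' t y \<longrightarrow> ap (q \<cdot> l \<cdot> t) (b \<cdot> y) = ap (q \<cdot> l' \<cdot> t) (b \<cdot> y))"
      then have [simp]: "Dom E l = Dom E l'" "Cod E l = pb E m n" "Cod E l' = pb E m n"
        and pl: "\<pi>' \<cdot> l = \<pi>' \<cdot> l'" and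
        eq: "\<And>t y. cone (\<pi>' \<cdot> l) f' t y \<Longrightarrow> ap (q \<cdot> l \<cdot> t) (b \<cdot> y) = ap (q \<cdot> l' \<cdot> t) (b \<cdot> y)"
        by simp_all
      have "q \<cdot> l = q \<cdot> l'"
      proof (rule depprod_eqI[OF dp])
        fix t y assume c: "cone (\<pi> \<cdot> q \<cdot> l) f t y"
        then have [simp]: "t \<in> Arr E" "Cod E t = Dom E l'" by simp_all
        have "cone a f (\<pi>' \<cdot> l \<cdot> t) y" using pq[of "l \<cdot> t"] c by simp
        note T = pr[OF this]
        show "ap ((q \<cdot> l) \<cdot> t) y = ap ((q \<cdot> l') \<cdot> t) y"
          using eq[of t "pb_pair E a f (\<pi>' \<cdot> l \<cdot> t) y"] T c by simp
      qed (use pq pl in simp_all)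
      then show "l = l'"
        by - (rule pb_eqI[of m n], use pl in \<open>simp_all add: \<pi>'_def q_def\<close>)
    next
      fix x F assume x [simp]: "x \<in> Arr E" and "Cod E x = Cod E f' \<and> natfam f' g x F"
      then have Cx [simp]: "Cod E x = Dom E a" and F: "natfam f' g x F" by simp_all
      have Tf: "cone a f (x \<cdot> t) y" "cone x f' t (pb_pair E a f (x \<cdot> t) y)" "Dom E t = Dom E y"
        if c: "cone (a \<cdot> x) f t y" for t y
      proof -
        show "cone a f (x \<cdot> t) y" using c by auto
        from pr[OF this] c show "cone x f' t (pb_pair E a f (x \<cdot> t) y)" by simp
        show "Dom E t = Dom E y" by (rule cone_Dom[OF _ _ c]) simp_all
      qed
      \<comment> \<open>A family along the base change becomes one along \<open>f\<close> by
        evaluating it at the pair formed by \<open>x \<cdot> t\<close> and \<open>y\<close>.\<close>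
      have "natfam f (b \<cdot> g) (a \<cdot> x) (\<lambda>t y. F t (pb_pair E a f (x \<cdot> t) y))"
        unfolding natfam_def
      proof (intro allI impI conjI ballI)
        fix t y assume c: "cone (a \<cdot> x) f t y"
        note T = pr[OF Tf(1)[OF c]] and N = natfamD[OF F Tf(2)[OF c]]
        show "F t (pb_pair E a f (x \<cdot> t) y) \<in> Arr E"
          "Cod E (F t (pb_pair E a f (x \<cdot> t) y)) = Dom E (b \<cdot> g)"
          "(b \<cdot> g) \<cdot> F t (pb_pair E a f (x \<cdot> t) y) = y"
          using T N by simp_all
        fix u assume "u \<in> Arr E" "Cod E u = Dom E t"
        then show "F t (pb_pair E a f (x \<cdot> t) y) \<cdot> u = F (t \<cdot> u) (pb_pair E a f (x \<cdot> t \<cdot> u) (y \<cdot> u))"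
          using T(6)[of u] N(4)[of u] c by simp
      qed
      from depprod_ex[OF dp _ _ this] obtain k where k [simp]: "k \<in> Arr E" "Dom E k = Dom E x"
        "Cod E k = Dom E \<pi>" and pk: "\<pi> \<cdot> k = a \<cdot> x"
        and kF: "\<And>t y. cone (a \<cdot> x) f t y \<Longrightarrow> ap (k \<cdot> t) y = F t (pb_pair E a f (x \<cdot> t) y)"
        by auto
      have pk': "\<pi> \<cdot> k \<cdot> t = a \<cdot> x \<cdot> t" if "t \<in> Arr E" "Cod E t = Dom E x" for t
        using comp_eq_arr[OF pk, of t] that by simp
      \<comment> \<open>The arrow lands in the pullback because \<open>F\<close> consists of lifts
        along \<open>g\<close>: applying \<open>g\<close> to a value returns the pair at which it
        was taken.\<close>
      have mk: "m \<cdot> k = n \<cdot> x"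
      proof (rule depprod_eqI[OF dq])
        fix t y assume "cone (\<rho> \<cdot> m \<cdot> k) f t y"
        then have c: "cone (a \<cdot> x) f t y" using rm'[of k] pk by simp
        have "cone \<pi> f (k \<cdot> t) y" using c pk' by auto
        then show "aq ((m \<cdot> k) \<cdot> t) y = aq ((n \<cdot> x) \<cdot> t) y"
          using m_ap[of "k \<cdot> t" y] n_ap[OF Tf(1)[OF c]] kF[OF c] natfamD(3)[OF F Tf(2)[OF c]] c by simp
      qed (use rm' rn' pk in simp_all)
      let ?l = "pb_pair E m n k x"
      have l: "?l \<in> Arr E" "Dom E ?l = Dom E x" "Cod E ?l = pb E m n" "\<pi>' \<cdot> ?l = x" "q \<cdot> ?l = k"
        "t \<in> Arr E \<Longrightarrow> Cod E t = Dom E x \<Longrightarrow> q \<cdot> ?l \<cdot> t = k \<cdot> t" for t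
        using mk by (simp_all add: \<pi>'_def q_def)
      have "ap (q \<cdot> ?l \<cdot> t) (b \<cdot> y) = F t y" if c: "cone x f' t y" for t y
        using kF[of t "b \<cdot> y"] c l sq'[of y] eta[of y] by simp
      then show "\<exists>k\<in>Arr E. Dom E k = Dom E x \<and> Cod E k = Dom E \<pi>' \<and> \<pi>' \<cdot> k = x \<and>
          (\<forall>t y. cone x f' t y \<longrightarrow> ap (q \<cdot> k \<cdot> t) (b \<cdot> y) = F t y)"
        using l by auto
    qed simp_all
    then show "\<exists>\<pi> ap. depprod f' g \<pi> ap" by blast
  qed simp
  then show ?thesis by (simp add: f'_def)
qed

section \<open>Generalized elements of the composition product\<close>

text \<open>For a position \<open>k = (x, f)\<close> of \<open>p \<triangleleft> q\<close>, these are \<open>x\<close> and, at a direction \<open>y\<close>, the value \<open>f y\<close>.\<close>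

definition pos_fst :: "'m \<Rightarrow> 'm \<Rightarrow> 'm \<Rightarrow> 'm" where
  "pos_fst p q k = cp_pos E p q \<cdot> k"

definition pos_app :: "'m \<Rightarrow> 'm \<Rightarrow> 'm \<Rightarrow> 'm \<Rightarrow> 'm" where
  "pos_app p q k y = cp_ev E p q \<cdot> pb_pair E (cp_pos E p q) p k y"

lemma exponentiable_Arr [simp]: "exponentiable E p \<Longrightarrow> p \<in> Arr E"
  by (simp add: exponentiable_def)

lemma cp_typing:
  assumes [simp]: "exponentiable E p" "exponentiable E q"
  shows cp_pos: "cp_pos E p q \<in> Arr E" "Cod E (cp_pos E p q) = Cod E p"
    and cp_ev: "cp_ev E p q \<in> Arr E" "Dom E (cp_ev E p q) = pb E (cp_pos E p q) p"
      "Cod E (cp_ev E p q) = Cod E q"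
  using Pi_counit[of p "prod2 E (Cod E q) (Dom E p)"]
  by (simp_all add: cp_pos_def cp_ev_def)

lemma comp_prod_exponentiable [simp]:
  assumes [simp]: "exponentiable E p" "exponentiable E q"
  shows "exponentiable E (comp_prod E p q)"
proof -
  note [simp] = cp_typing[of p q]
  show ?thesis
    unfolding comp_prod_def
    by (intro exponentiable_comp exponentiable_pb1) simp_all
qed

text \<open>The later rules type positions and directions by the codomain and domain of
  \<open>comp_prod E p q\<close> instead of the underlying objects, so that nested products are
  handled uniformly.\<close>

lemma cp_Cod: "exponentiable E p \<Longrightarrow> exponentiable E q \<Longrightarrow> Cod E (comp_prod E p q) = Dom E (cp_pos E p q)"
  by (simp add: comp_prod_def cp_typing)

lemma cp_Dom: "exponentiable E p \<Longrightarrow> exponentiable E q \<Longrightarrow> Dom E (comp_prod E p q) = pb E (cp_ev E p q) q"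
  by (simp add: comp_prod_def cp_typing)

section \<open>Positions of the composition product\<close>

lemma pos_fst [simp]:
  assumes "exponentiable E p" "exponentiable E q" "k \<in> Arr E" "Cod E k = Cod E (comp_prod E p q)"
  shows "pos_fst p q k \<in> Arr E" "Dom E (pos_fst p q k) = Dom E k" "Cod E (pos_fst p q k) = Cod E p"
    "t \<in> Arr E \<Longrightarrow> Cod E t = Dom E k \<Longrightarrow> pos_fst p q k \<cdot> t = pos_fst p q (k \<cdot> t)"
  using assms by (simp_all add: pos_fst_def cp_typing cp_Cod)

lemma cone_pos:
  assumes "exponentiable E p" "exponentiable E q" "k \<in> Arr E" "Cod E k = Cod E (comp_prod E p q)"
    "y \<in> Arr E" "Cod E y = Dom E p" "p \<cdot> y = pos_fst p q k"
  shows "cone (cp_pos E p q) p k y" "Dom E y = Dom E k"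
proof -
  show c: "cone (cp_pos E p q) p k y"
    using assms by (simp add: pos_fst_def cp_Cod)
  show "Dom E y = Dom E k"
    using cone_Dom[OF _ _ c] assms(1,2) by (simp add: cp_typing)
qed

lemma pos_app [simp]:
  assumes "exponentiable E p" "exponentiable E q" "k \<in> Arr E" "Cod E k = Cod E (comp_prod E p q)"
    "y \<in> Arr E" "Cod E y = Dom E p" "p \<cdot> y = pos_fst p q k"
  shows "pos_app p q k y \<in> Arr E" "Dom E (pos_app p q k y) = Dom E k" "Cod E (pos_app p q k y) = Cod E q"
    "t \<in> Arr E \<Longrightarrow> Cod E t = Dom E k \<Longrightarrow> pos_app p q k y \<cdot> t = pos_app p q (k \<cdot> t) (y \<cdot> t)"
  using cone_pos[OF assms] assms(1,2) by (simp_all add: pos_app_def cp_typing pb_pair_comp)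

text \<open>The full value \<open>(f y, y)\<close> in the dependent product, to which the rules for
  \<open>depprod\<close> apply; \<open>pos_app\<close> is its first component.\<close>

definition cp_ap :: "'m \<Rightarrow> 'm \<Rightarrow> 'm \<Rightarrow> 'm \<Rightarrow> 'm" where
  "cp_ap p q k y = slice_map (Pi_counit E p (prod2 E (Cod E q) (Dom E p))) \<cdot> pb_pair E (cp_pos E p q) p k y"

lemma cp_depprod:
  assumes [simp]: "exponentiable E p" "exponentiable E q"
  shows "depprod p (prod2 E (Cod E q) (Dom E p)) (cp_pos E p q) (cp_ap p q)"
  using Pi_depprod[of p "prod2 E (Cod E q) (Dom E p)"]
  unfolding cp_pos_def cp_ap_def by simp

lemma pos_app_cp_ap:
  assumes [simp]: "exponentiable E p" "exponentiable E q" and c: "cone (cp_pos E p q) p k y"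
  shows "pos_app p q k y = prod1 E (Cod E q) (Dom E p) \<cdot> cp_ap p q k y"
  using Pi_counit[of p "prod2 E (Cod E q) (Dom E p)"] c cone_Dom[OF _ _ c] cp_typing[of p q]
  by (simp add: pos_app_def cp_ap_def cp_ev_def cp_pos_def)

text \<open>Extensionality of the dependent product. Comparing first components is enough, since the
  second component of a value is always \<open>y\<close>.\<close>

lemma pos_eqI:
  assumes [simp]: "exponentiable E p" "exponentiable E q"
    and k [simp]: "k \<in> Arr E" "k' \<in> Arr E" "Dom E k = Dom E k'" "Cod E k = Cod E (comp_prod E p q)"
    "Cod E k' = Cod E (comp_prod E p q)" and pos_fst: "pos_fst p q k = pos_fst p q k'"
    and pos_app: "\<And>t y. \<lbrakk>t \<in> Arr E; Cod E t = Dom E k'; y \<in> Arr E; Cod E y = Dom E p; Dom E y = Dom E t;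
      p \<cdot> y = pos_fst p q (k' \<cdot> t)\<rbrakk> \<Longrightarrow> pos_app p q (k \<cdot> t) y = pos_app p q (k' \<cdot> t) y"
  shows "k = k'"
proof -
  note [simp] = cp_typing[of p q] and C = cp_Cod[of p q]
  have pk: "cp_pos E p q \<cdot> k = cp_pos E p q \<cdot> k'" using pos_fst by (simp add: pos_fst_def)
  show ?thesis
  proof (rule depprod_eqI[OF cp_depprod])
    fix t y assume c: "cone (cp_pos E p q \<cdot> k) p t y"
    then have [simp]: "t \<in> Arr E" "y \<in> Arr E" "Cod E t = Dom E k'" "Cod E y = Dom E p" 
      and py: "cp_pos E p q \<cdot> (k \<cdot> t) = p \<cdot> y"
      using C by auto
    have c1: "cone (cp_pos E p q) p (k \<cdot> t) y"
      using py C by simp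
    moreover have c2: "cone (cp_pos E p q) p (k' \<cdot> t) y"
      using c1 comp_eq_comp[OF pk, of t] C by simp
    have D: "Dom E y = Dom E t" using cone_Dom[OF _ _ c] C by simp
    have e: "pos_app p q (k \<cdot> t) y = pos_app p q (k' \<cdot> t) y"
      by (rule pos_app) (use c2 D in \<open>simp_all add: pos_fst_def\<close>)
    note T = depprodD(3-5)[OF cp_depprod[of p q] c1] depprodD(3-5)[OF cp_depprod[of p q] c2]
    let ?b = "prod2 E (Cod E q) (Dom E p)"
    have "Dom E (cp_ap p q (k \<cdot> t) y) = Dom E (cp_ap p q (k' \<cdot> t) y)"
      using cat_simps(7)[of "cp_ap p q (k \<cdot> t) y" ?b] cat_simps(7)[of "cp_ap p q (k' \<cdot> t) y" ?b] T
      by simp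
    then show "cp_ap p q (k \<cdot> t) y = cp_ap p q (k' \<cdot> t) y"
      by - (rule prod_eqI[of "Cod E q" "Dom E p"], use T e pos_app_cp_ap[OF _ _ c1] pos_app_cp_ap[OF _ _ c2] in simp_all)
  qed (use pk C in simp_all)
qed

lemma pos_ex:
  assumes [simp]: "exponentiable E p" "exponentiable E q"
    and [simp]: "x \<in> Arr E" "Cod E x = Cod E p" "f \<in> Arr E" "Dom E f = pb E x p" "Cod E f = Cod E q"
  shows "\<exists>k\<in>Arr E. Dom E k = Dom E x \<and> Cod E k = Cod E (comp_prod E p q) \<and> pos_fst p q k = x \<and>
    (\<forall>t y. t \<in> Arr E \<and> Cod E t = Dom E x \<and> y \<in> Arr E \<and> Cod E y = Dom E p \<and> p \<cdot> y = x \<cdot> t \<longrightarrow>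
      pos_app p q (k \<cdot> t) y = f \<cdot> pb_pair E x p t y)"
proof -
  note [simp] = cp_typing[of p q] and C = cp_Cod[of p q]
  let ?a1 = "prod1 E (Cod E q) (Dom E p)" and ?b = "prod2 E (Cod E q) (Dom E p)"
  \<comment> \<open>Pairing \<open>f\<close> with the projection to directions makes it an arrow
    over the domain of \<open>p\<close>, as the dependent product requires.\<close>
  obtain h where h [simp]: "h \<in> Arr E" "Dom E h = pb E x p" "Cod E h = Dom E ?b"
    and h1: "?a1 \<cdot> h = f" and h2: "?b \<cdot> h = pb2 E x p"
    using prod_pair_ex[of "Cod E q" "Dom E p" f "pb2 E x p"] by auto
  have h1': "?a1 \<cdot> h \<cdot> u = f \<cdot> u" and h2': "?b \<cdot> h \<cdot> u = pb2 E x p \<cdot> u"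
    if "u \<in> Arr E" "Cod E u = pb E x p" for u
    using comp_eq_arr[OF h1, of u] comp_eq_arr[OF h2, of u] that by simp_all
  have "natfam p ?b x (\<lambda>t y. h \<cdot> pb_pair E x p t y)"
    unfolding natfam_def
  proof (intro allI impI)
    fix t y assume c: "cone x p t y"
    then show "h \<cdot> pb_pair E x p t y \<in> Arr E \<and> Cod E (h \<cdot> pb_pair E x p t y) = Dom E ?b \<and>
      ?b \<cdot> h \<cdot> pb_pair E x p t y = y \<and> (\<forall>u\<in>Arr E. Cod E u = Dom E t \<longrightarrow>
      (h \<cdot> pb_pair E x p t y) \<cdot> u = h \<cdot> pb_pair E x p (t \<cdot> u) (y \<cdot> u))"
      using cone_Dom[OF _ _ c] by (simp add: h2' pb_pair_comp)
  qed
  from depprod_ex[OF cp_depprod[of p q] _ _ this] obtain k where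
    k [simp]: "k \<in> Arr E" "Dom E k = Dom E x" "Cod E k = Dom E (cp_pos E p q)" and kx: "cp_pos E p q \<cdot> k = x"
    and kf: "\<And>t y. cone x p t y \<Longrightarrow> cp_ap p q (k \<cdot> t) y = h \<cdot> pb_pair E x p t y"
    by auto
  have "pos_app p q (k \<cdot> t) y = f \<cdot> pb_pair E x p t y"
    if [simp]: "t \<in> Arr E" "Cod E t = Dom E x" "y \<in> Arr E" "Cod E y = Dom E p" and y: "p \<cdot> y = x \<cdot> t" for t y
  proof -
    have c: "cone x p t y" using y by simp
    have "cone (cp_pos E p q) p (k \<cdot> t) y"
      using comp_eq_arr[OF kx, of t] y by simp
    then show ?thesis
      using pos_app_cp_ap[of p q "k \<cdot> t" y] kf[OF c] cone_Dom[OF _ _ c] y by (simp add: h1')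
  qed
  then show ?thesis using kx C by (intro bexI[of _ k]) (simp_all add: pos_fst_def)
qed

text \<open>The description defining \<open>mk_pos\<close> is proper because \<open>pos_fun\<close>
  is the value of a position at the generic direction, from which naturality gives the value at
  every direction.\<close>

lemma mk_pos [simp]:
  assumes pq [simp]: "exponentiable E p" "exponentiable E q"
    and xf [simp]: "x \<in> Arr E" "Cod E x = Cod E p" "f \<in> Arr E" "Dom E f = pb E x p" "Cod E f = Cod E q"
  shows "mk_pos E p q x f \<in> Arr E" "Dom E (mk_pos E p q x f) = Dom E x"
    "Cod E (mk_pos E p q x f) = Cod E (comp_prod E p q)"
    "pos_fst p q (mk_pos E p q x f) = x"
    "t \<in> Arr E \<Longrightarrow> Cod E t = Dom E x \<Longrightarrow> pos_fst p q (mk_pos E p q x f \<cdot> t) = x \<cdot> t"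
    "\<lbrakk>t \<in> Arr E; Cod E t = Dom E x; y \<in> Arr E; Cod E y = Dom E p; p \<cdot> y = x \<cdot> t\<rbrakk> \<Longrightarrow>
      pos_app p q (mk_pos E p q x f \<cdot> t) y = f \<cdot> pb_pair E x p t y"
proof -
  note [simp] = cp_typing[of p q] and C = cp_Cod[of p q, symmetric]
  let ?Q = "\<lambda>k. k \<in> hom E (Dom E x) (Dom E (cp_pos E p q)) \<and> cp_pos E p q \<cdot> k = x \<and> pos_fun E p q k = f"
  obtain k where k [simp]: "k \<in> Arr E" "Dom E k = Dom E x" "Cod E k = Cod E (comp_prod E p q)" and kx: "pos_fst p q k = x"
    and kf: "\<And>t y. \<lbrakk>t \<in> Arr E; Cod E t = Dom E x; y \<in> Arr E; Cod E y = Dom E p; p \<cdot> y = x \<cdot> t\<rbrakk> \<Longrightarrow>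
      pos_app p q (k \<cdot> t) y = f \<cdot> pb_pair E x p t y"
    using pos_ex[OF pq xf] by blast
  have pf: "pos_fun E p q l = pos_app p q (l \<cdot> pb1 E x p) (pb2 E x p)" if "pos_fst p q l = x" for l
    using that by (simp add: pos_fun_def pos_app_def pos_fst_def)
  have "pos_fun E p q k = f"
    using kf[of "pb1 E x p" "pb2 E x p"] pb_square[of x p] pb_pair_eta[of x p "Ident E (pb E x p)"]
    by (simp add: pf kx)
  then have Qk: "?Q k" using kx by (simp add: hom_def C pos_fst_def)
  have "mk_pos E p q x f = k"
    unfolding mk_pos_def
  proof (rule the_equality[of ?Q, OF Qk])
    fix l assume l: "?Q l"
    then have [simp]: "l \<in> Arr E" "Dom E l = Dom E x" "Cod E l = Cod E (comp_prod E p q)" and lx: "pos_fst p q l = x"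
      and lf: "pos_app p q (l \<cdot> pb1 E x p) (pb2 E x p) = f"
      using pf by (auto simp: hom_def C pos_fst_def)
    show "l = k"
    proof (rule pos_eqI[OF pq])
      fix t y assume [simp]: "t \<in> Arr E" "Cod E t = Dom E k" "y \<in> Arr E" "Cod E y = Dom E p" "Dom E y = Dom E t"
        and py: "p \<cdot> y = pos_fst p q (k \<cdot> t)"
      then have py': "p \<cdot> y = x \<cdot> t" using kx pos_fst(4)[of p q k t] by simp
      have "p \<cdot> pb2 E x p = pos_fst p q (l \<cdot> pb1 E x p)"
        using pb_square[of x p] lx pos_fst(4)[of p q l "pb1 E x p"] by simp
      then show "pos_app p q (l \<cdot> t) y = pos_app p q (k \<cdot> t) y"
        using py' kf[of t y] lf pos_app(4)[of p q "l \<cdot> pb1 E x p" "pb2 E x p" "pb_pair E x p t y"] by simp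
    qed (use kx lx in simp_all)
  qed
  then show "mk_pos E p q x f \<in> Arr E" "Dom E (mk_pos E p q x f) = Dom E x"
    "Cod E (mk_pos E p q x f) = Cod E (comp_prod E p q)"
    "pos_fst p q (mk_pos E p q x f) = x"
    "t \<in> Arr E \<Longrightarrow> Cod E t = Dom E x \<Longrightarrow> pos_fst p q (mk_pos E p q x f \<cdot> t) = x \<cdot> t"
    "\<lbrakk>t \<in> Arr E; Cod E t = Dom E x; y \<in> Arr E; Cod E y = Dom E p; p \<cdot> y = x \<cdot> t\<rbrakk> \<Longrightarrow>
      pos_app p q (mk_pos E p q x f \<cdot> t) y = f \<cdot> pb_pair E x p t y"
    using kx kf pos_fst(4)[of p q k t] by simp_all
qed

section \<open>Directions of the composition product\<close>

lemma dirs [simp]: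
  assumes pq [simp]: "exponentiable E p" "exponentiable E q"
    and d [simp]: "d \<in> Arr E" "Cod E d = Dom E (comp_prod E p q)"
  shows "dir1 E p q d \<in> Arr E" "Dom E (dir1 E p q d) = Dom E d" "Cod E (dir1 E p q d) = Dom E p"
    "p \<cdot> dir1 E p q d = pos_fst p q (comp_prod E p q \<cdot> d)"
    "dir2 E p q d \<in> Arr E" "Dom E (dir2 E p q d) = Dom E d" "Cod E (dir2 E p q d) = Dom E q"
    "q \<cdot> dir2 E p q d = pos_app p q (comp_prod E p q \<cdot> d) (dir1 E p q d)"
    "t \<in> Arr E \<Longrightarrow> Cod E t = Dom E d \<Longrightarrow> dir1 E p q d \<cdot> t = dir1 E p q (d \<cdot> t)"
    "t \<in> Arr E \<Longrightarrow> Cod E t = Dom E d \<Longrightarrow> dir2 E p q d \<cdot> t = dir2 E p q (d \<cdot> t)"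
proof -
  note [simp] = cp_typing[of p q] and C = cp_Dom[of p q] and C' = cp_Dom[of p q, symmetric]
  show "dir1 E p q d \<in> Arr E" "Dom E (dir1 E p q d) = Dom E d" "Cod E (dir1 E p q d) = Dom E p"
    "dir2 E p q d \<in> Arr E" "Dom E (dir2 E p q d) = Dom E d" "Cod E (dir2 E p q d) = Dom E q"
    "t \<in> Arr E \<Longrightarrow> Cod E t = Dom E d \<Longrightarrow> dir1 E p q d \<cdot> t = dir1 E p q (d \<cdot> t)"
    "t \<in> Arr E \<Longrightarrow> Cod E t = Dom E d \<Longrightarrow> dir2 E p q d \<cdot> t = dir2 E p q (d \<cdot> t)"
    using d C by (simp_all add: dir1_def dir2_def)
  \<comment> \<open>The domain of \<open>p \<triangleleft> q\<close> is an iterated pullback: the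
    inner square says that \<open>y\<close> lies over \<open>x\<close>, the outer one that
    \<open>z\<close> lies over \<open>f y\<close>.\<close>
  show "p \<cdot> dir1 E p q d = pos_fst p q (comp_prod E p q \<cdot> d)"
    using d C pb_square'[of "cp_pos E p q" p "pb1 E (cp_ev E p q) q \<cdot> d"]
    by (simp add: dir1_def pos_fst_def comp_prod_def)
  have "pb_pair E (cp_pos E p q) p (comp_prod E p q \<cdot> d) (dir1 E p q d) = pb1 E (cp_ev E p q) q \<cdot> d"
    using d C pb_pair_eta[of "cp_pos E p q" p "pb1 E (cp_ev E p q) q \<cdot> d"]
    by (simp add: dir1_def comp_prod_def)
  then show "q \<cdot> dir2 E p q d = pos_app p q (comp_prod E p q \<cdot> d) (dir1 E p q d)"
    using d C pb_square'[of "cp_ev E p q" q d] by (simp add: dir2_def pos_app_def)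
qed

lemma mk_dir [simp]:
  assumes pq [simp]: "exponentiable E p" "exponentiable E q"
    and k [simp]: "k \<in> Arr E" "Cod E k = Cod E (comp_prod E p q)"
    and y [simp]: "y \<in> Arr E" "Cod E y = Dom E p" and py: "p \<cdot> y = pos_fst p q k"
    and z [simp]: "z \<in> Arr E" "Cod E z = Dom E q" and qz: "q \<cdot> z = pos_app p q k y"
  shows "mk_dir E p q k y z \<in> Arr E" "Dom E (mk_dir E p q k y z) = Dom E k"
    "Cod E (mk_dir E p q k y z) = Dom E (comp_prod E p q)" "comp_prod E p q \<cdot> mk_dir E p q k y z = k"
    "dir1 E p q (mk_dir E p q k y z) = y" "dir2 E p q (mk_dir E p q k y z) = z"
    "t \<in> Arr E \<Longrightarrow> Cod E t = Dom E k \<Longrightarrow> mk_dir E p q k y z \<cdot> t = mk_dir E p q (k \<cdot> t) (y \<cdot> t) (z \<cdot> t)"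
proof -
  note [simp] = cp_typing[of p q] and C = cp_Dom[of p q] and C' = cp_Cod[of p q]
  note c = cone_pos[OF pq k y py]
  have D: "Dom E y = Dom E k" "Dom E z = Dom E k"
    using c arg_cong[OF qz, of "Dom E"] pos_app(2)[OF pq k y py] by simp_all
  have q': "cp_ev E p q \<cdot> pb_pair E (cp_pos E p q) p k y = q \<cdot> z"
    using qz by (simp add: pos_app_def)
  show "mk_dir E p q k y z \<in> Arr E" "Dom E (mk_dir E p q k y z) = Dom E k"
    "Cod E (mk_dir E p q k y z) = Dom E (comp_prod E p q)" "comp_prod E p q \<cdot> mk_dir E p q k y z = k"
    "dir1 E p q (mk_dir E p q k y z) = y" "dir2 E p q (mk_dir E p q k y z) = z"
    "t \<in> Arr E \<Longrightarrow> Cod E t = Dom E k \<Longrightarrow> mk_dir E p q k y z \<cdot> t = mk_dir E p q (k \<cdot> t) (y \<cdot> t) (z \<cdot> t)"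
    using c D q' C by (simp_all add: mk_dir_def comp_prod_def dir1_def dir2_def pb_pair_comp)
qed

lemma dir_eqI:
  assumes pq [simp]: "exponentiable E p" "exponentiable E q"
    and d [simp]: "d \<in> Arr E" "d' \<in> Arr E" "Dom E d = Dom E d'" "Cod E d = Dom E (comp_prod E p q)"
      "Cod E d' = Dom E (comp_prod E p q)"
    and eq: "comp_prod E p q \<cdot> d = comp_prod E p q \<cdot> d'"
      "dir1 E p q d = dir1 E p q d'" "dir2 E p q d = dir2 E p q d'"
  shows "d = d'"
proof -
  note [simp] = cp_typing[of p q] and C = cp_Dom[of p q]
  have "pb1 E (cp_ev E p q) q \<cdot> d = pb1 E (cp_ev E p q) q \<cdot> d'"
    by (rule pb_eqI[of "cp_pos E p q" p]) (use d C eq in \<open>simp_all add: comp_prod_def dir1_def\<close>)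
  then show ?thesis
    by - (rule pb_eqI[of "cp_ev E p q" q], use d C eq in \<open>simp_all add: dir2_def\<close>)
qed

lemma mk_dir_eta [simp]:
  assumes pq [simp]: "exponentiable E p" "exponentiable E q"
    and d [simp]: "d \<in> Arr E" "Cod E d = Dom E (comp_prod E p q)"
    and k: "comp_prod E p q \<cdot> d = k"
  shows "mk_dir E p q k (dir1 E p q d) (dir2 E p q d) = d"
  unfolding k[symmetric] by (rule dir_eqI[OF pq]) simp_all

section \<open>The category of polynomials\<close>

text \<open>The values \<open>\<phi>\<^sub>1 x\<close> and \<open>\<phi>\<^sup>\<sharp> (x, w)\<close> at generalized elements.\<close>

definition pos_map :: "'m poly_arr \<Rightarrow> 'm \<Rightarrow> 'm" where
  "pos_map \<phi> x = on_pos \<phi> \<cdot> x"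

definition dir_map :: "'m poly_arr \<Rightarrow> 'm \<Rightarrow> 'm \<Rightarrow> 'm" where
  "dir_map \<phi> x w = on_dir \<phi> \<cdot> pb_pair E (on_pos \<phi>) (poly_tgt \<phi>) x w"

lemma Poly_sel [simp]:
  "p \<in> Obj (Poly E) \<longleftrightarrow> exponentiable E p" "Dom (Poly E) = poly_src" "Cod (Poly E) = poly_tgt"
  by (simp_all add: Poly_def)

lemma Poly_Arr: "\<phi> \<in> Arr (Poly E) \<longleftrightarrow> exponentiable E (poly_src \<phi>) \<and> exponentiable E (poly_tgt \<phi>) \<and>
    on_pos \<phi> \<in> Arr E \<and> Dom E (on_pos \<phi>) = Cod E (poly_src \<phi>) \<and> Cod E (on_pos \<phi>) = Cod E (poly_tgt \<phi>) \<and>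
    on_dir \<phi> \<in> Arr E \<and> Dom E (on_dir \<phi>) = pb E (on_pos \<phi>) (poly_tgt \<phi>) \<and> Cod E (on_dir \<phi>) = Dom E (poly_src \<phi>) \<and>
    poly_src \<phi> \<cdot> on_dir \<phi> = pb1 E (on_pos \<phi>) (poly_tgt \<phi>)"
  by (cases \<phi>) (auto simp: Poly_def hom_def)

lemma Poly_exp [simp]:
  "\<phi> \<in> Arr (Poly E) \<Longrightarrow> exponentiable E (poly_src \<phi>)"
  "\<phi> \<in> Arr (Poly E) \<Longrightarrow> exponentiable E (poly_tgt \<phi>)"
  by (simp_all add: Poly_Arr)

lemma pos_map [simp]:
  assumes "\<phi> \<in> Arr (Poly E)" "x \<in> Arr E" "Cod E x = Cod E (poly_src \<phi>)"
  shows "pos_map \<phi> x \<in> Arr E" "Dom E (pos_map \<phi> x) = Dom E x" "Cod E (pos_map \<phi> x) = Cod E (poly_tgt \<phi>)"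
    "t \<in> Arr E \<Longrightarrow> Cod E t = Dom E x \<Longrightarrow> pos_map \<phi> x \<cdot> t = pos_map \<phi> (x \<cdot> t)"
  using assms unfolding Poly_Arr by (auto simp: pos_map_def)

lemma dir_map [simp]:
  assumes "\<phi> \<in> Arr (Poly E)" "x \<in> Arr E" "Cod E x = Cod E (poly_src \<phi>)"
    "w \<in> Arr E" "Cod E w = Dom E (poly_tgt \<phi>)" "poly_tgt \<phi> \<cdot> w = pos_map \<phi> x"
  shows "dir_map \<phi> x w \<in> Arr E" "Dom E (dir_map \<phi> x w) = Dom E x" "Cod E (dir_map \<phi> x w) = Dom E (poly_src \<phi>)"
    "poly_src \<phi> = p \<Longrightarrow> p \<cdot> dir_map \<phi> x w = x"
    "t \<in> Arr E \<Longrightarrow> Cod E t = Dom E x \<Longrightarrow> dir_map \<phi> x w \<cdot> t = dir_map \<phi> (x \<cdot> t) (w \<cdot> t)"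
proof -
  have a: "exponentiable E (poly_src \<phi>)" "exponentiable E (poly_tgt \<phi>)" "on_pos \<phi> \<in> Arr E"
    "Dom E (on_pos \<phi>) = Cod E (poly_src \<phi>)" "Cod E (on_pos \<phi>) = Cod E (poly_tgt \<phi>)"
    "on_dir \<phi> \<in> Arr E" "Dom E (on_dir \<phi>) = pb E (on_pos \<phi>) (poly_tgt \<phi>)" "Cod E (on_dir \<phi>) = Dom E (poly_src \<phi>)"
    and b: "poly_src \<phi> \<cdot> on_dir \<phi> = pb1 E (on_pos \<phi>) (poly_tgt \<phi>)"
    using assms(1) unfolding Poly_Arr by simp_all
  have D: "Dom E w = Dom E x"
    using arg_cong[OF assms(6), of "Dom E"] assms(1-5) by simp
  show "dir_map \<phi> x w \<in> Arr E" "Dom E (dir_map \<phi> x w) = Dom E x" "Cod E (dir_map \<phi> x w) = Dom E (poly_src \<phi>)"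
    "poly_src \<phi> = p \<Longrightarrow> p \<cdot> dir_map \<phi> x w = x"
    "t \<in> Arr E \<Longrightarrow> Cod E t = Dom E x \<Longrightarrow> dir_map \<phi> x w \<cdot> t = dir_map \<phi> (x \<cdot> t) (w \<cdot> t)"
    using a assms(2-) D comp_eq_arr[OF b, of "pb_pair E (on_pos \<phi>) (poly_tgt \<phi>) x w"]
    by (auto simp: dir_map_def pos_map_def pb_pair_comp)
qed

text \<open>Yoneda: the identity recovers \<open>on_pos\<close>, and the two pullback projections
  recover \<open>on_dir\<close>. Agreement on positions is handed to \<open>dir\<close> so that
  \<open>w\<close> counts as a direction at both images.\<close>

lemma poly_eqI:
  assumes f: "\<phi> \<in> Arr (Poly E)" "\<psi> \<in> Arr (Poly E)" "poly_src \<phi> = poly_src \<psi>" "poly_tgt \<phi> = poly_tgt \<psi>"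
    and pos: "\<And>x. x \<in> Arr E \<Longrightarrow> Cod E x = Cod E (poly_src \<psi>) \<Longrightarrow> pos_map \<phi> x = pos_map \<psi> x"
    and dir: "\<And>x w. \<lbrakk>x \<in> Arr E; Cod E x = Cod E (poly_src \<psi>); w \<in> Arr E; Cod E w = Dom E (poly_tgt \<psi>);
      Dom E w = Dom E x; poly_tgt \<psi> \<cdot> w = pos_map \<psi> x; pos_map \<phi> x = pos_map \<psi> x\<rbrakk> \<Longrightarrow> dir_map \<phi> x w = dir_map \<psi> x w"
  shows "\<phi> = \<psi>"
proof -
  have 1: "on_pos \<phi> = on_pos \<psi>"
    using pos[of "Ident E (Cod E (poly_src \<psi>))"] f unfolding Poly_Arr by (auto simp: pos_map_def)
  let ?x = "pb1 E (on_pos \<psi>) (poly_tgt \<psi>)" and ?w = "pb2 E (on_pos \<psi>) (poly_tgt \<psi>)"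
  have "dir_map \<phi> ?x ?w = dir_map \<psi> ?x ?w"
    by (rule dir) (use f 1 pb_square[of "on_pos \<psi>" "poly_tgt \<psi>"] in \<open>unfold Poly_Arr, auto simp: pos_map_def\<close>)
  moreover have "pb_pair E (on_pos \<psi>) (poly_tgt \<psi>) ?x ?w = Ident E (pb E (on_pos \<psi>) (poly_tgt \<psi>))"
    using f pb_pair_eta[of "on_pos \<psi>" "poly_tgt \<psi>" "Ident E (pb E (on_pos \<psi>) (poly_tgt \<psi>))"]
    unfolding Poly_Arr by auto
  ultimately have "on_dir \<phi> = on_dir \<psi>"
    using f 1 unfolding Poly_Arr by (auto simp: dir_map_def)
  with 1 f(3,4) show ?thesis by (simp add: poly_arr.expand)
qed

lemma Poly_arrI:
  assumes "exponentiable E p" "exponentiable E q" "f \<in> Arr E" "Dom E f = Cod E p" "Cod E f = Cod E q"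
    "g \<in> Arr E" "Dom E g = pb E f q" "Cod E g = Dom E p" "p \<cdot> g = pb1 E f q"
  shows "Poly_arr p q f g \<in> Arr (Poly E)"
  using assms unfolding Poly_Arr by simp

text \<open>A definition written only at the generic direction acts by the same formula at all
  directions, once that formula is natural. The tensor, the associator and the unitors are all
  evaluated through this.\<close>

lemma Poly_arr_of_family:
  assumes [simp]: "exponentiable E p" "exponentiable E q"
    and c [simp]: "c \<in> Arr E" "Dom E c = Cod E p" "Cod E c = Cod E q"
    and D: "\<And>k d. \<lbrakk>k \<in> Arr E; Cod E k = Cod E p; d \<in> Arr E; Cod E d = Dom E q; q \<cdot> d = c \<cdot> k; Dom E d = Dom E k\<rbrakk> \<Longrightarrow>
      D k d \<in> Arr E \<and> Dom E (D k d) = Dom E k \<and> Cod E (D k d) = Dom E p \<and> p \<cdot> D k d = k \<and>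
      (\<forall>t\<in>Arr E. Cod E t = Dom E k \<longrightarrow> D k d \<cdot> t = D (k \<cdot> t) (d \<cdot> t))"
    and \<phi>: "\<phi> = Poly_arr p q c (D (pb1 E c q) (pb2 E c q))"
  shows "\<phi> \<in> Arr (Poly E)"
    and "\<lbrakk>k \<in> Arr E; Cod E k = Cod E p; d \<in> Arr E; Cod E d = Dom E q; q \<cdot> d = pos_map \<phi> k\<rbrakk> \<Longrightarrow> dir_map \<phi> k d = D k d"
proof -
  have D0: "D (pb1 E c q) (pb2 E c q) \<in> Arr E \<and> Dom E (D (pb1 E c q) (pb2 E c q)) = pb E c q \<and>
      Cod E (D (pb1 E c q) (pb2 E c q)) = Dom E p \<and> p \<cdot> D (pb1 E c q) (pb2 E c q) = pb1 E c q \<and>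
      (\<forall>t\<in>Arr E. Cod E t = pb E c q \<longrightarrow>
        D (pb1 E c q) (pb2 E c q) \<cdot> t = D (pb1 E c q \<cdot> t) (pb2 E c q \<cdot> t))"
    using D[of "pb1 E c q" "pb2 E c q"] pb_square[of c q] by simp
  then show "\<phi> \<in> Arr (Poly E)"
    unfolding \<phi> by (intro Poly_arrI) simp_all
  assume k [simp]: "k \<in> Arr E" "Cod E k = Cod E p" "d \<in> Arr E" "Cod E d = Dom E q" and d: "q \<cdot> d = pos_map \<phi> k"
  have ck: "c \<cdot> k = q \<cdot> d" using d by (simp add: pos_map_def \<phi>)
  have "Dom E k = Dom E d" using arg_cong[OF ck, of "Dom E"] by simp
  then show "dir_map \<phi> k d = D k d"
    using D0 ck by (simp add: dir_map_def \<phi>)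
qed

lemma Ident_Poly [simp]:
  assumes [simp]: "exponentiable E p"
  shows "Ident (Poly E) p \<in> Arr (Poly E)" "poly_src (Ident (Poly E) p) = p" "poly_tgt (Ident (Poly E) p) = p"
    "x \<in> Arr E \<Longrightarrow> Cod E x = Cod E p \<Longrightarrow> pos_map (Ident (Poly E) p) x = x"
    "\<lbrakk>x \<in> Arr E; Cod E x = Cod E p; w \<in> Arr E; Cod E w = Dom E p; p \<cdot> w = x\<rbrakk> \<Longrightarrow>
      dir_map (Ident (Poly E) p) x w = w"
proof -
  have I: "Ident (Poly E) p = Poly_arr p p (Ident E (Cod E p)) (pb2 E (Ident E (Cod E p)) p)"
    by (simp add: Poly_def)
  show "Ident (Poly E) p \<in> Arr (Poly E)" "poly_src (Ident (Poly E) p) = p" "poly_tgt (Ident (Poly E) p) = p"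
    unfolding I using pb_square[of "Ident E (Cod E p)" p] by (simp_all add: Poly_arrI)
  show "pos_map (Ident (Poly E) p) x = x" if "x \<in> Arr E" "Cod E x = Cod E p"
    using that by (simp add: I pos_map_def)
  show "dir_map (Ident (Poly E) p) x w = w"
    if "x \<in> Arr E" "Cod E x = Cod E p" "w \<in> Arr E" "Cod E w = Dom E p" "p \<cdot> w = x"
    using that by (auto simp add: I dir_map_def)
qed

lemma Comp_Poly_eq:
  "\<psi> \<cdot>\<^bsub>Poly E\<^esub> \<phi> = (let \<chi> = on_pos \<psi> \<cdot> on_pos \<phi>; r = poly_tgt \<psi> in
     Poly_arr (poly_src \<phi>) r \<chi> (dir_map \<phi> (pb1 E \<chi> r) (dir_map \<psi> (pos_map \<phi> (pb1 E \<chi> r)) (pb2 E \<chi> r))))"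
  by (simp add: Poly_def dir_map_def pos_map_def Let_def)

lemma Comp_Poly [simp]:
  assumes f [simp]: "\<phi> \<in> Arr (Poly E)" "\<psi> \<in> Arr (Poly E)" "poly_tgt \<phi> = poly_src \<psi>"
  shows "\<psi> \<cdot>\<^bsub>Poly E\<^esub> \<phi> \<in> Arr (Poly E)" "poly_src (\<psi> \<cdot>\<^bsub>Poly E\<^esub> \<phi>) = poly_src \<phi>"
    "poly_tgt (\<psi> \<cdot>\<^bsub>Poly E\<^esub> \<phi>) = poly_tgt \<psi>"
    "x \<in> Arr E \<Longrightarrow> Cod E x = Cod E (poly_src \<phi>) \<Longrightarrow> pos_map (\<psi> \<cdot>\<^bsub>Poly E\<^esub> \<phi>) x = pos_map \<psi> (pos_map \<phi> x)"
    "\<lbrakk>x \<in> Arr E; Cod E x = Cod E (poly_src \<phi>); w \<in> Arr E; Cod E w = Dom E (poly_tgt \<psi>);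
      poly_tgt \<psi> \<cdot> w = pos_map \<psi> (pos_map \<phi> x)\<rbrakk> \<Longrightarrow>
      dir_map (\<psi> \<cdot>\<^bsub>Poly E\<^esub> \<phi>) x w = dir_map \<phi> x (dir_map \<psi> (pos_map \<phi> x) w)"
proof -
  let ?\<chi> = "on_pos \<psi> \<cdot> on_pos \<phi>" and ?r = "poly_tgt \<psi>"
  have P: "on_pos \<phi> \<in> Arr E" "Dom E (on_pos \<phi>) = Cod E (poly_src \<phi>)" "Cod E (on_pos \<phi>) = Cod E (poly_src \<psi>)"
    "on_pos \<psi> \<in> Arr E" "Dom E (on_pos \<psi>) = Cod E (poly_src \<psi>)" "Cod E (on_pos \<psi>) = Cod E (poly_tgt \<psi>)"
    using f unfolding Poly_Arr by simp_all
  then have C [simp]: "?\<chi> \<in> Arr E" "Dom E ?\<chi> = Cod E (poly_src \<phi>)" "Cod E ?\<chi> = Cod E (poly_tgt \<psi>)"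
    by simp_all
  have sq: "pos_map \<psi> (pos_map \<phi> (pb1 E ?\<chi> ?r)) = ?r \<cdot> pb2 E ?\<chi> ?r"
    using pb_square[of ?\<chi> ?r] P by (simp add: pos_map_def)
  show 1: "\<psi> \<cdot>\<^bsub>Poly E\<^esub> \<phi> \<in> Arr (Poly E)"
    unfolding Comp_Poly_eq Let_def by (rule Poly_arrI) (simp_all add: sq)
  show "poly_src (\<psi> \<cdot>\<^bsub>Poly E\<^esub> \<phi>) = poly_src \<phi>" "poly_tgt (\<psi> \<cdot>\<^bsub>Poly E\<^esub> \<phi>) = poly_tgt \<psi>"
    by (simp_all add: Comp_Poly_eq Let_def)
  show "pos_map (\<psi> \<cdot>\<^bsub>Poly E\<^esub> \<phi>) x = pos_map \<psi> (pos_map \<phi> x)" if "x \<in> Arr E" "Cod E x = Cod E (poly_src \<phi>)"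
    using that P by (simp add: Comp_Poly_eq Let_def pos_map_def)
  assume [simp]: "x \<in> Arr E" "Cod E x = Cod E (poly_src \<phi>)" "w \<in> Arr E" "Cod E w = Dom E (poly_tgt \<psi>)"
    and w: "poly_tgt \<psi> \<cdot> w = pos_map \<psi> (pos_map \<phi> x)"
  have [simp]: "Dom E w = Dom E x" using arg_cong[OF w, of "Dom E"] by simp
  have w': "?\<chi> \<cdot> x = ?r \<cdot> w" using w P by (simp add: pos_map_def)
  show "dir_map (\<psi> \<cdot>\<^bsub>Poly E\<^esub> \<phi>) x w = dir_map \<phi> x (dir_map \<psi> (pos_map \<phi> x) w)"
    unfolding dir_map_def[of "\<psi> \<cdot>\<^bsub>Poly E\<^esub> \<phi>"] by (simp add: Comp_Poly_eq Let_def sq w' w)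
qed

text \<open>On generalized elements composition is nested application, so the laws hold by
  unfolding.\<close>

lemma Poly_category: "category (Poly E)"
  unfolding category_def
proof (intro conjI ballI impI)
  fix f g h assume f: "f \<in> Arr (Poly E)" "g \<in> Arr (Poly E)" "h \<in> Arr (Poly E)"
    "Cod (Poly E) f = Dom (Poly E) g \<and> Cod (Poly E) g = Dom (Poly E) h"
  show "h \<cdot>\<^bsub>Poly E\<^esub> (g \<cdot>\<^bsub>Poly E\<^esub> f) = (h \<cdot>\<^bsub>Poly E\<^esub> g) \<cdot>\<^bsub>Poly E\<^esub> f"
    by (rule poly_eqI) (use f in simp_all)
next
  fix f assume f: "f \<in> Arr (Poly E)"
  show "f \<cdot>\<^bsub>Poly E\<^esub> Ident (Poly E) (Dom (Poly E) f) = f"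
    by (rule poly_eqI) (use f in simp_all)
  show "Ident (Poly E) (Cod (Poly E) f) \<cdot>\<^bsub>Poly E\<^esub> f = f"
    by (rule poly_eqI) (use f in simp_all)
qed (simp_all add: hom_def)

text \<open>Bijectivity at every stage, on positions and on the directions at each position, yields
  an inverse. Inverses of the coherence maps then never have to be written as morphisms.\<close>

lemma Poly_isoI:
  assumes f [simp]: "\<phi> \<in> Arr (Poly E)"
    and inj: "\<And>x x'. \<lbrakk>x \<in> Arr E; x' \<in> Arr E; Dom E x = Dom E x'; Cod E x = Cod E (poly_src \<phi>);
      Cod E x' = Cod E (poly_src \<phi>); pos_map \<phi> x = pos_map \<phi> x'\<rbrakk> \<Longrightarrow> x = x'"
    and surj: "\<And>x'. \<lbrakk>x' \<in> Arr E; Cod E x' = Cod E (poly_tgt \<phi>)\<rbrakk> \<Longrightarrow>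
      \<exists>x\<in>Arr E. Cod E x = Cod E (poly_src \<phi>) \<and> pos_map \<phi> x = x'"
    and dinj: "\<And>x w w'. \<lbrakk>x \<in> Arr E; Cod E x = Cod E (poly_src \<phi>); w \<in> Arr E; Cod E w = Dom E (poly_tgt \<phi>);
      w' \<in> Arr E; Cod E w' = Dom E (poly_tgt \<phi>); Dom E w = Dom E x; Dom E w' = Dom E x;
      poly_tgt \<phi> \<cdot> w = pos_map \<phi> x; poly_tgt \<phi> \<cdot> w' = pos_map \<phi> x; dir_map \<phi> x w = dir_map \<phi> x w'\<rbrakk> \<Longrightarrow> w = w'"
    and dsurj: "\<And>x y. \<lbrakk>x \<in> Arr E; Cod E x = Cod E (poly_src \<phi>); y \<in> Arr E; Cod E y = Dom E (poly_src \<phi>);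
      Dom E y = Dom E x; poly_src \<phi> \<cdot> y = x\<rbrakk> \<Longrightarrow>
      \<exists>w\<in>Arr E. Cod E w = Dom E (poly_tgt \<phi>) \<and> poly_tgt \<phi> \<cdot> w = pos_map \<phi> x \<and> dir_map \<phi> x w = y"
  shows "is_iso (Poly E) \<phi>"
proof -
  let ?p = "poly_src \<phi>" and ?q = "poly_tgt \<phi>"
  \<comment> \<open>Surjectivity at the identity gives the inverse on positions.\<close>
  obtain g where g [simp]: "g \<in> Arr E" "Cod E g = Cod E ?p" and fg: "pos_map \<phi> g = Ident E (Cod E ?q)"
    using surj[of "Ident E (Cod E ?q)"] by auto
  have [simp]: "Dom E g = Cod E ?q" using arg_cong[OF fg, of "Dom E"] by simp
  have fgx: "pos_map \<phi> (g \<cdot> x) = x" if "x \<in> Arr E" "Cod E x = Cod E ?q" for x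
    using pos_map(4)[of \<phi> g x] that fg by simp
  have gfx: "g \<cdot> pos_map \<phi> x = x" if "x \<in> Arr E" "Cod E x = Cod E ?p" for x
    by (rule inj) (use that fgx[of "pos_map \<phi> x"] in simp_all)
  let ?x = "pb1 E g ?p" and ?y = "pb2 E g ?p"
  \<comment> \<open>Surjectivity at the generic direction over \<open>g\<close> gives the inverse on
    directions.\<close>
  have "\<exists>w\<in>Arr E. Cod E w = Dom E ?q \<and> ?q \<cdot> w = pos_map \<phi> (g \<cdot> ?x) \<and> dir_map \<phi> (g \<cdot> ?x) w = ?y"
    by (rule dsurj) (simp_all add: pb_square[of g ?p])
  then obtain w where w [simp]: "w \<in> Arr E" "Cod E w = Dom E ?q" and qw: "?q \<cdot> w = ?x"
    and dw: "dir_map \<phi> (g \<cdot> ?x) w = ?y"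
    using fgx[of ?x] by auto
  have [simp]: "Dom E w = pb E g ?p" using arg_cong[OF qw, of "Dom E"] by simp
  define \<psi> where "\<psi> = Poly_arr ?q ?p g w"
  have psi [simp]: "\<psi> \<in> Arr (Poly E)" "poly_src \<psi> = ?q" "poly_tgt \<psi> = ?p"
    unfolding \<psi>_def using qw by (simp_all add: Poly_arrI)
  have pp [simp]: "pos_map \<psi> x = g \<cdot> x" for x by (simp add: pos_map_def \<psi>_def)
  \<comment> \<open>The equation defining \<open>w\<close> at the generic direction, carried to
    arbitrary ones by naturality.\<close>
  have dd: "dir_map \<phi> (g \<cdot> x) (dir_map \<psi> x y) = y"
    if [simp]: "x \<in> Arr E" "Cod E x = Cod E ?q" "y \<in> Arr E" "Cod E y = Dom E ?p" "Dom E y = Dom E x"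
      and y: "?p \<cdot> y = g \<cdot> x" for x y
  proof -
    let ?u = "pb_pair E g ?p x y"
    have "dir_map \<phi> (g \<cdot> ?x) w \<cdot> ?u = dir_map \<phi> (g \<cdot> x) (dir_map \<psi> x y)"
      using dir_map(5)[of \<phi> "g \<cdot> ?x" w ?u] fgx[of ?x] y qw by (simp add: dir_map_def[of \<psi>]) (simp add: \<psi>_def)
    then show ?thesis using dw y by simp
  qed
  have dd': "dir_map \<psi> (pos_map \<phi> x) (dir_map \<phi> x w) = w"
    if [simp]: "x \<in> Arr E" "Cod E x = Cod E ?p" "w \<in> Arr E" "Cod E w = Dom E ?q" "Dom E w = Dom E x"
      and w: "?q \<cdot> w = pos_map \<phi> x" for x w
    by (rule dinj[of x]) (use dd[of "pos_map \<phi> x" "dir_map \<phi> x w"] w gfx[of x] in simp_all)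
  have "\<psi> \<cdot>\<^bsub>Poly E\<^esub> \<phi> = Ident (Poly E) ?p"
  proof (rule poly_eqI)
    fix x w assume "x \<in> Arr E" "Cod E x = Cod E (poly_src (Ident (Poly E) ?p))" "w \<in> Arr E"
      "Cod E w = Dom E (poly_tgt (Ident (Poly E) ?p))" "Dom E w = Dom E x"
      "poly_tgt (Ident (Poly E) ?p) \<cdot> w = pos_map (Ident (Poly E) ?p) x"
    then show "dir_map (\<psi> \<cdot>\<^bsub>Poly E\<^esub> \<phi>) x w = dir_map (Ident (Poly E) ?p) x w"
      using dd[of "pos_map \<phi> x" w] by (simp add: gfx)
  qed (simp_all add: gfx)
  moreover have "\<phi> \<cdot>\<^bsub>Poly E\<^esub> \<psi> = Ident (Poly E) ?q"
  proof (rule poly_eqI)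
    fix x w assume "x \<in> Arr E" "Cod E x = Cod E (poly_src (Ident (Poly E) ?q))" "w \<in> Arr E"
      "Cod E w = Dom E (poly_tgt (Ident (Poly E) ?q))" "Dom E w = Dom E x"
      "poly_tgt (Ident (Poly E) ?q) \<cdot> w = pos_map (Ident (Poly E) ?q) x"
    then show "dir_map (\<phi> \<cdot>\<^bsub>Poly E\<^esub> \<psi>) x w = dir_map (Ident (Poly E) ?q) x w"
      using dd'[of "g \<cdot> x" w] by (simp add: fgx)
  qed (simp_all add: fgx)
  ultimately show ?thesis
    unfolding is_iso_def hom_def by (intro conjI bexI[of _ \<psi>]) simp_all
qed

section \<open>Functoriality of the composition product\<close>

lemma comp_prod_pos_eq:
  assumes [simp]: "\<phi> \<in> Arr (Poly E)" "\<psi> \<in> Arr (Poly E)"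
  shows "comp_prod_pos E \<phi> \<psi> =
    (let p = poly_src \<phi>; p' = poly_tgt \<phi>; q = poly_src \<psi>; q' = poly_tgt \<psi>;
       x' = pos_map \<phi> (cp_pos E p q); k = pb1 E x' p'
     in mk_pos E p' q' x' (pos_map \<psi> (pos_app p q k (dir_map \<phi> (pos_fst p q k) (pb2 E x' p')))))"
  by (simp add: comp_prod_pos_def Let_def pos_map_def dir_map_def pos_app_def pos_fst_def)

lemma tensor_pos:
  assumes [simp]: "\<phi> \<in> Arr (Poly E)" "\<psi> \<in> Arr (Poly E)"
    and [simp]: "poly_src \<phi> = p" "poly_tgt \<phi> = p'" "poly_src \<psi> = q" "poly_tgt \<psi> = q'"
  shows "comp_prod_pos E \<phi> \<psi> \<in> Arr E" "Dom E (comp_prod_pos E \<phi> \<psi>) = Cod E (comp_prod E p q)"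
    "Cod E (comp_prod_pos E \<phi> \<psi>) = Cod E (comp_prod E p' q')"
    "\<lbrakk>k \<in> Arr E; Cod E k = Cod E (comp_prod E p q)\<rbrakk> \<Longrightarrow>
      pos_fst p' q' (comp_prod_pos E \<phi> \<psi> \<cdot> k) = pos_map \<phi> (pos_fst p q k)"
    "\<lbrakk>k \<in> Arr E; Cod E k = Cod E (comp_prod E p q); y \<in> Arr E; Cod E y = Dom E p'; p' \<cdot> y = pos_map \<phi> (pos_fst p q k)\<rbrakk> \<Longrightarrow>
      pos_app p' q' (comp_prod_pos E \<phi> \<psi> \<cdot> k) y = pos_map \<psi> (pos_app p q k (dir_map \<phi> (pos_fst p q k) y))"
proof -
  note [simp] = Poly_exp[of \<phi>, simplified] Poly_exp[of \<psi>, simplified] cp_typing[of p q]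
    and C = cp_Cod[of p q]
  define x' where "x' = pos_map \<phi> (cp_pos E p q)"
  define k0 where "k0 = pb1 E x' p'"
  define f where "f = pos_map \<psi> (pos_app p q k0 (dir_map \<phi> (pos_fst p q k0) (pb2 E x' p')))"
  have fsx: "pos_map \<phi> (pos_fst p q k) = x' \<cdot> k" if "k \<in> Arr E" "Cod E k = Cod E (comp_prod E p q)" for k
    using that C by (simp add: pos_fst_def x'_def)
  have x [simp]: "x' \<in> Arr E" "Cod E x' = Cod E p'" "Dom E x' = Cod E (comp_prod E p q)"
    using C by (simp_all add: x'_def)
  have K [simp]: "k0 \<in> Arr E" "Cod E k0 = Cod E (comp_prod E p q)" "Dom E k0 = pb E x' p'"
    by (simp_all add: k0_def)
  have sq: "p' \<cdot> pb2 E x' p' = pos_map \<phi> (pos_fst p q k0)"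
    using pb_square[of x' p'] fsx[OF K(1,2)] by (simp add: k0_def)
  have f [simp]: "f \<in> Arr E" "Dom E f = pb E x' p'" "Cod E f = Cod E q'"
    by (simp_all add: f_def sq)
  have eq: "comp_prod_pos E \<phi> \<psi> = mk_pos E p' q' x' f"
    using comp_prod_pos_eq[of \<phi> \<psi>] by (simp add: Let_def f_def k0_def x'_def)
  show "comp_prod_pos E \<phi> \<psi> \<in> Arr E" "Dom E (comp_prod_pos E \<phi> \<psi>) = Cod E (comp_prod E p q)"
    "Cod E (comp_prod_pos E \<phi> \<psi>) = Cod E (comp_prod E p' q')"
    unfolding eq by simp_all
  assume k [simp]: "k \<in> Arr E" "Cod E k = Cod E (comp_prod E p q)"
  show "pos_fst p' q' (comp_prod_pos E \<phi> \<psi> \<cdot> k) = pos_map \<phi> (pos_fst p q k)"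
    unfolding eq fsx[OF k] by simp
  assume y [simp]: "y \<in> Arr E" "Cod E y = Dom E p'" and py: "p' \<cdot> y = pos_map \<phi> (pos_fst p q k)"
  \<comment> \<open>\<open>u\<close> classifies the pair \<open>(k, y)\<close>: the generic
    direction restricts to \<open>y\<close> along it, so the definition at the generic element
    specialises.\<close>
  define u where "u = pb_pair E x' p' k y"
  have D: "Dom E y = Dom E k" using arg_cong[OF py, of "Dom E"] by simp
  have u [simp]: "u \<in> Arr E" "Dom E u = Dom E k" "Cod E u = pb E x' p'" "k0 \<cdot> u = k" "pb2 E x' p' \<cdot> u = y"
    using py fsx[OF k] D by (simp_all add: u_def k0_def)
  have "pos_app p' q' (comp_prod_pos E \<phi> \<psi> \<cdot> k) y = f \<cdot> u"
    unfolding eq u_def by (rule mk_pos) (use py fsx[OF k] in simp_all)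
  also have "\<dots> = pos_map \<psi> (pos_app p q k (dir_map \<phi> (pos_fst p q k) y))"
    by (simp add: f_def sq)
  finally show "pos_app p' q' (comp_prod_pos E \<phi> \<psi> \<cdot> k) y = pos_map \<psi> (pos_app p q k (dir_map \<phi> (pos_fst p q k) y))" .
qed

lemma tensor_sel [simp]:
  "poly_src (comp_prod_arr E \<phi> \<psi>) = comp_prod E (poly_src \<phi>) (poly_src \<psi>)"
  "poly_tgt (comp_prod_arr E \<phi> \<psi>) = comp_prod E (poly_tgt \<phi>) (poly_tgt \<psi>)"
  by (simp_all add: comp_prod_arr_def)

text \<open>Sources and targets are variables tied by equations so that the rules still match after
  \<open>poly_src \<phi>\<close> or \<open>poly_tgt \<phi>\<close> has been rewritten to a concrete
  polynomial.\<close>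

lemma tensor [simp]:
  assumes [simp]: "\<phi> \<in> Arr (Poly E)" "\<psi> \<in> Arr (Poly E)"
    and [simp]: "poly_src \<phi> = p" "poly_tgt \<phi> = p'" "poly_src \<psi> = q" "poly_tgt \<psi> = q'"
  shows "comp_prod_arr E \<phi> \<psi> \<in> Arr (Poly E)" (is ?A)
    "\<lbrakk>k \<in> Arr E; Cod E k = Cod E (comp_prod E p q)\<rbrakk> \<Longrightarrow>
      pos_fst p' q' (pos_map (comp_prod_arr E \<phi> \<psi>) k) = pos_map \<phi> (pos_fst p q k)"
    "\<lbrakk>k \<in> Arr E; Cod E k = Cod E (comp_prod E p q); y \<in> Arr E; Cod E y = Dom E p'; p' \<cdot> y = pos_map \<phi> (pos_fst p q k)\<rbrakk> \<Longrightarrow>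
      pos_app p' q' (pos_map (comp_prod_arr E \<phi> \<psi>) k) y = pos_map \<psi> (pos_app p q k (dir_map \<phi> (pos_fst p q k) y))"
    "\<lbrakk>k \<in> Arr E; Cod E k = Cod E (comp_prod E p q); d \<in> Arr E; Cod E d = Dom E (comp_prod E p' q');
       comp_prod E p' q' \<cdot> d = pos_map (comp_prod_arr E \<phi> \<psi>) k\<rbrakk> \<Longrightarrow>
      dir_map (comp_prod_arr E \<phi> \<psi>) k d = mk_dir E p q k (dir_map \<phi> (pos_fst p q k) (dir1 E p' q' d))
         (dir_map \<psi> (pos_app p q k (dir_map \<phi> (pos_fst p q k) (dir1 E p' q' d))) (dir2 E p' q' d))" (is "PROP ?D")
proof -
  note [simp] = Poly_exp[of \<phi>, simplified] Poly_exp[of \<psi>, simplified]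
  let ?c = "comp_prod_pos E \<phi> \<psi>"
  note c [simp] = tensor_pos[of \<phi> \<psi>, simplified]
  have pac: "pos_map (comp_prod_arr E \<phi> \<psi>) k = ?c \<cdot> k" for k
    by (simp add: pos_map_def comp_prod_arr_def)
  show "\<lbrakk>k \<in> Arr E; Cod E k = Cod E (comp_prod E p q)\<rbrakk> \<Longrightarrow>
      pos_fst p' q' (pos_map (comp_prod_arr E \<phi> \<psi>) k) = pos_map \<phi> (pos_fst p q k)"
    "\<lbrakk>k \<in> Arr E; Cod E k = Cod E (comp_prod E p q); y \<in> Arr E; Cod E y = Dom E p'; p' \<cdot> y = pos_map \<phi> (pos_fst p q k)\<rbrakk> \<Longrightarrow>
      pos_app p' q' (pos_map (comp_prod_arr E \<phi> \<psi>) k) y = pos_map \<psi> (pos_app p q k (dir_map \<phi> (pos_fst p q k) y))"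
    unfolding pac by simp_all
  define D where "D k d = mk_dir E p q k (dir_map \<phi> (pos_fst p q k) (dir1 E p' q' d))
         (dir_map \<psi> (pos_app p q k (dir_map \<phi> (pos_fst p q k) (dir1 E p' q' d))) (dir2 E p' q' d))" for k d
  have "comp_prod_arr E \<phi> \<psi> = Poly_arr (comp_prod E p q) (comp_prod E p' q') ?c
      (D (pb1 E ?c (comp_prod E p' q')) (pb2 E ?c (comp_prod E p' q')))"
    by (simp add: comp_prod_arr_def comp_prod_dir_def Let_def dir_map_def pos_app_def pos_fst_def D_def)
  note fam = Poly_arr_of_family[where D = D, OF _ _ _ _ _ _ this]
  show ?A by (rule fam) (simp_all add: D_def)
  show "PROP ?D"
    unfolding D_def[symmetric] by (rule fam) (simp_all add: D_def)
qed

text \<open>Curried extensionality: a value of a position of a right-nested product is again a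
  position. A test stage \<open>s\<close> of the inner position is absorbed into
  \<open>t \<cdot> s\<close> by restricting \<open>y\<close> along \<open>s\<close>.\<close>

lemma pos_eqI2:
  assumes [simp]: "exponentiable E p" "exponentiable E q" "exponentiable E r"
    and k [simp]: "k \<in> Arr E" "k' \<in> Arr E" "Dom E k = Dom E k'" "Cod E k = Cod E (comp_prod E p (comp_prod E q r))"
    "Cod E k' = Cod E (comp_prod E p (comp_prod E q r))" and fseq: "pos_fst p (comp_prod E q r) k = pos_fst p (comp_prod E q r) k'"
    and app1: "\<And>t y. \<lbrakk>t \<in> Arr E; Cod E t = Dom E k'; y \<in> Arr E; Cod E y = Dom E p; Dom E y = Dom E t;
      p \<cdot> y = pos_fst p (comp_prod E q r) (k' \<cdot> t)\<rbrakk> \<Longrightarrow>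
      pos_fst q r (pos_app p (comp_prod E q r) (k \<cdot> t) y) = pos_fst q r (pos_app p (comp_prod E q r) (k' \<cdot> t) y)"
    and app2: "\<And>t y z. \<lbrakk>t \<in> Arr E; Cod E t = Dom E k'; y \<in> Arr E; Cod E y = Dom E p; Dom E y = Dom E t;
      p \<cdot> y = pos_fst p (comp_prod E q r) (k' \<cdot> t); z \<in> Arr E; Cod E z = Dom E q; Dom E z = Dom E t;
      q \<cdot> z = pos_fst q r (pos_app p (comp_prod E q r) (k' \<cdot> t) y)\<rbrakk> \<Longrightarrow>
      pos_app q r (pos_app p (comp_prod E q r) (k \<cdot> t) y) z = pos_app q r (pos_app p (comp_prod E q r) (k' \<cdot> t) y) z"
  shows "k = k'"
proof (rule pos_eqI[OF assms(1) _ k fseq])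
  fix t y assume y: "t \<in> Arr E" "Cod E t = Dom E k'" "y \<in> Arr E" "Cod E y = Dom E p" "Dom E y = Dom E t"
      "p \<cdot> y = pos_fst p (comp_prod E q r) (k' \<cdot> t)"
  have "pos_fst p (comp_prod E q r) (k \<cdot> t) = pos_fst p (comp_prod E q r) (k' \<cdot> t)"
    using fseq y pos_fst(4)[of p "comp_prod E q r" k t] pos_fst(4)[of p "comp_prod E q r" k' t] by simp
  then have y': "p \<cdot> y = pos_fst p (comp_prod E q r) (k \<cdot> t)" using y(6) by simp
  show "pos_app p (comp_prod E q r) (k \<cdot> t) y = pos_app p (comp_prod E q r) (k' \<cdot> t) y"
  proof (rule pos_eqI[OF assms(2,3)])
    fix s z assume s: "s \<in> Arr E" "Cod E s = Dom E (pos_app p (comp_prod E q r) (k' \<cdot> t) y)" "z \<in> Arr E"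
      "Cod E z = Dom E q" "Dom E z = Dom E s" "q \<cdot> z = pos_fst q r (pos_app p (comp_prod E q r) (k' \<cdot> t) y \<cdot> s)"
    have "p \<cdot> y \<cdot> s = pos_fst p (comp_prod E q r) (k' \<cdot> t \<cdot> s)"
      using comp_eq_arr[OF y(6), of s] y s by simp
    then show "pos_app q r (pos_app p (comp_prod E q r) (k \<cdot> t) y \<cdot> s) z = pos_app q r (pos_app p (comp_prod E q r) (k' \<cdot> t) y \<cdot> s) z"
      using app2[of "t \<cdot> s" "y \<cdot> s" z] y y' s by simp
  qed (use y y' app1 in simp_all)
qed simp

text \<open>One level deeper, for the positions in the pentagon.\<close>

lemma pos_eqI3:
  assumes [simp]: "exponentiable E p" "exponentiable E q" "exponentiable E r" "exponentiable E s"
    and k [simp]: "k \<in> Arr E" "k' \<in> Arr E" "Dom E k = Dom E k'"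
    "Cod E k = Cod E (comp_prod E p (comp_prod E q (comp_prod E r s)))"
    "Cod E k' = Cod E (comp_prod E p (comp_prod E q (comp_prod E r s)))"
    and fseq: "pos_fst p (comp_prod E q (comp_prod E r s)) k = pos_fst p (comp_prod E q (comp_prod E r s)) k'"
    and app1: "\<And>t y. \<lbrakk>t \<in> Arr E; Cod E t = Dom E k'; y \<in> Arr E; Cod E y = Dom E p; Dom E y = Dom E t;
      p \<cdot> y = pos_fst p (comp_prod E q (comp_prod E r s)) (k' \<cdot> t)\<rbrakk> \<Longrightarrow>
      pos_fst q (comp_prod E r s) (pos_app p (comp_prod E q (comp_prod E r s)) (k \<cdot> t) y) =
      pos_fst q (comp_prod E r s) (pos_app p (comp_prod E q (comp_prod E r s)) (k' \<cdot> t) y)"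
    and app2: "\<And>t y z. \<lbrakk>t \<in> Arr E; Cod E t = Dom E k'; y \<in> Arr E; Cod E y = Dom E p; Dom E y = Dom E t;
      p \<cdot> y = pos_fst p (comp_prod E q (comp_prod E r s)) (k' \<cdot> t); z \<in> Arr E; Cod E z = Dom E q; Dom E z = Dom E t;
      q \<cdot> z = pos_fst q (comp_prod E r s) (pos_app p (comp_prod E q (comp_prod E r s)) (k' \<cdot> t) y)\<rbrakk> \<Longrightarrow>
      pos_fst r s (pos_app q (comp_prod E r s) (pos_app p (comp_prod E q (comp_prod E r s)) (k \<cdot> t) y) z) =
      pos_fst r s (pos_app q (comp_prod E r s) (pos_app p (comp_prod E q (comp_prod E r s)) (k' \<cdot> t) y) z)"
    and app3: "\<And>t y z w. \<lbrakk>t \<in> Arr E; Cod E t = Dom E k'; y \<in> Arr E; Cod E y = Dom E p; Dom E y = Dom E t;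
      p \<cdot> y = pos_fst p (comp_prod E q (comp_prod E r s)) (k' \<cdot> t); z \<in> Arr E; Cod E z = Dom E q; Dom E z = Dom E t;
      q \<cdot> z = pos_fst q (comp_prod E r s) (pos_app p (comp_prod E q (comp_prod E r s)) (k' \<cdot> t) y);
      w \<in> Arr E; Cod E w = Dom E r; Dom E w = Dom E t;
      r \<cdot> w = pos_fst r s (pos_app q (comp_prod E r s) (pos_app p (comp_prod E q (comp_prod E r s)) (k' \<cdot> t) y) z)\<rbrakk> \<Longrightarrow>
      pos_app r s (pos_app q (comp_prod E r s) (pos_app p (comp_prod E q (comp_prod E r s)) (k \<cdot> t) y) z) w =
      pos_app r s (pos_app q (comp_prod E r s) (pos_app p (comp_prod E q (comp_prod E r s)) (k' \<cdot> t) y) z) w"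
  shows "k = k'"
proof -
  let ?v = "comp_prod E r s" let ?u = "comp_prod E q ?v"
  show ?thesis
  proof (rule pos_eqI[OF assms(1) _ k fseq])
    fix t y assume y: "t \<in> Arr E" "Cod E t = Dom E k'" "y \<in> Arr E" "Cod E y = Dom E p" "Dom E y = Dom E t"
        "p \<cdot> y = pos_fst p ?u (k' \<cdot> t)"
    have "pos_fst p ?u (k \<cdot> t) = pos_fst p ?u (k' \<cdot> t)"
      using fseq y pos_fst(4)[of p "?u" k t] pos_fst(4)[of p "?u" k' t] by simp
    then have y': "p \<cdot> y = pos_fst p ?u (k \<cdot> t)" using y(6) by simp
    show "pos_app p ?u (k \<cdot> t) y = pos_app p ?u (k' \<cdot> t) y"
    proof (rule pos_eqI2[OF assms(2-4)])
      fix s' z assume s: "s' \<in> Arr E" "Cod E s' = Dom E (pos_app p ?u (k' \<cdot> t) y)" "z \<in> Arr E"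
        "Cod E z = Dom E q" "Dom E z = Dom E s'" "q \<cdot> z = pos_fst q ?v (pos_app p ?u (k' \<cdot> t) y \<cdot> s')"
      have py: "p \<cdot> y \<cdot> s' = pos_fst p ?u (k' \<cdot> t \<cdot> s')"
        using comp_eq_arr[OF y(6), of s'] y s by simp
      then show "pos_fst r s (pos_app q ?v (pos_app p ?u (k \<cdot> t) y \<cdot> s') z) = pos_fst r s (pos_app q ?v (pos_app p ?u (k' \<cdot> t) y \<cdot> s') z)"
        using app2[of "t \<cdot> s'" "y \<cdot> s'" z] y y' s by simp
      fix w assume "w \<in> Arr E" "Cod E w = Dom E r" "Dom E w = Dom E s'"
        "r \<cdot> w = pos_fst r s (pos_app q ?v (pos_app p ?u (k' \<cdot> t) y \<cdot> s') z)"
      then show "pos_app r s (pos_app q ?v (pos_app p ?u (k \<cdot> t) y \<cdot> s') z) w = pos_app r s (pos_app q ?v (pos_app p ?u (k' \<cdot> t) y \<cdot> s') z) w"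
        using app3[of "t \<cdot> s'" "y \<cdot> s'" z w] y y' s py by simp
    qed (use y y' app1 in simp_all)
  qed simp
qed

lemma tensor_Ident:
  assumes [simp]: "exponentiable E p" "exponentiable E q"
  shows "comp_prod_arr E (Ident (Poly E) p) (Ident (Poly E) q) = Ident (Poly E) (comp_prod E p q)"
proof (rule poly_eqI)
  fix x assume "x \<in> Arr E" "Cod E x = Cod E (poly_src (Ident (Poly E) (comp_prod E p q)))"
  then show "pos_map (comp_prod_arr E (Ident (Poly E) p) (Ident (Poly E) q)) x = pos_map (Ident (Poly E) (comp_prod E p q)) x"
    by - (rule pos_eqI[of p q], simp_all)
qed simp_all

lemma tensor_Comp:
  assumes [simp]: "f \<in> Arr (Poly E)" "g \<in> Arr (Poly E)" "f' \<in> Arr (Poly E)" "g' \<in> Arr (Poly E)"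
    "poly_tgt f = poly_src g" "poly_tgt f' = poly_src g'"
  shows "comp_prod_arr E (g \<cdot>\<^bsub>Poly E\<^esub> f) (g' \<cdot>\<^bsub>Poly E\<^esub> f') =
    comp_prod_arr E g g' \<cdot>\<^bsub>Poly E\<^esub> comp_prod_arr E f f'"
proof (rule poly_eqI)
  fix x assume "x \<in> Arr E" "Cod E x = Cod E (poly_src (comp_prod_arr E g g' \<cdot>\<^bsub>Poly E\<^esub> comp_prod_arr E f f'))"
  then show "pos_map (comp_prod_arr E (g \<cdot>\<^bsub>Poly E\<^esub> f) (g' \<cdot>\<^bsub>Poly E\<^esub> f')) x =
    pos_map (comp_prod_arr E g g' \<cdot>\<^bsub>Poly E\<^esub> comp_prod_arr E f f') x"
    by - (rule pos_eqI[of "poly_tgt g" "poly_tgt g'"], simp_all)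
qed simp_all

lemma tensor_functor: "is_functor (prod_cat (Poly E) (Poly E)) (Poly E) (comp_prod_functor E)"
proof -
  note C = categoryD[OF Poly_category]
  have "category (prod_cat (Poly E) (Poly E))"
    unfolding category_def prod_cat_def hom_def using C by (auto simp del: Poly_sel)
  then show ?thesis
    using Poly_category
    by (auto simp: is_functor_def prod_cat_def comp_prod_functor_def hom_def tensor_Ident tensor_Comp)
qed

section \<open>Associator\<close>

text \<open>The definition speaks of the generic position only. Each level of currying adds one
  pullback, and an argument at an arbitrary stage is reached through the arrow classifying
  it.\<close>

lemma assoc_pos:
  assumes [simp]: "exponentiable E p" "exponentiable E q" "exponentiable E r"
  shows "assoc_pos E p q r \<in> Arr E" (is ?T1)
    "Dom E (assoc_pos E p q r) = Cod E (comp_prod E (comp_prod E p q) r)" (is ?T2)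
    "Cod E (assoc_pos E p q r) = Cod E (comp_prod E p (comp_prod E q r))" (is ?T3)
    "\<lbrakk>j \<in> Arr E; Cod E j = Cod E (comp_prod E (comp_prod E p q) r)\<rbrakk> \<Longrightarrow>
      pos_fst p (comp_prod E q r) (assoc_pos E p q r \<cdot> j) = pos_fst p q (pos_fst (comp_prod E p q) r j)"
    "\<lbrakk>j \<in> Arr E; Cod E j = Cod E (comp_prod E (comp_prod E p q) r);
      y \<in> Arr E; Cod E y = Dom E p; p \<cdot> y = pos_fst p q (pos_fst (comp_prod E p q) r j)\<rbrakk> \<Longrightarrow>
      pos_fst q r (pos_app p (comp_prod E q r) (assoc_pos E p q r \<cdot> j) y) = pos_app p q (pos_fst (comp_prod E p q) r j) y"
    "\<lbrakk>j \<in> Arr E; Cod E j = Cod E (comp_prod E (comp_prod E p q) r);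
      y \<in> Arr E; Cod E y = Dom E p; p \<cdot> y = pos_fst p q (pos_fst (comp_prod E p q) r j);
      z \<in> Arr E; Cod E z = Dom E q; q \<cdot> z = pos_app p q (pos_fst (comp_prod E p q) r j) y\<rbrakk> \<Longrightarrow>
      pos_app q r (pos_app p (comp_prod E q r) (assoc_pos E p q r \<cdot> j) y) z =
      pos_app (comp_prod E p q) r j (mk_dir E p q (pos_fst (comp_prod E p q) r j) y z)"
proof -
  define s where "s = comp_prod E p q"
  have s [simp]: "exponentiable E s" by (simp add: s_def)
  note [simp] = cp_typing[of s r] cp_typing[of p q] and C = cp_Cod[of s r]
  define k where "k = cp_pos E s r"
  define x where "x = pos_fst p q k"
  have k [simp]: "k \<in> Arr E" "Dom E k = Cod E (comp_prod E s r)" "Cod E k = Cod E s"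
    using C by (simp_all add: k_def)
  have kj: "k \<cdot> j = pos_fst s r j" for j by (simp add: k_def pos_fst_def)
  have x [simp]: "x \<in> Arr E" "Dom E x = Cod E (comp_prod E s r)" "Cod E x = Cod E p"
    by (simp_all add: x_def s_def[symmetric])
  have xj: "x \<cdot> j = pos_fst p q (pos_fst s r j)" if "j \<in> Arr E" "Cod E j = Cod E (comp_prod E s r)" for j
    using that by (simp add: x_def kj[symmetric] s_def[symmetric])
  \<comment> \<open>\<open>b2\<close> is the generic direction of \<open>p\<close> over the generic
    position restricted along \<open>b1\<close>; \<open>c1\<close> and \<open>c2\<close> below add
    the generic direction of \<open>q\<close> at the value there.\<close>
  define b1 b2 where "b1 = pb1 E x p" and "b2 = pb2 E x p"
  have b [simp]: "b1 \<in> Arr E" "b2 \<in> Arr E" "Dom E b1 = pb E x p" "Dom E b2 = pb E x p"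
    "Cod E b1 = Cod E (comp_prod E s r)" "Cod E b2 = Dom E p" 
    and bsq: "p \<cdot> b2 = pos_fst p q (pos_fst s r b1)"
    using pb_square[of x p] xj[of "pb1 E x p"] by (simp_all add: b1_def b2_def)
  define f where "f = pos_app p q (pos_fst s r b1) b2"
  have fsb [simp]: "Cod E (pos_fst s r b1) = Cod E (comp_prod E p q)" by (simp add: s_def[symmetric])
  have f [simp]: "f \<in> Arr E" "Dom E f = pb E x p" "Cod E f = Cod E q"
    by (simp_all add: f_def bsq)
  have fu: "f \<cdot> u = pos_app p q (pos_fst s r (b1 \<cdot> u)) (b2 \<cdot> u)" if "u \<in> Arr E" "Cod E u = pb E x p" for u
    using that by (simp add: f_def bsq)
  define c1 c2 where "c1 = pb1 E f q" and "c2 = pb2 E f q"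
  have c [simp]: "c1 \<in> Arr E" "c2 \<in> Arr E" "Dom E c1 = pb E f q" "Dom E c2 = pb E f q"
    "Cod E c1 = pb E x p" "Cod E c2 = Dom E q"
    and csq: "q \<cdot> c2 = pos_app p q (pos_fst s r (b1 \<cdot> c1)) (b2 \<cdot> c1)"
    using pb_square[of f q] fu[of "pb1 E f q"] by (simp_all add: c1_def c2_def)
  have psq: "p \<cdot> b2 \<cdot> c1 = pos_fst p q (pos_fst s r (b1 \<cdot> c1))"
    using comp_eq_arr[OF bsq, of c1] by simp
  \<comment> \<open>The two generic directions joined into one of
    \<open>p \<triangleleft> q\<close>; \<open>H\<close> below is the value there, so it is the
    fully curried function.\<close>
  define m where "m = mk_dir E p q (pos_fst s r (b1 \<cdot> c1)) (b2 \<cdot> c1) c2"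
  have fsc [simp]: "Cod E (pos_fst s r (b1 \<cdot> c1)) = Cod E (comp_prod E p q)" by (simp add: s_def[symmetric])
  have m [simp]: "m \<in> Arr E" "Dom E m = pb E f q" "Cod E m = Dom E s" "s \<cdot> m = pos_fst s r (b1 \<cdot> c1)"
    by (simp_all add: m_def csq psq) (simp_all add: s_def csq psq fsc[unfolded s_def])
  have mv: "m \<cdot> v = mk_dir E p q (pos_fst s r (b1 \<cdot> c1 \<cdot> v)) (b2 \<cdot> c1 \<cdot> v) (c2 \<cdot> v)"
    if "v \<in> Arr E" "Cod E v = pb E f q" for v
    using that by (simp add: m_def csq psq)
  define H where "H = pos_app s r (b1 \<cdot> c1) m"
  have H [simp]: "H \<in> Arr E" "Dom E H = pb E f q" "Cod E H = Cod E r"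
    by (simp_all add: H_def)
  have Hv: "H \<cdot> v = pos_app s r (b1 \<cdot> c1 \<cdot> v) (mk_dir E p q (pos_fst s r (b1 \<cdot> c1 \<cdot> v)) (b2 \<cdot> c1 \<cdot> v) (c2 \<cdot> v))"
    if "v \<in> Arr E" "Cod E v = pb E f q" for v
    using that by (simp add: H_def mv)
  have eq: "assoc_pos E p q r = mk_pos E p (comp_prod E q r) x (mk_pos E q r f H)"
  proof -
    have 1: "pos_fun E p q k = f"
      by (simp add: pos_fun_def f_def pos_app_def Let_def kj b1_def b2_def x_def pos_fst_def[of p q k, symmetric])
    have 2: "cp_ev E s r \<cdot> pb_pair E k s (b1 \<cdot> c1) (mk_dir E p q (k \<cdot> (b1 \<cdot> c1)) (b2 \<cdot> c1) c2) = H"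
      by (simp add: H_def pos_app_def m_def kj k_def[symmetric])
    show ?thesis
      unfolding assoc_pos_def Let_def s_def[symmetric] k_def[symmetric] 1
      unfolding pos_fst_def[symmetric] x_def[symmetric] b1_def[symmetric] b2_def[symmetric]
        c1_def[symmetric] c2_def[symmetric] 2 ..
  qed
  show ?T1 ?T2 ?T3
    unfolding eq s_def[symmetric] by simp_all
  assume j [simp]: "j \<in> Arr E" and Cj: "Cod E j = Cod E (comp_prod E (comp_prod E p q) r)"
  have Cj' [simp]: "Cod E j = Cod E (comp_prod E s r)" using Cj by (simp add: s_def)
  have x'j: "pos_fst p q (pos_fst (comp_prod E p q) r j) = x \<cdot> j" by (simp add: xj s_def[symmetric])
  show "pos_fst p (comp_prod E q r) (assoc_pos E p q r \<cdot> j) = pos_fst p q (pos_fst (comp_prod E p q) r j)"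
    unfolding eq x'j by simp
  assume y [simp]: "y \<in> Arr E" "Cod E y = Dom E p" and y': "p \<cdot> y = pos_fst p q (pos_fst (comp_prod E p q) r j)"
  note py = y'[unfolded x'j]
  have [simp]: "Dom E y = Dom E j" using arg_cong[OF py, of "Dom E"] by simp
  \<comment> \<open>\<open>u\<close> classifies \<open>(j, y)\<close>, and \<open>v\<close> below
    classifies \<open>(u, z)\<close>. Precomposing with them turns the generic \<open>f\<close> and
    \<open>H\<close> into values at \<open>j\<close>.\<close>
  define u where "u = pb_pair E x p j y"
  have u [simp]: "u \<in> Arr E" "Dom E u = Dom E j" "Cod E u = pb E x p" "b1 \<cdot> u = j" "b2 \<cdot> u = y"
    using py by (simp_all add: u_def b1_def b2_def)
  have ap: "pos_app p (comp_prod E q r) (assoc_pos E p q r \<cdot> j) y = mk_pos E q r f H \<cdot> u"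
    unfolding eq u_def by (rule mk_pos) (use py in simp_all)
  have fuj: "pos_app p q (pos_fst (comp_prod E p q) r j) y = f \<cdot> u" by (simp add: fu s_def[symmetric])
  show "pos_fst q r (pos_app p (comp_prod E q r) (assoc_pos E p q r \<cdot> j) y) = pos_app p q (pos_fst (comp_prod E p q) r j) y"
    unfolding ap fuj by simp
  assume z [simp]: "z \<in> Arr E" "Cod E z = Dom E q" and z': "q \<cdot> z = pos_app p q (pos_fst (comp_prod E p q) r j) y"
  note qz = z'[unfolded fuj]
  have [simp]: "Dom E z = Dom E j" using arg_cong[OF qz, of "Dom E"] by simp
  define v where "v = pb_pair E f q u z"
  have v [simp]: "v \<in> Arr E" "Dom E v = Dom E j" "Cod E v = pb E f q" "c1 \<cdot> v = u" "c2 \<cdot> v = z"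
    using qz by (simp_all add: v_def c1_def c2_def)
  have "pos_app q r (pos_app p (comp_prod E q r) (assoc_pos E p q r \<cdot> j) y) z = H \<cdot> v"
    unfolding ap v_def by (rule mk_pos) (use qz in simp_all)
  then show "pos_app q r (pos_app p (comp_prod E q r) (assoc_pos E p q r \<cdot> j) y) z =
      pos_app (comp_prod E p q) r j (mk_dir E p q (pos_fst (comp_prod E p q) r j) y z)"
    by (simp add: Hv s_def[symmetric])
qed

lemma assoc_sel [simp]:
  "poly_src (associator E p q r) = comp_prod E (comp_prod E p q) r"
  "poly_tgt (associator E p q r) = comp_prod E p (comp_prod E q r)"
  by (simp_all add: associator_def)

lemma assoc [simp]:
  assumes [simp]: "exponentiable E p" "exponentiable E q" "exponentiable E r"
  shows "associator E p q r \<in> Arr (Poly E)"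
    "\<lbrakk>j \<in> Arr E; Cod E j = Cod E (comp_prod E (comp_prod E p q) r)\<rbrakk> \<Longrightarrow>
      pos_fst p (comp_prod E q r) (pos_map (associator E p q r) j) = pos_fst p q (pos_fst (comp_prod E p q) r j)"
    "\<lbrakk>j \<in> Arr E; Cod E j = Cod E (comp_prod E (comp_prod E p q) r);
      y \<in> Arr E; Cod E y = Dom E p; p \<cdot> y = pos_fst p q (pos_fst (comp_prod E p q) r j)\<rbrakk> \<Longrightarrow>
      pos_fst q r (pos_app p (comp_prod E q r) (pos_map (associator E p q r) j) y) = pos_app p q (pos_fst (comp_prod E p q) r j) y"
    "\<lbrakk>j \<in> Arr E; Cod E j = Cod E (comp_prod E (comp_prod E p q) r);
      y \<in> Arr E; Cod E y = Dom E p; p \<cdot> y = pos_fst p q (pos_fst (comp_prod E p q) r j);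
      z \<in> Arr E; Cod E z = Dom E q; q \<cdot> z = pos_app p q (pos_fst (comp_prod E p q) r j) y\<rbrakk> \<Longrightarrow>
      pos_app q r (pos_app p (comp_prod E q r) (pos_map (associator E p q r) j) y) z =
      pos_app (comp_prod E p q) r j (mk_dir E p q (pos_fst (comp_prod E p q) r j) y z)"
    "\<lbrakk>j \<in> Arr E; Cod E j = Cod E (comp_prod E (comp_prod E p q) r);
      d \<in> Arr E; Cod E d = Dom E (comp_prod E p (comp_prod E q r));
      comp_prod E p (comp_prod E q r) \<cdot> d = pos_map (associator E p q r) j\<rbrakk> \<Longrightarrow>
      dir_map (associator E p q r) j d = mk_dir E (comp_prod E p q) r j
        (mk_dir E p q (pos_fst (comp_prod E p q) r j) (dir1 E p (comp_prod E q r) d)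
          (dir1 E q r (dir2 E p (comp_prod E q r) d)))
        (dir2 E q r (dir2 E p (comp_prod E q r) d))" (is "PROP ?D")
proof -
  let ?c = "assoc_pos E p q r" and ?t = "comp_prod E p (comp_prod E q r)"
  note c [simp] = assoc_pos[of p q r]
  have pac: "pos_map (associator E p q r) j = ?c \<cdot> j" for j by (simp add: pos_map_def associator_def)
  show "\<lbrakk>j \<in> Arr E; Cod E j = Cod E (comp_prod E (comp_prod E p q) r)\<rbrakk> \<Longrightarrow>
      pos_fst p (comp_prod E q r) (pos_map (associator E p q r) j) = pos_fst p q (pos_fst (comp_prod E p q) r j)"
    "\<lbrakk>j \<in> Arr E; Cod E j = Cod E (comp_prod E (comp_prod E p q) r);
      y \<in> Arr E; Cod E y = Dom E p; p \<cdot> y = pos_fst p q (pos_fst (comp_prod E p q) r j)\<rbrakk> \<Longrightarrow>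
      pos_fst q r (pos_app p (comp_prod E q r) (pos_map (associator E p q r) j) y) = pos_app p q (pos_fst (comp_prod E p q) r j) y"
    "\<lbrakk>j \<in> Arr E; Cod E j = Cod E (comp_prod E (comp_prod E p q) r);
      y \<in> Arr E; Cod E y = Dom E p; p \<cdot> y = pos_fst p q (pos_fst (comp_prod E p q) r j);
      z \<in> Arr E; Cod E z = Dom E q; q \<cdot> z = pos_app p q (pos_fst (comp_prod E p q) r j) y\<rbrakk> \<Longrightarrow>
      pos_app q r (pos_app p (comp_prod E q r) (pos_map (associator E p q r) j) y) z =
      pos_app (comp_prod E p q) r j (mk_dir E p q (pos_fst (comp_prod E p q) r j) y z)"
    unfolding pac by simp_all
  define D where "D j d = mk_dir E (comp_prod E p q) r j
        (mk_dir E p q (pos_fst (comp_prod E p q) r j) (dir1 E p (comp_prod E q r) d)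
          (dir1 E q r (dir2 E p (comp_prod E q r) d)))
        (dir2 E q r (dir2 E p (comp_prod E q r) d))" for j d
  have "associator E p q r = Poly_arr (comp_prod E (comp_prod E p q) r) ?t ?c (D (pb1 E ?c ?t) (pb2 E ?c ?t))"
    by (simp add: associator_def assoc_dir_def Let_def pos_fst_def D_def)
  note fam = Poly_arr_of_family[where D = D, OF _ _ _ _ _ _ this]
  show "associator E p q r \<in> Arr (Poly E)" by (rule fam) (simp_all add: D_def)
  show "PROP ?D" unfolding D_def[symmetric] by (rule fam) (simp_all add: D_def)
qed

section \<open>Unitors\<close>

lemma unit_poly [simp]:
  "exponentiable E (unit_poly E)" "Dom E (unit_poly E) = term_obj E" "Cod E (unit_poly E) = term_obj E"
  "y \<in> Arr E \<Longrightarrow> Cod E y = term_obj E \<Longrightarrow> unit_poly E \<cdot> y = y"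
  by (simp_all add: unit_poly_def exponentiable_Ident)

lemma bang_comp [simp]: "t \<in> Arr E \<Longrightarrow> x \<in> Obj E \<Longrightarrow> Cod E t = x \<Longrightarrow> bang E x \<cdot> t = bang E (Dom E t)"
  by (rule term_eq) simp_all

text \<open>This and the next three rules rewrite every component valued in the terminal object to
  \<open>bang\<close>, so that unit components on both sides of a coherence equation become
  identical.\<close>

lemma pos_fst_unit [simp]:
  assumes "exponentiable E q" "k \<in> Arr E" "Cod E k = Cod E (comp_prod E (unit_poly E) q)"
  shows "pos_fst (unit_poly E) q k = bang E (Dom E k)"
  by (rule term_eq) (use assms in simp_all)

lemma pos_app_unit [simp]:
  assumes "exponentiable E p" "k \<in> Arr E" "Cod E k = Cod E (comp_prod E p (unit_poly E))"
    "y \<in> Arr E" "Cod E y = Dom E p" "p \<cdot> y = pos_fst p (unit_poly E) k"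
  shows "pos_app p (unit_poly E) k y = bang E (Dom E k)"
  by (rule term_eq) (use assms in simp_all)

lemma dir1_unit [simp]:
  assumes "exponentiable E q" "d \<in> Arr E" "Cod E d = Dom E (comp_prod E (unit_poly E) q)"
  shows "dir1 E (unit_poly E) q d = bang E (Dom E d)"
  by (rule term_eq) (use assms dirs(1-3)[of "unit_poly E" q d] in simp_all)

lemma dir2_unit [simp]:
  assumes "exponentiable E p" "d \<in> Arr E" "Cod E d = Dom E (comp_prod E p (unit_poly E))"
  shows "dir2 E p (unit_poly E) d = bang E (Dom E d)"
  by (rule term_eq) (use assms dirs(5-7)[of p "unit_poly E" d] in simp_all)

lemma left_unitor_sel [simp]:
  "poly_src (left_unitor E q) = comp_prod E (unit_poly E) q" "poly_tgt (left_unitor E q) = q"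
  by (simp_all add: left_unitor_def Let_def)

lemma left_unitor [simp]:
  assumes [simp]: "exponentiable E q"
  shows "left_unitor E q \<in> Arr (Poly E)"
    "\<lbrakk>k \<in> Arr E; Cod E k = Cod E (comp_prod E (unit_poly E) q)\<rbrakk> \<Longrightarrow>
      pos_map (left_unitor E q) k = pos_app (unit_poly E) q k (bang E (Dom E k))"
    "\<lbrakk>k \<in> Arr E; Cod E k = Cod E (comp_prod E (unit_poly E) q); d \<in> Arr E; Cod E d = Dom E q;
      q \<cdot> d = pos_app (unit_poly E) q k (bang E (Dom E k))\<rbrakk> \<Longrightarrow>
      dir_map (left_unitor E q) k d = mk_dir E (unit_poly E) q k (bang E (Dom E k)) d"
proof -
  let ?u = "unit_poly E"
  note [simp] = cp_typing[of ?u q] cp_Cod[of ?u q, symmetric]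
  define a where "a = Cod E (comp_prod E ?u q)"
  have a [simp]: "a \<in> Obj E" "Cod E (comp_prod E ?u q) = a"
    by (simp_all add: a_def)
  \<comment> \<open>The value of the generic position at the unique direction of the unit. As
    \<open>cp_pos\<close> ends in the terminal object, it is itself that direction.\<close>
  define c where "c = pos_app ?u q (Ident E a) (bang E a)"
  have x0: "cp_pos E ?u q = bang E a"
    by (rule term_eq) simp_all
  have c [simp]: "c \<in> Arr E" "Dom E c = a" "Cod E c = Cod E q"
    by (simp_all add: c_def)
  have ck: "c \<cdot> k = pos_app ?u q k (bang E (Dom E k))" if "k \<in> Arr E" "Cod E k = a" for k
    using that by (simp add: c_def)
  define D where "D k d = mk_dir E ?u q k (bang E (Dom E k)) d" for k d
  have 1: "left_unitor E q = Poly_arr (comp_prod E ?u q) q c (D (pb1 E c q) (pb2 E c q))"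
    by (simp add: left_unitor_def Let_def x0 c_def[unfolded pos_app_def x0, symmetric] D_def)
  note fam = Poly_arr_of_family[where D = D, OF _ _ _ _ _ _ this]
  have 2: "pos_map (left_unitor E q) k = c \<cdot> k" for k by (simp add: 1 pos_map_def)
  show "left_unitor E q \<in> Arr (Poly E)" by (rule fam) (simp_all add: D_def ck)
  show "\<lbrakk>k \<in> Arr E; Cod E k = Cod E (comp_prod E (unit_poly E) q)\<rbrakk> \<Longrightarrow>
      pos_map (left_unitor E q) k = pos_app (unit_poly E) q k (bang E (Dom E k))"
    by (simp add: 2 ck)
  show "\<lbrakk>k \<in> Arr E; Cod E k = Cod E (comp_prod E (unit_poly E) q); d \<in> Arr E; Cod E d = Dom E q;
      q \<cdot> d = pos_app (unit_poly E) q k (bang E (Dom E k))\<rbrakk> \<Longrightarrow>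
      dir_map (left_unitor E q) k d = mk_dir E (unit_poly E) q k (bang E (Dom E k)) d"
    unfolding D_def[symmetric] by (rule fam) (simp_all add: D_def 2 ck)
qed

lemma right_unitor_sel [simp]:
  "poly_src (right_unitor E p) = comp_prod E p (unit_poly E)" "poly_tgt (right_unitor E p) = p"
  by (simp_all add: right_unitor_def Let_def)

lemma right_unitor [simp]:
  assumes [simp]: "exponentiable E p"
  shows "right_unitor E p \<in> Arr (Poly E)"
    "pos_map (right_unitor E p) k = pos_fst p (unit_poly E) k"
    "\<lbrakk>k \<in> Arr E; Cod E k = Cod E (comp_prod E p (unit_poly E)); d \<in> Arr E; Cod E d = Dom E p;
      p \<cdot> d = pos_fst p (unit_poly E) k\<rbrakk> \<Longrightarrow>
      dir_map (right_unitor E p) k d = mk_dir E p (unit_poly E) k d (bang E (Dom E k))"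
proof -
  let ?u = "unit_poly E"
  let ?c = "cp_pos E p ?u"
  note [simp] = cp_typing[of p ?u] and C = cp_Cod[of p ?u]
  define D where "D k d = mk_dir E p ?u k d (bang E (Dom E k))" for k d
  have 1: "right_unitor E p = Poly_arr (comp_prod E p ?u) p ?c (D (pb1 E ?c p) (pb2 E ?c p))"
    by (simp add: right_unitor_def Let_def D_def)
  note fam = Poly_arr_of_family[where D = D, OF _ _ _ _ _ _ this]
  have c: "?c \<cdot> k = pos_fst p ?u k" for k by (simp add: pos_fst_def)
  show pos_map: "pos_map (right_unitor E p) k = pos_fst p (unit_poly E) k" for k
    by (simp add: pos_map_def c right_unitor_def Let_def)
  show "right_unitor E p \<in> Arr (Poly E)" by (rule fam) (simp_all add: D_def c C)
  show "\<lbrakk>k \<in> Arr E; Cod E k = Cod E (comp_prod E p (unit_poly E)); d \<in> Arr E; Cod E d = Dom E p;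
      p \<cdot> d = pos_fst p (unit_poly E) k\<rbrakk> \<Longrightarrow>
      dir_map (right_unitor E p) k d = mk_dir E p (unit_poly E) k d (bang E (Dom E k))"
    unfolding D_def[symmetric] by (rule fam) (simp_all add: D_def c C pos_map)
qed

section \<open>Coherence\<close>

lemma left_unitor_natural:
  assumes [simp]: "f \<in> Arr (Poly E)"
  shows "left_unitor E (poly_tgt f) \<cdot>\<^bsub>Poly E\<^esub> comp_prod_arr E (Ident (Poly E) (unit_poly E)) f =
    f \<cdot>\<^bsub>Poly E\<^esub> left_unitor E (poly_src f)"
  by (rule poly_eqI) simp_all

lemma right_unitor_natural:
  assumes [simp]: "f \<in> Arr (Poly E)"
  shows "right_unitor E (poly_tgt f) \<cdot>\<^bsub>Poly E\<^esub> comp_prod_arr E f (Ident (Poly E) (unit_poly E)) =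
    f \<cdot>\<^bsub>Poly E\<^esub> right_unitor E (poly_src f)"
  by (rule poly_eqI) simp_all

lemma triangle:
  assumes [simp]: "exponentiable E a" "exponentiable E b"
  shows "comp_prod_arr E (Ident (Poly E) a) (left_unitor E b) \<cdot>\<^bsub>Poly E\<^esub> associator E a (unit_poly E) b =
    comp_prod_arr E (right_unitor E a) (Ident (Poly E) b)" (is "?l = ?r")
proof (rule poly_eqI)
  fix x assume "x \<in> Arr E" "Cod E x = Cod E (poly_src ?r)"
  then show "pos_map ?l x = pos_map ?r x"
    by - (rule pos_eqI[of a b], simp_all)
qed simp_all

text \<open>On directions, the components on both sides are named one at a time; fully expanded terms would
  make the conditional rewrite rules recheck the same side conditions exponentially often.\<close>

lemma assoc_natural:
  assumes [simp]: "f \<in> Arr (Poly E)" "g \<in> Arr (Poly E)" "h \<in> Arr (Poly E)"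
    and st [simp]: "poly_src f = p" "poly_tgt f = p'" "poly_src g = q" "poly_tgt g = q'"
      "poly_src h = r" "poly_tgt h = r'"
  shows "associator E p' q' r' \<cdot>\<^bsub>Poly E\<^esub> comp_prod_arr E (comp_prod_arr E f g) h =
    comp_prod_arr E f (comp_prod_arr E g h) \<cdot>\<^bsub>Poly E\<^esub> associator E p q r"
    (is "?l = ?r")
proof -
  have ex [simp]: "exponentiable E p" "exponentiable E p'" "exponentiable E q" "exponentiable E q'"
    "exponentiable E r" "exponentiable E r'"
    using Poly_exp[of f] Poly_exp[of g] Poly_exp[of h] by simp_all
  show ?thesis
  proof (rule poly_eqI)
    fix x assume "x \<in> Arr E" "Cod E x = Cod E (poly_src ?r)"
    then show "pos_map ?l x = pos_map ?r x"
      by - (rule pos_eqI2[of p' q' r'], simp_all)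
  next
    fix x w assume x: "x \<in> Arr E" "Cod E x = Cod E (poly_src ?r)" "w \<in> Arr E" "Cod E w = Dom E (poly_tgt ?r)"
      "Dom E w = Dom E x" and wr: "poly_tgt ?r \<cdot> w = pos_map ?r x" and lr: "pos_map ?l x = pos_map ?r x"
    define s where "s = comp_prod E p q"
    define s' where "s' = comp_prod E p' q'"
    define T where "T = comp_prod_arr E f g"
    define U where "U = comp_prod_arr E g h"
    have x [simp]: "x \<in> Arr E" "Cod E x = Cod E (comp_prod E s r)" "w \<in> Arr E"
      "Cod E w = Dom E (comp_prod E p' (comp_prod E q' r'))" "Dom E w = Dom E x"
      using x by (simp_all add: s_def)
    have T [simp]: "T \<in> Arr (Poly E)" "poly_src T = s" "poly_tgt T = s'"
      "U \<in> Arr (Poly E)" "poly_src U = comp_prod E q r" "poly_tgt U = comp_prod E q' r'"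
      "exponentiable E s" "exponentiable E s'"
      by (simp_all add: T_def U_def s_def s'_def)
    define \<alpha> where "\<alpha> = associator E p q r"
    define \<alpha>' where "\<alpha>' = associator E p' q' r'"
    note al [simp] = assoc(1)[OF ex(1,3,5), folded \<alpha>_def s_def]
      assoc_sel[of p q r, folded \<alpha>_def s_def] assoc(1)[OF ex(2,4,6), folded \<alpha>'_def s'_def]
      assoc_sel[of p' q' r', folded \<alpha>'_def s'_def]
    define i where "i = pos_map \<alpha> x"
    define j where "j = pos_map (comp_prod_arr E T h) x"
    define k where "k = pos_fst s r x"
    define x0 where "x0 = pos_fst p q k"
    define k' where "k' = pos_map T k"
    have i [simp]: "i \<in> Arr E" "Dom E i = Dom E x" "Cod E i = Cod E (comp_prod E p (comp_prod E q r))"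
      "pos_fst p (comp_prod E q r) i = x0"
      using assoc(2)[OF ex(1,3,5), folded s_def \<alpha>_def, of x] by (simp_all add: i_def x0_def k_def)
    have j [simp]: "j \<in> Arr E" "Dom E j = Dom E x" "Cod E j = Cod E (comp_prod E s' r')" "pos_fst s' r' j = k'"
      by (simp_all add: j_def k'_def k_def)
    have k [simp]: "k \<in> Arr E" "Dom E k = Dom E x" "Cod E k = Cod E s" "pos_fst p q k = x0"
      by (simp_all add: k_def x0_def)
    have ks [simp]: "Cod E (comp_prod E p q) = Cod E s" "Dom E (comp_prod E p q) = Dom E s"
      "Cod E (comp_prod E p' q') = Cod E s'" "Dom E (comp_prod E p' q') = Dom E s'"
      by (simp_all add: s_def s'_def)
    have x0 [simp]: "x0 \<in> Arr E" "Dom E x0 = Dom E x" "Cod E x0 = Cod E p"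
      using pos_fst[of p q k] by simp_all
    have k' [simp]: "k' \<in> Arr E" "Dom E k' = Dom E x" "Cod E k' = Cod E s'" "pos_fst p' q' k' = pos_map f x0"
      by (simp_all add: k'_def) (simp add: T_def)
    \<comment> \<open>\<open>w\<close> is given as a direction for the right-hand composite;
      \<open>wl\<close> makes it one for the left-hand composite.\<close>
    have wr': "comp_prod E p' (comp_prod E q' r') \<cdot> w = pos_map (comp_prod_arr E f U) i"
      using wr by (simp add: U_def i_def \<alpha>_def s_def)
    have wl: "pos_map (comp_prod_arr E f U) i = pos_map \<alpha>' j"
      using lr by (simp add: U_def T_def i_def j_def \<alpha>_def \<alpha>'_def s_def)
    \<comment> \<open>Here \<open>w\<close> is \<open>(y, (z, w'))\<close>. The names
      \<open>Y\<close>, \<open>Z\<close>, \<open>W\<close> stand for the images of \<open>y\<close>,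
      \<open>z\<close>, \<open>w'\<close> under the direction maps of \<open>f\<close>,
      \<open>g\<close>, \<open>h\<close>.\<close>
    define y where "y = dir1 E p' (comp_prod E q' r') w"
    define v where "v = dir2 E p' (comp_prod E q' r') w"
    have y [simp]: "y \<in> Arr E" "Dom E y = Dom E x" "Cod E y = Dom E p'" "p' \<cdot> y = pos_map f x0"
      by (simp_all add: y_def wr')
    define Y where "Y = dir_map f x0 y"
    have Y [simp]: "Y \<in> Arr E" "Dom E Y = Dom E x" "Cod E Y = Dom E p" "p \<cdot> Y = x0"
      by (simp_all add: Y_def)
    define b where "b = pos_app p (comp_prod E q r) i Y"
    define c where "c = pos_app p q k Y"
    have c [simp]: "c \<in> Arr E" "Dom E c = Dom E x" "Cod E c = Cod E q"
      by (simp_all add: c_def)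
    have b [simp]: "b \<in> Arr E" "Dom E b = Dom E x" "Cod E b = Cod E (comp_prod E q r)" "pos_fst q r b = c"
      using assoc(3)[OF ex(1,3,5), folded s_def \<alpha>_def, of x Y]
      by (simp_all add: b_def c_def i_def[symmetric] k_def[symmetric])
    have v [simp]: "v \<in> Arr E" "Dom E v = Dom E x" "Cod E v = Dom E (comp_prod E q' r')"
      "comp_prod E q' r' \<cdot> v = pos_map U b"
      by (simp_all add: v_def wr' y_def[symmetric] Y_def[symmetric] b_def)
    define z where "z = dir1 E q' r' v"
    define w' where "w' = dir2 E q' r' v"
    have z [simp]: "z \<in> Arr E" "Dom E z = Dom E x" "Cod E z = Dom E q'" "q' \<cdot> z = pos_map g c"
      by (simp_all add: z_def) (simp add: U_def)
    define Z where "Z = dir_map g c z"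
    have Z [simp]: "Z \<in> Arr E" "Dom E Z = Dom E x" "Cod E Z = Dom E q" "q \<cdot> Z = c"
      by (simp_all add: Z_def)
    define A where "A = mk_dir E p q k Y Z"
    have A [simp]: "A \<in> Arr E" "Dom E A = Dom E x" "Cod E A = Dom E s" "s \<cdot> A = k"
      using mk_dir(1-4)[of p q k Y Z, folded s_def] by (simp_all add: A_def c_def[symmetric])
    define l where "l = pos_app s r x A"
    have l [simp]: "l \<in> Arr E" "Dom E l = Dom E x" "Cod E l = Cod E r"
      by (simp_all add: l_def k_def[symmetric])
    \<comment> \<open>Currying on positions: evaluating \<open>b\<close> at \<open>Z\<close> is
      evaluating \<open>x\<close> at the pair \<open>A\<close>.\<close>
    have bl [simp]: "pos_app q r b Z = l"
      using assoc(4)[OF ex(1,3,5), folded s_def \<alpha>_def, of x Y Z]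
      by (simp add: b_def c_def[symmetric] i_def[symmetric] k_def[symmetric] l_def A_def)
    have w' [simp]: "w' \<in> Arr E" "Dom E w' = Dom E x" "Cod E w' = Dom E r'" "r' \<cdot> w' = pos_map h l"
      by (simp_all add: w'_def z_def[symmetric])
        (simp add: U_def Z_def[symmetric])
    define W where "W = dir_map h l w'"
    have W [simp]: "W \<in> Arr E" "Dom E W = Dom E x" "Cod E W = Dom E r" "r \<cdot> W = l"
      by (simp_all add: W_def)
    define M where "M = mk_dir E p' q' k' y z"
    have ak: "pos_app p' q' k' y = pos_map g c"
      unfolding k'_def T_def by (simp add: Y_def[symmetric] c_def)
    have M [simp]: "M \<in> Arr E" "Dom E M = Dom E x" "Cod E M = Dom E s'" "s' \<cdot> M = k'"
      "dir1 E p' q' M = y" "dir2 E p' q' M = z"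
      using mk_dir(1-6)[of p' q' k' y z, folded s'_def] by (simp_all add: M_def ak)
    have TM: "dir_map T k M = A"
      using tensor(4)[of f g p p' q q' k M, folded T_def s'_def] by (simp add: Y_def[symmetric] c_def[symmetric] Z_def[symmetric] A_def k'_def)
    have aj: "pos_app s' r' j M = pos_map h l"
      unfolding j_def by (simp add: k_def[symmetric] TM k'_def[symmetric] l_def)
    define d where "d = mk_dir E s' r' j M w'"
    have d [simp]: "d \<in> Arr E" "Dom E d = Dom E x" "Cod E d = Dom E (comp_prod E s' r')"
      "comp_prod E s' r' \<cdot> d = j" "dir1 E s' r' d = M" "dir2 E s' r' d = w'"
      by (simp_all add: d_def aj)
    \<comment> \<open>\<open>1\<close> and \<open>2\<close> follow the left-hand composite,
      \<open>3\<close> and \<open>4\<close> the right-hand one, each against the order of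
      composition; both end in \<open>((Y, Z), W)\<close>.\<close>
    have 1: "dir_map \<alpha>' j w = d"
      using assoc(5)[OF ex(2,4,6), folded s'_def \<alpha>'_def, of j w]
      by (simp add: wr' wl y_def[symmetric] v_def[symmetric] z_def[symmetric] w'_def[symmetric] M_def d_def)
    have 2: "dir_map (comp_prod_arr E T h) x d = mk_dir E s r x A W"
      using d(4) unfolding j_def by (simp add: k_def[symmetric] TM l_def[symmetric] W_def)
    define V where "V = mk_dir E q r b Z W"
    have V [simp]: "V \<in> Arr E" "Dom E V = Dom E x" "Cod E V = Dom E (comp_prod E q r)" "comp_prod E q r \<cdot> V = b"
      "dir1 E q r V = Z" "dir2 E q r V = W"
      by (simp_all add: V_def)
    have Uv: "dir_map U b v = V"
      using v(4) unfolding U_def by (simp add: z_def[symmetric] w'_def[symmetric] Z_def[symmetric] W_def[symmetric] V_def)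
    define e where "e = mk_dir E p (comp_prod E q r) i Y V"
    have e [simp]: "e \<in> Arr E" "Dom E e = Dom E x" "Cod E e = Dom E (comp_prod E p (comp_prod E q r))"
      "comp_prod E p (comp_prod E q r) \<cdot> e = i" "dir1 E p (comp_prod E q r) e = Y" "dir2 E p (comp_prod E q r) e = V"
      by (simp_all add: e_def b_def[symmetric])
    have 3: "dir_map (comp_prod_arr E f U) i w = e"
      using wr' by (simp add: y_def[symmetric] v_def[symmetric] Y_def[symmetric] b_def[symmetric] Uv e_def)
    have 4: "dir_map \<alpha> x e = mk_dir E s r x A W"
      using assoc(5)[OF ex(1,3,5), folded s_def \<alpha>_def, of x e]
      by (simp add: i_def[symmetric] k_def[symmetric] A_def)
    have "dir_map ?l x w = dir_map (comp_prod_arr E T h) x (dir_map \<alpha>' j w)"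
      unfolding T_def[symmetric] \<alpha>'_def[symmetric] j_def
      using wr' wl by (simp add: j_def)
    moreover have "dir_map ?r x w = dir_map \<alpha> x (dir_map (comp_prod_arr E f U) i w)"
      unfolding U_def[symmetric] \<alpha>_def[symmetric] i_def
      using wr' by (simp add: i_def)
    ultimately show "dir_map ?l x w = dir_map ?r x w" by (simp add: 1 2 3 4)
  qed simp_all
qed

text \<open>Both composites rebracket a direction \<open>(y, (z, (w, t)))\<close> to
  \<open>(((y, z), w), t)\<close>. The effort lies in checking that each intermediate bracketing is
  a direction at the right position, that is, that the values \<open>f1\<close>, \<open>f2\<close>,
  \<open>f3\<close> come out the same along both paths.\<close>

lemma pentagon:
  assumes [simp]: "exponentiable E a" "exponentiable E b" "exponentiable E c" "exponentiable E d"
  shows "associator E a b (comp_prod E c d) \<cdot>\<^bsub>Poly E\<^esub> associator E (comp_prod E a b) c d =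
    comp_prod_arr E (Ident (Poly E) a) (associator E b c d) \<cdot>\<^bsub>Poly E\<^esub>
      associator E a (comp_prod E b c) d \<cdot>\<^bsub>Poly E\<^esub> comp_prod_arr E (associator E a b c) (Ident (Poly E) d)"
    (is "?l = ?r")
proof (rule poly_eqI)
  fix x assume "x \<in> Arr E" "Cod E x = Cod E (poly_src ?r)"
  then show "pos_map ?l x = pos_map ?r x"
    by - (rule pos_eqI3[of a b c d], simp_all)
next
  fix x e assume x: "x \<in> Arr E" "Cod E x = Cod E (poly_src ?r)" "e \<in> Arr E" "Cod E e = Dom E (poly_tgt ?r)"
    "Dom E e = Dom E x" and er: "poly_tgt ?r \<cdot> e = pos_map ?r x" and lr: "pos_map ?l x = pos_map ?r x"
  let ?ab = "comp_prod E a b" let ?bc = "comp_prod E b c" let ?cd = "comp_prod E c d"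
  let ?S = "comp_prod E ?ab c" let ?R = "comp_prod E a ?bc" let ?Q = "comp_prod E b ?cd"
  let ?P = "comp_prod E ?bc d"
  have x [simp]: "x \<in> Arr E" "Cod E x = Cod E (comp_prod E ?S d)" "e \<in> Arr E"
    "Cod E e = Dom E (comp_prod E a ?Q)" "Dom E e = Dom E x"
    using x by simp_all
  define \<alpha>1 where "\<alpha>1 = associator E ?ab c d"
  define \<alpha>2 where "\<alpha>2 = associator E a b ?cd"
  define \<alpha>3 where "\<alpha>3 = associator E a b c"
  define \<alpha>4 where "\<alpha>4 = associator E a ?bc d"
  define \<alpha>5 where "\<alpha>5 = associator E b c d"
  define T where "T = comp_prod_arr E \<alpha>3 (Ident (Poly E) d)"
  define U where "U = comp_prod_arr E (Ident (Poly E) a) \<alpha>5"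
  have al [simp]: "\<alpha>1 \<in> Arr (Poly E)" "poly_src \<alpha>1 = comp_prod E ?S d" "poly_tgt \<alpha>1 = comp_prod E ?ab ?cd"
    "\<alpha>2 \<in> Arr (Poly E)" "poly_src \<alpha>2 = comp_prod E ?ab ?cd" "poly_tgt \<alpha>2 = comp_prod E a ?Q"
    "\<alpha>3 \<in> Arr (Poly E)" "poly_src \<alpha>3 = ?S" "poly_tgt \<alpha>3 = ?R"
    "\<alpha>4 \<in> Arr (Poly E)" "poly_src \<alpha>4 = comp_prod E ?R d" "poly_tgt \<alpha>4 = comp_prod E a ?P"
    "\<alpha>5 \<in> Arr (Poly E)" "poly_src \<alpha>5 = ?P" "poly_tgt \<alpha>5 = ?Q"
    by (simp_all add: \<alpha>1_def \<alpha>2_def \<alpha>3_def \<alpha>4_def \<alpha>5_def)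
  have TU [simp]: "T \<in> Arr (Poly E)" "poly_src T = comp_prod E ?S d" "poly_tgt T = comp_prod E ?R d"
    "U \<in> Arr (Poly E)" "poly_src U = comp_prod E a ?P" "poly_tgt U = comp_prod E a ?Q"
    by (simp_all add: T_def U_def)
  \<comment> \<open>The first components of the four-fold position, stripped from the outside
    in.\<close>
  define k2 where "k2 = pos_fst ?S d x"
  define k1 where "k1 = pos_fst ?ab c k2"
  define x0 where "x0 = pos_fst a b k1"
  have k2 [simp]: "k2 \<in> Arr E" "Dom E k2 = Dom E x" "Cod E k2 = Cod E ?S" "pos_fst ?S d x = k2" by (simp_all add: k2_def)
  have k1 [simp]: "k1 \<in> Arr E" "Dom E k1 = Dom E x" "Cod E k1 = Cod E ?ab" "pos_fst ?ab c k2 = k1" by (simp_all add: k1_def)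
  have x0 [simp]: "x0 \<in> Arr E" "Dom E x0 = Dom E x" "Cod E x0 = Cod E a" "pos_fst a b k1 = x0" by (simp_all add: x0_def)
  \<comment> \<open>\<open>i\<close> is the intermediate position on the left-hand path;
    \<open>n\<close> and \<open>j\<close> are those on the right-hand path, with \<open>m\<close>
    the first component of \<open>n\<close>.\<close>
  define i where "i = pos_map \<alpha>1 x"
  define m where "m = pos_map \<alpha>3 k2"
  define n where "n = pos_map T x"
  define j where "j = pos_map \<alpha>4 n"
  have i [simp]: "i \<in> Arr E" "Dom E i = Dom E x" "Cod E i = Cod E (comp_prod E ?ab ?cd)" "pos_fst ?ab ?cd i = k1"
    by (simp_all add: i_def) (simp add: \<alpha>1_def)
  have m [simp]: "m \<in> Arr E" "Dom E m = Dom E x" "Cod E m = Cod E ?R" "pos_fst a ?bc m = x0"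
    by (simp_all add: m_def) (simp add: \<alpha>3_def)
  have n [simp]: "n \<in> Arr E" "Dom E n = Dom E x" "Cod E n = Cod E (comp_prod E ?R d)" "pos_fst ?R d n = m"
    by (simp_all add: n_def) (simp add: T_def m_def)
  have j [simp]: "j \<in> Arr E" "Dom E j = Dom E x" "Cod E j = Cod E (comp_prod E a ?P)" "pos_fst a ?P j = x0"
    by (simp_all add: j_def) (simp add: \<alpha>4_def)
  have er': "comp_prod E a ?Q \<cdot> e = pos_map U j"
    using er by (simp add: U_def T_def j_def n_def \<alpha>3_def \<alpha>4_def \<alpha>5_def)
  have wl: "pos_map U j = pos_map \<alpha>2 i"
    using lr by (simp add: U_def T_def j_def n_def i_def \<alpha>1_def \<alpha>2_def \<alpha>3_def \<alpha>4_def \<alpha>5_def)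
  define y v where "y = dir1 E a ?Q e" and "v = dir2 E a ?Q e"
  have y [simp]: "y \<in> Arr E" "Dom E y = Dom E x" "Cod E y = Dom E a" "a \<cdot> y = x0"
    by (simp_all add: y_def er' wl) (simp add: \<alpha>2_def)
  define f1 where "f1 = pos_app a b k1 y"
  define g1 where "g1 = pos_app a ?bc m y"
  define h1 where "h1 = pos_app a ?P j y"
  define l1 where "l1 = pos_app a ?Q (pos_map \<alpha>2 i) y"
  have f1 [simp]: "f1 \<in> Arr E" "Dom E f1 = Dom E x" "Cod E f1 = Cod E b" by (simp_all add: f1_def)
  have g1 [simp]: "g1 \<in> Arr E" "Dom E g1 = Dom E x" "Cod E g1 = Cod E ?bc" "pos_fst b c g1 = f1"
    by (simp_all add: g1_def) (simp add: m_def \<alpha>3_def f1_def)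
  have h1 [simp]: "h1 \<in> Arr E" "Dom E h1 = Dom E x" "Cod E h1 = Cod E ?P" "pos_fst ?bc d h1 = g1"
    by (simp_all add: h1_def) (simp add: j_def \<alpha>4_def g1_def)
  have f2i: "pos_fst a ?Q (pos_map \<alpha>2 i) = x0" by (simp add: \<alpha>2_def)
  have l1 [simp]: "l1 \<in> Arr E" "Dom E l1 = Dom E x" "Cod E l1 = Cod E ?Q" "pos_fst b ?cd l1 = f1"
    by (simp_all add: l1_def f2i) (simp add: \<alpha>2_def f1_def)
  have l1h: "l1 = pos_map \<alpha>5 h1"
    unfolding l1_def wl[symmetric] U_def by (simp add: h1_def)
  have v [simp]: "v \<in> Arr E" "Dom E v = Dom E x" "Cod E v = Dom E ?Q" "?Q \<cdot> v = l1"
    by (simp_all add: v_def er' wl y_def[symmetric] l1_def)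
  define z u where "z = dir1 E b ?cd v" and "u = dir2 E b ?cd v"
  have z [simp]: "z \<in> Arr E" "Dom E z = Dom E x" "Cod E z = Dom E b" "b \<cdot> z = f1"
    by (simp_all add: z_def)
  \<comment> \<open>\<open>M\<close> is \<open>(y, z)\<close>; below, \<open>K\<close> is
    \<open>((y, z), w)\<close>, \<open>N\<close> is \<open>(z, w)\<close> and \<open>L\<close> is
    \<open>(y, (z, w))\<close>.\<close>
  define M where "M = mk_dir E a b k1 y z"
  have M [simp]: "M \<in> Arr E" "Dom E M = Dom E x" "Cod E M = Dom E ?ab" "?ab \<cdot> M = k1"
    by (simp_all add: M_def f1_def[symmetric])
  define l2 where "l2 = pos_app ?ab ?cd i M"
  define f2 where "f2 = pos_app ?ab c k2 M"
  have f2 [simp]: "f2 \<in> Arr E" "Dom E f2 = Dom E x" "Cod E f2 = Cod E c" by (simp_all add: f2_def)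
  have l2 [simp]: "l2 \<in> Arr E" "Dom E l2 = Dom E x" "Cod E l2 = Cod E ?cd" "pos_fst c d l2 = f2"
    by (simp_all add: l2_def) (simp add: i_def \<alpha>1_def f2_def)
  have u [simp]: "u \<in> Arr E" "Dom E u = Dom E x" "Cod E u = Dom E ?cd" "?cd \<cdot> u = l2"
    by (simp_all add: u_def z_def[symmetric])
      (simp add: l1_def \<alpha>2_def f1_def[symmetric] l2_def M_def)
  define w t where "w = dir1 E c d u" and "t = dir2 E c d u"
  have w [simp]: "w \<in> Arr E" "Dom E w = Dom E x" "Cod E w = Dom E c" "c \<cdot> w = f2"
    by (simp_all add: w_def)
  define K where "K = mk_dir E ?ab c k2 M w"
  have K [simp]: "K \<in> Arr E" "Dom E K = Dom E x" "Cod E K = Dom E ?S" "?S \<cdot> K = k2"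
    by (simp_all add: K_def f2_def[symmetric])
  define f3 where "f3 = pos_app ?S d x K"
  have f3 [simp]: "f3 \<in> Arr E" "Dom E f3 = Dom E x" "Cod E f3 = Cod E d" by (simp_all add: f3_def)
  have t [simp]: "t \<in> Arr E" "Dom E t = Dom E x" "Cod E t = Dom E d" "d \<cdot> t = f3"
    by (simp_all add: t_def w_def[symmetric])
      (simp add: l2_def i_def \<alpha>1_def f2_def[symmetric] f3_def K_def)
  define B where "B = mk_dir E ?ab ?cd i M u"
  have B [simp]: "B \<in> Arr E" "Dom E B = Dom E x" "Cod E B = Dom E (comp_prod E ?ab ?cd)"
    "comp_prod E ?ab ?cd \<cdot> B = i" "dir1 E ?ab ?cd B = M" "dir2 E ?ab ?cd B = u"
    by (simp_all add: B_def l2_def[symmetric])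
  have 1: "dir_map \<alpha>2 i e = B"
    using er' unfolding wl unfolding \<alpha>2_def
    by (simp add: y_def[symmetric] v_def[symmetric] z_def[symmetric] u_def[symmetric] M_def B_def)
  have 2: "dir_map \<alpha>1 x B = mk_dir E ?S d x K t"
    using B(4) unfolding i_def unfolding \<alpha>1_def by (simp add: w_def[symmetric] t_def[symmetric] K_def)
  define N where "N = mk_dir E b c g1 z w"
  \<comment> \<open>The values \<open>f2\<close> here and \<open>f3\<close> in \<open>nL\<close> and
    \<open>h1N\<close> reappear at rebracketed directions; this makes \<open>N\<close>,
    \<open>C\<close> and \<open>G\<close> well formed.\<close>
  have g1z: "pos_app b c g1 z = f2"
    by (simp add: g1_def m_def \<alpha>3_def f1_def[symmetric] f2_def M_def)
  have N [simp]: "N \<in> Arr E" "Dom E N = Dom E x" "Cod E N = Dom E ?bc" "?bc \<cdot> N = g1"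
    "dir1 E b c N = z" "dir2 E b c N = w"
    by (simp_all add: N_def g1z)
  define L where "L = mk_dir E a ?bc m y N"
  have L [simp]: "L \<in> Arr E" "Dom E L = Dom E x" "Cod E L = Dom E ?R" "?R \<cdot> L = m"
    "dir1 E a ?bc L = y" "dir2 E a ?bc L = N"
    by (simp_all add: L_def g1_def[symmetric])
  have KL: "dir_map \<alpha>3 k2 L = K"
    using L(4) unfolding m_def unfolding \<alpha>3_def by (simp add: M_def K_def)
  have nL: "pos_app ?R d n L = f3"
    by (simp add: n_def T_def m_def[symmetric] KL f3_def)
  have h1N: "pos_app ?bc d h1 N = f3"
    using nL by (simp add: h1_def j_def \<alpha>4_def g1_def[symmetric] L_def)
  define G where "G = mk_dir E ?bc d h1 N t"
  have G [simp]: "G \<in> Arr E" "Dom E G = Dom E x" "Cod E G = Dom E ?P" "?P \<cdot> G = h1"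
    "dir1 E ?bc d G = N" "dir2 E ?bc d G = t"
    by (simp_all add: G_def h1N)
  have vG: "dir_map \<alpha>5 h1 v = G"
    using v(4) unfolding l1h unfolding \<alpha>5_def
    by (simp add: z_def[symmetric] u_def[symmetric] w_def[symmetric] t_def[symmetric] N_def G_def)
  define H where "H = mk_dir E a ?P j y G"
  have H [simp]: "H \<in> Arr E" "Dom E H = Dom E x" "Cod E H = Dom E (comp_prod E a ?P)" "comp_prod E a ?P \<cdot> H = j"
    "dir1 E a ?P H = y" "dir2 E a ?P H = G"
    by (simp_all add: H_def h1_def[symmetric])
  have 3: "dir_map U j e = H"
    using er' unfolding U_def by (simp add: y_def[symmetric] v_def[symmetric] h1_def[symmetric] vG H_def)
  define C where "C = mk_dir E ?R d n L t"
  have C [simp]: "C \<in> Arr E" "Dom E C = Dom E x" "Cod E C = Dom E (comp_prod E ?R d)" "comp_prod E ?R d \<cdot> C = n"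
    "dir1 E ?R d C = L" "dir2 E ?R d C = t"
    by (simp_all add: C_def nL)
  have 4: "dir_map \<alpha>4 n H = C"
    using H(4) unfolding j_def unfolding \<alpha>4_def by (simp add: L_def C_def)
  have 5: "dir_map T x C = mk_dir E ?S d x K t"
    using C(4) unfolding n_def unfolding T_def by (simp add: KL f3_def[symmetric])
  have "dir_map ?l x e = dir_map \<alpha>1 x (dir_map \<alpha>2 i e)"
    unfolding \<alpha>1_def[symmetric] \<alpha>2_def[symmetric] using er' wl by (simp add: i_def)
  moreover have "dir_map ?r x e = dir_map T x (dir_map \<alpha>4 n (dir_map U j e))"
    unfolding \<alpha>3_def[symmetric] \<alpha>4_def[symmetric] \<alpha>5_def[symmetric] U_def[symmetric] T_def[symmetric]
    using er' by (simp add: j_def n_def)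
  ultimately show "dir_map ?l x e = dir_map ?r x e" by (simp add: 1 2 3 4 5)
qed simp_all

section \<open>Invertibility\<close>

lemma left_unitor_iso:
  assumes [simp]: "exponentiable E q"
  shows "is_iso (Poly E) (left_unitor E q)"
proof (rule Poly_isoI)
  let ?u = "unit_poly E"
  fix x x' assume [simp]: "x \<in> Arr E" "x' \<in> Arr E" "Dom E x = Dom E x'"
    "Cod E x = Cod E (poly_src (left_unitor E q))" "Cod E x' = Cod E (poly_src (left_unitor E q))"
    and eq: "pos_map (left_unitor E q) x = pos_map (left_unitor E q) x'"
  show "x = x'"
  proof (rule pos_eqI[of ?u q])
    fix t y assume t: "t \<in> Arr E" "Cod E t = Dom E x'" "y \<in> Arr E" "Cod E y = Dom E ?u" "?u \<cdot> y = pos_fst ?u q (x' \<cdot> t)"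
    then have "y = bang E (Dom E t)" by simp
    then show "pos_app ?u q (x \<cdot> t) y = pos_app ?u q (x' \<cdot> t) y"
      using arg_cong[OF eq, of "\<lambda>a. a \<cdot> t"] t(1,2) by simp
  qed simp_all
next
  let ?u = "unit_poly E"
  fix x' assume x' [simp]: "x' \<in> Arr E" "Cod E x' = Cod E (poly_tgt (left_unitor E q))"
  let ?b = "bang E (Dom E x')"
  \<comment> \<open>The position whose function part is constantly \<open>x'\<close>, ignoring the
    direction of the unit.\<close>
  let ?x = "mk_pos E ?u q ?b (x' \<cdot> pb1 E ?b ?u)"
  have "pos_app ?u q (?x \<cdot> Ident E (Dom E x')) ?b = (x' \<cdot> pb1 E ?b ?u) \<cdot> pb_pair E ?b ?u (Ident E (Dom E x')) ?b"
    by (rule mk_pos) simp_all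
  then have "pos_map (left_unitor E q) ?x = x'" by simp
  then show "\<exists>x\<in>Arr E. Cod E x = Cod E (poly_src (left_unitor E q)) \<and> pos_map (left_unitor E q) x = x'"
    by (intro bexI[of _ ?x]) simp_all
next
  let ?u = "unit_poly E"
  fix x w w' assume x: "x \<in> Arr E" "Cod E x = Cod E (poly_src (left_unitor E q))" "w \<in> Arr E"
    "Cod E w = Dom E (poly_tgt (left_unitor E q))" "w' \<in> Arr E" "Cod E w' = Dom E (poly_tgt (left_unitor E q))"
    "Dom E w = Dom E x" "Dom E w' = Dom E x"
    "poly_tgt (left_unitor E q) \<cdot> w = pos_map (left_unitor E q) x" "poly_tgt (left_unitor E q) \<cdot> w' = pos_map (left_unitor E q) x"
    and eq: "dir_map (left_unitor E q) x w = dir_map (left_unitor E q) x w'"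
  show "w = w'"
    using arg_cong[OF eq, of "dir2 E ?u q"] x by simp
next
  let ?u = "unit_poly E"
  fix x y assume x: "x \<in> Arr E" "Cod E x = Cod E (poly_src (left_unitor E q))" "y \<in> Arr E"
    "Cod E y = Dom E (poly_src (left_unitor E q))" "Dom E y = Dom E x" "poly_src (left_unitor E q) \<cdot> y = x"
  then have "dir_map (left_unitor E q) x (dir2 E ?u q y) = y"
    by - (rule dir_eqI[of ?u q], simp_all)
  then show "\<exists>w\<in>Arr E. Cod E w = Dom E (poly_tgt (left_unitor E q)) \<and>
      poly_tgt (left_unitor E q) \<cdot> w = pos_map (left_unitor E q) x \<and> dir_map (left_unitor E q) x w = y"
    using x by (intro bexI[of _ "dir2 E ?u q y"]) simp_all
qed simp

lemma right_unitor_iso: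
  assumes [simp]: "exponentiable E p"
  shows "is_iso (Poly E) (right_unitor E p)"
proof (rule Poly_isoI)
  let ?u = "unit_poly E"
  fix x x' assume [simp]: "x \<in> Arr E" "x' \<in> Arr E" "Dom E x = Dom E x'"
    "Cod E x = Cod E (poly_src (right_unitor E p))" "Cod E x' = Cod E (poly_src (right_unitor E p))"
    and eq: "pos_map (right_unitor E p) x = pos_map (right_unitor E p) x'"
  \<comment> \<open>Function parts end in the terminal object, so only first components have to be
    compared, at every stage.\<close>
  have "pos_fst p ?u (x \<cdot> t) = pos_fst p ?u (x' \<cdot> t)" if "t \<in> Arr E" "Cod E t = Dom E x'" for t
    using arg_cong[OF eq, of "\<lambda>a. a \<cdot> t"] that by simp
  then show "x = x'"
    by - (rule pos_eqI[of p ?u], use eq in simp_all)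
next
  let ?u = "unit_poly E"
  fix x' assume [simp]: "x' \<in> Arr E" "Cod E x' = Cod E (poly_tgt (right_unitor E p))"
  show "\<exists>x\<in>Arr E. Cod E x = Cod E (poly_src (right_unitor E p)) \<and> pos_map (right_unitor E p) x = x'"
    by (intro bexI[of _ "mk_pos E p ?u x' (bang E (pb E x' p))"]) simp_all
next
  let ?u = "unit_poly E"
  fix x w w' assume x: "x \<in> Arr E" "Cod E x = Cod E (poly_src (right_unitor E p))" "w \<in> Arr E"
    "Cod E w = Dom E (poly_tgt (right_unitor E p))" "w' \<in> Arr E" "Cod E w' = Dom E (poly_tgt (right_unitor E p))"
    "Dom E w = Dom E x" "Dom E w' = Dom E x"
    "poly_tgt (right_unitor E p) \<cdot> w = pos_map (right_unitor E p) x" "poly_tgt (right_unitor E p) \<cdot> w' = pos_map (right_unitor E p) x"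
    and eq: "dir_map (right_unitor E p) x w = dir_map (right_unitor E p) x w'"
  show "w = w'"
    using arg_cong[OF eq, of "dir1 E p ?u"] x by simp
next
  let ?u = "unit_poly E"
  fix x y assume x: "x \<in> Arr E" "Cod E x = Cod E (poly_src (right_unitor E p))" "y \<in> Arr E"
    "Cod E y = Dom E (poly_src (right_unitor E p))" "Dom E y = Dom E x" "poly_src (right_unitor E p) \<cdot> y = x"
  then have "dir_map (right_unitor E p) x (dir1 E p ?u y) = y"
    by - (rule dir_eqI[of p ?u], simp_all)
  then show "\<exists>w\<in>Arr E. Cod E w = Dom E (poly_tgt (right_unitor E p)) \<and>
      poly_tgt (right_unitor E p) \<cdot> w = pos_map (right_unitor E p) x \<and> dir_map (right_unitor E p) x w = y"
    using x by (intro bexI[of _ "dir1 E p ?u y"]) simp_all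
qed simp

text \<open>Every direction of \<open>p \<triangleleft> q\<close> is the pair of its components, so
  functions on such directions and curried functions determine each other.\<close>

lemma associator_iso:
  assumes [simp]: "exponentiable E p" "exponentiable E q" "exponentiable E r"
  shows "is_iso (Poly E) (associator E p q r)"
proof -
  let ?\<alpha> = "associator E p q r" and ?pq = "comp_prod E p q" and ?qr = "comp_prod E q r"
  show ?thesis
  proof (rule Poly_isoI)
    fix x x' assume "x \<in> Arr E" "x' \<in> Arr E" "Dom E x = Dom E x'"
      "Cod E x = Cod E (poly_src ?\<alpha>)" "Cod E x' = Cod E (poly_src ?\<alpha>)"
      and eq: "pos_map ?\<alpha> x = pos_map ?\<alpha> x'"
    then have x [simp]: "x \<in> Arr E" "x' \<in> Arr E" "Dom E x = Dom E x'"
      "Cod E x = Cod E (comp_prod E ?pq r)" "Cod E x' = Cod E (comp_prod E ?pq r)"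
      by simp_all
    have eqt: "pos_map ?\<alpha> (x \<cdot> t) = pos_map ?\<alpha> (x' \<cdot> t)" if "t \<in> Arr E" "Cod E t = Dom E x'" for t
      using arg_cong[OF eq, of "\<lambda>a. a \<cdot> t"] that by simp
    have ff: "pos_fst p q (pos_fst ?pq r x) = pos_fst p q (pos_fst ?pq r x')"
      using arg_cong[OF eq, of "pos_fst p ?qr"] by simp
    have f1: "pos_fst p q (pos_fst ?pq r (x \<cdot> t)) = pos_fst p q (pos_fst ?pq r (x' \<cdot> t))" if "t \<in> Arr E" "Cod E t = Dom E x'" for t
      using arg_cong[OF eqt[OF that], of "pos_fst p ?qr"] that by simp
    have ap: "pos_app p q (pos_fst ?pq r (x \<cdot> t)) y = pos_app p q (pos_fst ?pq r (x' \<cdot> t)) y"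
      if "t \<in> Arr E" "Cod E t = Dom E x'" "y \<in> Arr E" "Cod E y = Dom E p" "Dom E y = Dom E t"
        "p \<cdot> y = pos_fst p q (pos_fst ?pq r (x' \<cdot> t))" for t y
      using arg_cong[OF eqt[OF that(1,2)], of "\<lambda>k. pos_fst q r (pos_app p ?qr k y)"] that f1[OF that(1,2)] by simp
    have f2: "pos_fst ?pq r x = pos_fst ?pq r x'"
      by (rule pos_eqI[of p q]) (simp_all add: ff ap)
    have f2t: "pos_fst ?pq r (x \<cdot> t) = pos_fst ?pq r (x' \<cdot> t)" if "t \<in> Arr E" "Cod E t = Dom E x'" for t
      using arg_cong[OF f2, of "\<lambda>a. a \<cdot> t"] that by simp
    show "x = x'"
    proof (rule pos_eqI[of ?pq r])
      fix t d assume t: "t \<in> Arr E" "Cod E t = Dom E x'" "d \<in> Arr E" "Cod E d = Dom E ?pq" "Dom E d = Dom E t"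
        "?pq \<cdot> d = pos_fst ?pq r (x' \<cdot> t)"
      \<comment> \<open>As \<open>d\<close> is the pair of its components, evaluating the common
        image at them gives the value at \<open>d\<close>.\<close>
      show "pos_app ?pq r (x \<cdot> t) d = pos_app ?pq r (x' \<cdot> t) d"
        using arg_cong[OF eqt[OF t(1,2)], of "\<lambda>k. pos_app q r (pos_app p ?qr k (dir1 E p q d)) (dir2 E p q d)"] t f2t[OF t(1,2)]
        by simp
    qed (simp_all add: f2)
  next
    fix x' assume "x' \<in> Arr E" "Cod E x' = Cod E (poly_tgt ?\<alpha>)"
    then have x' [simp]: "x' \<in> Arr E" "Cod E x' = Cod E (comp_prod E p ?qr)" by simp_all
    define x0 where "x0 = pos_fst p ?qr x'"
    have x0 [simp]: "x0 \<in> Arr E" "Dom E x0 = Dom E x'" "Cod E x0 = Cod E p" by (simp_all add: x0_def)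
    define y0 where "y0 = pb2 E x0 p"
    define b0 where "b0 = pb1 E x0 p"
    have [simp]: "y0 \<in> Arr E" "b0 \<in> Arr E" "Dom E y0 = pb E x0 p" "Dom E b0 = pb E x0 p" "Cod E y0 = Dom E p"
      "Cod E b0 = Dom E x'" "p \<cdot> y0 = pos_fst p ?qr (x' \<cdot> b0)"
      using pb_square[of x0 p] by (simp_all add: y0_def b0_def) (simp add: x0_def)
    \<comment> \<open>The preimage keeps the first component of each value of \<open>x'\<close> as
      its inner function.\<close>
    define f where "f = pos_fst q r (pos_app p ?qr (x' \<cdot> b0) y0)"
    have f [simp]: "f \<in> Arr E" "Dom E f = pb E x0 p" "Cod E f = Cod E q" by (simp_all add: f_def)
    have fu: "f \<cdot> pb_pair E x0 p t y = pos_fst q r (pos_app p ?qr (x' \<cdot> t) y)"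
      if "t \<in> Arr E" "Cod E t = Dom E x'" "y \<in> Arr E" "Cod E y = Dom E p" "Dom E y = Dom E t" "p \<cdot> y = x0 \<cdot> t" for t y
      using that by (simp add: f_def) (simp add: y0_def b0_def)
    define m where "m = mk_pos E p q x0 f"
    have m [simp]: "m \<in> Arr E" "Dom E m = Dom E x'" "Cod E m = Cod E ?pq" "pos_fst p q m = x0"
      "t \<in> Arr E \<Longrightarrow> Cod E t = Dom E x' \<Longrightarrow> pos_fst p q (m \<cdot> t) = x0 \<cdot> t" for t
      by (simp_all add: m_def)
    have mt: "pos_app p q (m \<cdot> t) y = pos_fst q r (pos_app p ?qr (x' \<cdot> t) y)"
      if "t \<in> Arr E" "Cod E t = Dom E x'" "y \<in> Arr E" "Cod E y = Dom E p" "Dom E y = Dom E t" "p \<cdot> y = x0 \<cdot> t" for t y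
      unfolding fu[OF that, symmetric] m_def by (rule mk_pos) (use that in simp_all)
    have x0t: "pos_fst p ?qr (x' \<cdot> t) = x0 \<cdot> t" if "t \<in> Arr E" "Cod E t = Dom E x'" for t
      using that by (simp add: x0_def)
    define d0 where "d0 = pb2 E m ?pq"
    define c0 where "c0 = pb1 E m ?pq"
    have d0 [simp]: "d0 \<in> Arr E" "c0 \<in> Arr E" "Dom E d0 = pb E m ?pq" "Dom E c0 = pb E m ?pq" "Cod E d0 = Dom E ?pq"
      "Cod E c0 = Dom E x'" "?pq \<cdot> d0 = m \<cdot> c0"
      using pb_square[of m ?pq] by (simp_all add: d0_def c0_def)
    \<comment> \<open>Uncurrying: the inner function of \<open>x'\<close> is applied to the two
      components of the generic direction.\<close>
    define g where "g = pos_app q r (pos_app p ?qr (x' \<cdot> c0) (dir1 E p q d0)) (dir2 E p q d0)"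
    have g [simp]: "g \<in> Arr E" "Dom E g = pb E m ?pq" "Cod E g = Cod E r" 
      by (simp_all add: g_def mt x0t)
    have gu: "g \<cdot> pb_pair E m ?pq t d = pos_app q r (pos_app p ?qr (x' \<cdot> t) (dir1 E p q d)) (dir2 E p q d)"
      if "t \<in> Arr E" "Cod E t = Dom E x'" "d \<in> Arr E" "Cod E d = Dom E ?pq" "Dom E d = Dom E t" "?pq \<cdot> d = m \<cdot> t" for t d
    proof -
      define u where "u = pb_pair E m ?pq t d"
      have [simp]: "u \<in> Arr E" "Dom E u = Dom E t" "Cod E u = pb E m ?pq" "c0 \<cdot> u = t" "d0 \<cdot> u = d"
        using that by (simp_all add: u_def c0_def d0_def)
      show ?thesis unfolding u_def[symmetric] by (simp add: g_def mt x0t)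
    qed
    define x where "x = mk_pos E ?pq r m g"
    have x [simp]: "x \<in> Arr E" "Dom E x = Dom E x'" "Cod E x = Cod E (comp_prod E ?pq r)" "pos_fst ?pq r x = m"
      "t \<in> Arr E \<Longrightarrow> Cod E t = Dom E x' \<Longrightarrow> pos_fst ?pq r (x \<cdot> t) = m \<cdot> t" for t
      by (simp_all add: x_def)
    have xt: "pos_app ?pq r (x \<cdot> t) d = pos_app q r (pos_app p ?qr (x' \<cdot> t) (dir1 E p q d)) (dir2 E p q d)"
      if "t \<in> Arr E" "Cod E t = Dom E x'" "d \<in> Arr E" "Cod E d = Dom E ?pq" "Dom E d = Dom E t" "?pq \<cdot> d = m \<cdot> t" for t d
      unfolding gu[OF that, symmetric] x_def by (rule mk_pos) (use that in simp_all)
    have "pos_map ?\<alpha> x = x'"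
      by (rule pos_eqI2[of p q r]) (simp_all add: x0t mt xt, simp add: x0_def)
    then show "\<exists>x\<in>Arr E. Cod E x = Cod E (poly_src ?\<alpha>) \<and> pos_map ?\<alpha> x = x'"
      by (intro bexI[of _ x]) simp_all
  next
    fix x w w' assume x: "x \<in> Arr E" "Cod E x = Cod E (poly_src ?\<alpha>)" "w \<in> Arr E" "Cod E w = Dom E (poly_tgt ?\<alpha>)"
      "w' \<in> Arr E" "Cod E w' = Dom E (poly_tgt ?\<alpha>)" "Dom E w = Dom E x" "Dom E w' = Dom E x"
      "poly_tgt ?\<alpha> \<cdot> w = pos_map ?\<alpha> x" "poly_tgt ?\<alpha> \<cdot> w' = pos_map ?\<alpha> x"
      and eq: "dir_map ?\<alpha> x w = dir_map ?\<alpha> x w'"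
    \<comment> \<open>The image is the rebracketed direction, so its three components are those of
      the original.\<close>
    have 1: "dir1 E p ?qr w = dir1 E p ?qr w'"
      using arg_cong[OF eq, of "\<lambda>e. dir1 E p q (dir1 E ?pq r e)"] x by simp
    have 2: "dir1 E q r (dir2 E p ?qr w) = dir1 E q r (dir2 E p ?qr w')"
      using arg_cong[OF eq, of "\<lambda>e. dir2 E p q (dir1 E ?pq r e)"] x by simp
    have 3: "dir2 E q r (dir2 E p ?qr w) = dir2 E q r (dir2 E p ?qr w')"
      using arg_cong[OF eq, of "dir2 E ?pq r"] x by simp
    have "dir2 E p ?qr w = dir2 E p ?qr w'"
      by (rule dir_eqI[of q r]) (use x 1 2 3 in simp_all)
    then show "w = w'"
      by - (rule dir_eqI[of p ?qr], use x 1 in simp_all)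
  next
    fix x e assume x: "x \<in> Arr E" "Cod E x = Cod E (poly_src ?\<alpha>)" "e \<in> Arr E"
      "Cod E e = Dom E (poly_src ?\<alpha>)" "Dom E e = Dom E x" "poly_src ?\<alpha> \<cdot> e = x"
    then have [simp]: "x \<in> Arr E" "Cod E x = Cod E (comp_prod E ?pq r)" "e \<in> Arr E"
      "Cod E e = Dom E (comp_prod E ?pq r)" "Dom E e = Dom E x" "comp_prod E ?pq r \<cdot> e = x"
      by simp_all
    define m where "m = dir1 E ?pq r e"
    have m [simp]: "m \<in> Arr E" "Dom E m = Dom E x" "Cod E m = Dom E ?pq" "?pq \<cdot> m = pos_fst ?pq r x"
      by (simp_all add: m_def)
    define z where "z = pos_app p ?qr (pos_map ?\<alpha> x) (dir1 E p q m)"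
    have z [simp]: "z \<in> Arr E" "Dom E z = Dom E x" "Cod E z = Cod E ?qr"
      "pos_fst q r z = pos_app p q (pos_fst ?pq r x) (dir1 E p q m)"
      "pos_app q r z (dir2 E p q m) = pos_app ?pq r x m"
      by (simp_all add: z_def)
    \<comment> \<open>\<open>v\<close> and \<open>w\<close> rebracket \<open>e\<close> from
      \<open>((y, z), u)\<close> to \<open>(y, (z, u))\<close>.\<close>
    define v where "v = mk_dir E q r z (dir2 E p q m) (dir2 E ?pq r e)"
    have v [simp]: "v \<in> Arr E" "Dom E v = Dom E x" "Cod E v = Dom E ?qr" "?qr \<cdot> v = z"
      "dir1 E q r v = dir2 E p q m" "dir2 E q r v = dir2 E ?pq r e"
      by (simp_all add: v_def) (simp_all add: m_def[symmetric])
    define w where "w = mk_dir E p ?qr (pos_map ?\<alpha> x) (dir1 E p q m) v"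
    have w [simp]: "w \<in> Arr E" "Dom E w = Dom E x" "Cod E w = Dom E (comp_prod E p ?qr)"
      "comp_prod E p ?qr \<cdot> w = pos_map ?\<alpha> x" "dir1 E p ?qr w = dir1 E p q m" "dir2 E p ?qr w = v"
      by (simp_all add: w_def z_def[symmetric])
    have "dir_map ?\<alpha> x w = e"
      by simp (simp add: m_def)
    then show "\<exists>w\<in>Arr E. Cod E w = Dom E (poly_tgt ?\<alpha>) \<and> poly_tgt ?\<alpha> \<cdot> w = pos_map ?\<alpha> x \<and> dir_map ?\<alpha> x w = e"
      by (intro bexI[of _ w]) simp_all
  qed simp
qed

end

theorem theorem3p26:
  fixes E :: "('o, 'm) cat"
  assumes "category E" and "has_finite_limits E"
  shows "monoidal_category (Poly E) (comp_prod_functor E) (unit_poly E)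
           (associator E) (left_unitor E) (right_unitor E)"
proof -
  interpret finlim E using assms by unfold_locales
  have [simp]: "FObj (comp_prod_functor E) (p, q) = comp_prod E p q"
    "FArr (comp_prod_functor E) (\<phi>, \<psi>) = comp_prod_arr E \<phi> \<psi>" for p q \<phi> \<psi>
    by (simp_all add: comp_prod_functor_def)
  show ?thesis
    unfolding monoidal_category_def Let_def
    by (simp add: Poly_category tensor_functor hom_def associator_iso left_unitor_iso right_unitor_iso
        assoc_natural left_unitor_natural right_unitor_natural pentagon triangle)
qed

end
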